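(* Let $\kappa$ be an algebraically closed, valued field. Every finite simple, three-regular, three-edge-connected planar graph $G$ has a tropical graph curve associated to it; that is, if $g$ is the genus of $G$, there is an arrangement of $2g-2$ tropical lines in $\mathbb{TP}^{g-1}$ whose union (with the topology induced from $\mathbb{TP}^{g-1}$) contains $G^{\rm top}$ as a deformation retract.
   Context: **Graphs.** $G^{\rm top}$ is the topological space underlying any geometric realisation of $G$ (one closed interval per edge, glued at the vertices). The genus $g$ of a connected graph is its first Betti number. **Tropical graph curve.** A tropical graph curve associated to a three-regular, connected, simple graph $G$ of genus $g$ is an arrangement of $2g-2$ tropical lines in $\mathbb{TP}^{g-1}$ (with the Euclidean topology) that contains $G$ (i.e. a homeomorphic copy of $G^{\rm top}$) as a deformation retract. **Tropical projective space.** $\mathbb{TP}^n$ is the quotient of $(\mathbb{R}\cup\{\infty\})^{n+1}\setminus\{(\infty,\dots,\infty)\}$ by the action of $\mathbb{R}$ given by $\lambda\odot(q_0,\dots,q_n)=(\lambda+q_0,\dots,\lambda+q_n)$, with its natural (Euclidean) topology; it is homeomorphic to an $n$-simplex. **Extended tropicalisation and tropical lines.** Let $I\subset\kappa[x_1,\dots,x_{n+1}]$ be a homogeneous ideal. For each proper subset $\mathcal V\subsetneq\{1,\dots,n+1\}$, let $\tilde I_{\mathcal V}\subset\kappa[x_j^{\pm1}\mid j\notin\mathcal V]$ be the ideal generated by the polynomials obtained from elements of $I$ by setting $x_j=0$ for $j\in\mathcal V$. For an ideal $J$ of a Laurent polynomial ring over $\kappa$, ${\rm trop}(J)$ is the set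 of real vectors $w$ such that for every nonzero $f=\sum_a c_a x^a\in J$ the minimum of ${\rm val}(c_a)+w\cdot a$ over $a$ with $c_a\neq0$ is attained at least twice. The extended tropicalisation ${\rm tropproj}(I)\subset\mathbb{TP}^n$ is the union over all $\mathcal V$ of ${\rm trop}(\tilde I_{\mathcal V})$ modulo $\mathbb{R}(1,\dots,1)$, placed in the stratum of $\mathbb{TP}^n$ where exactly the coordinates in $\mathcal V$ are $\infty$. A tropical line in $\mathbb{TP}^n$ is ${\rm tropproj}(I)$ for $I$ the defining ideal of a line in $\mathbb{P}^n_\kappa$. *)

theory Defs
  imports
    "HOL-Analysis.Analysis"
    "HOL-Algebra.Ideal"
    "HOL-Library.Poly_Mapping"
    "HOL-Library.Function_Algebras"
    "HOL-Computational_Algebra.Polynomial"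
begin

section \<open>Graphs\<close>

definition finite_simple_graph :: "'v set \<Rightarrow> 'v set set \<Rightarrow> bool" where
  "finite_simple_graph V E \<longleftrightarrow> finite V \<and> (\<forall>e\<in>E. e \<subseteq> V \<and> card e = 2)"

definition regular_graph :: "nat \<Rightarrow> 'v set \<Rightarrow> 'v set set \<Rightarrow> bool" where
  "regular_graph k V E \<longleftrightarrow> (\<forall>v\<in>V. card {e\<in>E. v \<in> e} = k)"

definition connected_graph :: "'v set \<Rightarrow> 'v set set \<Rightarrow> bool" where
  "connected_graph V E \<longleftrightarrow> V \<noteq> {} \<and> (\<forall>u\<in>V. \<forall>v\<in>V. (u, v) \<in> {(a, b). {a, b} \<in> E}\<^sup>*)"

definition edge_connected :: "nat \<Rightarrow> 'v set \<Rightarrow> 'v set set \<Rightarrow> bool" where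
  "edge_connected k V E \<longleftrightarrow>
     card V > 1 \<and> (\<forall>F. F \<subseteq> E \<and> finite F \<and> card F < k \<longrightarrow> connected_graph V (E - F))"

text \<open>
  The geometric realisation in barycentric coordinates: inside the space of functions on \<open>V\<close>,
  the vertex \<open>v\<close> is the standard basis vector at \<open>v\<close>, and an edge \<open>{u, v}\<close> is the closed
  segment joining the basis vectors at \<open>u\<close> and \<open>v\<close>.
\<close>
definition graph_realisation :: "'v set \<Rightarrow> 'v set set \<Rightarrow> ('v \<Rightarrow> real) topology" where
  "graph_realisation V E =
     subtopology (powertop_real V)
       {x \<in> V \<rightarrow>\<^sub>E {0..1}. (\<Sum>v\<in>V. x v) = 1 \<and>
          {v\<in>V. x v \<noteq> 0} \<in> E \<union> (\<lambda>v. {v}) ` V}"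

definition planar_graph :: "'v set \<Rightarrow> 'v set set \<Rightarrow> bool" where
  "planar_graph V E \<longleftrightarrow>
     (\<exists>f. embedding_map (graph_realisation V E) (euclidean :: complex topology) f)"

text \<open>
  The kernel of the boundary map \<open>C\<^sub>1 \<rightarrow> C\<^sub>0\<close> with real coefficients, that is \<open>H\<^sub>1\<close> of the graph.
  A 1-chain is a function on ordered pairs that is antisymmetric and supported on the edges.
\<close>
definition cycle_space :: "'v set \<Rightarrow> 'v set set \<Rightarrow> ('v \<times> 'v \<Rightarrow> real) set" where
  "cycle_space V E =
     {f. (\<forall>u v. f (v, u) = - f (u, v)) \<and> (\<forall>u v. {u, v} \<notin> E \<longrightarrow> f (u, v) = 0) \<and>
         (\<forall>u\<in>V. (\<Sum>v\<in>V. f (u, v)) = 0)}"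

definition genus :: "'v set \<Rightarrow> 'v set set \<Rightarrow> nat" where
  "genus V E =
     vector_space.dim (\<lambda>(c :: real) (f :: 'v \<times> 'v \<Rightarrow> real) p. c * f p) (cycle_space V E)"

lemma vector_space_fun: "vector_space (\<lambda>(c :: real) (f :: 'a \<Rightarrow> real) p. c * f p)"
  by unfold_locales (auto simp: fun_eq_iff algebra_simps)


section \<open>Deformation retracts\<close>

text \<open>The homotopy from the identity to the retraction is required to fix \<open>S\<close> pointwise at all
  times (a strong deformation retraction).\<close>
definition deformation_retract_of_space :: "'a set \<Rightarrow> 'a topology \<Rightarrow> bool" where
  "deformation_retract_of_space S X \<longleftrightarrow>
     S \<subseteq> topspace X \<and>
     (\<exists>r. retraction_maps X (subtopology X S) r id \<and>
          homotopic_with (\<lambda>h. \<forall>x\<in>S. h x = x) X X id r)"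


section \<open>Tropical projective space\<close>

definition quotient_topology :: "'a topology \<Rightarrow> ('a \<times> 'a) set \<Rightarrow> 'a set topology" where
  "quotient_topology X R = topology (\<lambda>U. U \<subseteq> topspace X // R \<and> openin X (\<Union>U))"

lemma openin_quotient_topology:
  assumes "equiv (topspace X) R"
  shows "openin (quotient_topology X R) U \<longleftrightarrow> U \<subseteq> topspace X // R \<and> openin X (\<Union>U)"
proof -
  have Int: "\<Union>(U \<inter> W) = \<Union>U \<inter> \<Union>W"
    if "U \<subseteq> topspace X // R" "W \<subseteq> topspace X // R" for U W
    using that quotient_disj [OF assms] by fast
  have Un: "\<Union>(\<Union>K) = (\<Union>U\<in>K. \<Union>U)" for K :: "'a set set set"
    by blast
  have "istopology (\<lambda>U. U \<subseteq> topspace X // R \<and> openin X (\<Union>U))"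
    unfolding istopology_def
  proof (intro conjI allI impI)
    fix U W
    assume U: "U \<subseteq> topspace X // R \<and> openin X (\<Union>U)"
      and W: "W \<subseteq> topspace X // R \<and> openin X (\<Union>W)"
    then show "U \<inter> W \<subseteq> topspace X // R" by blast
    show "openin X (\<Union>(U \<inter> W))"
      using U W Int [of U W] openin_Int by metis
  next
    fix K assume K: "\<forall>U\<in>K. U \<subseteq> topspace X // R \<and> openin X (\<Union>U)"
    then show "\<Union>K \<subseteq> topspace X // R" by blast
    show "openin X (\<Union>(\<Union>K))"
      using K unfolding Un by (intro openin_Union) auto
  qed
  then show ?thesis
    by (simp add: quotient_topology_def topology_inverse')
qed

text \<open>\<open>(\<real> \<union> {\<infinity>})\<^bsup>n+1\<^esup> - {(\<infinity>,\<dots>,\<infinity>)}\<close>, with coordinates indexed by \<open>{..n}\<close>.\<close>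
definition TP_coords :: "nat \<Rightarrow> (nat \<Rightarrow> ereal) topology" where
  "TP_coords n =
     subtopology (product_topology (\<lambda>_. top_of_set {-\<infinity><..}) {..n}) {q. \<exists>i\<le>n. q i \<noteq> \<infinity>}"

definition TP_rel :: "nat \<Rightarrow> ((nat \<Rightarrow> ereal) \<times> (nat \<Rightarrow> ereal)) set" where
  "TP_rel n = {(p, q). p \<in> topspace (TP_coords n) \<and> q \<in> topspace (TP_coords n) \<and>
                 (\<exists>c::real. \<forall>i\<le>n. q i = ereal c + p i)}"

definition TP :: "nat \<Rightarrow> (nat \<Rightarrow> ereal) set topology" where
  "TP n = quotient_topology (TP_coords n) (TP_rel n)"

lemma equiv_TP_rel: "equiv (topspace (TP_coords n)) (TP_rel n)"
proof (rule equivI)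
  show "TP_rel n \<subseteq> topspace (TP_coords n) \<times> topspace (TP_coords n)"
    by (auto simp: TP_rel_def)
  show "refl_on (topspace (TP_coords n)) (TP_rel n)"
    by (auto simp: refl_on_def TP_rel_def intro!: exI [of _ 0] simp flip: zero_ereal_def)
  show "sym (TP_rel n)"
  proof (rule symI, unfold TP_rel_def, clarsimp)
    fix p q :: "nat \<Rightarrow> ereal" and c :: real
    have "x = ereal (- c) + (ereal c + x)" for x
      by (cases x) auto
    then show "\<exists>d. \<forall>i\<le>n. p i = ereal d + (ereal c + p i)"
      by blast
  qed
  show "trans (TP_rel n)"
  proof (rule transI, unfold TP_rel_def, clarsimp)
    fix p q :: "nat \<Rightarrow> ereal" and c d :: real
    have "ereal d + (ereal c + x) = ereal (d + c) + x" for x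
      by (cases x) auto
    then show "\<exists>e. \<forall>i\<le>n. ereal d + (ereal c + p i) = ereal e + p i"
      by blast
  qed
qed


section \<open>Polynomials and Laurent polynomials\<close>

text \<open>
  The polynomials in the variables \<open>x\<^sub>i\<close>, \<open>i \<in> S\<close>, if exponents are of type \<open>nat\<close>, and the
  Laurent polynomials in these variables, if exponents are of type \<open>int\<close>.
\<close>
definition poly_ring :: "nat set \<Rightarrow> ((nat \<Rightarrow>\<^sub>0 'm::comm_monoid_add) \<Rightarrow>\<^sub>0 'k::comm_ring_1) ring" where
  "poly_ring S =
     \<lparr>carrier = {f. \<forall>a\<in>Poly_Mapping.keys f. Poly_Mapping.keys a \<subseteq> S},
      monoid.mult = (*), one = 1, zero = 0, add = (+)\<rparr>"

type_synonym 'k mpoly = "(nat \<Rightarrow>\<^sub>0 nat) \<Rightarrow>\<^sub>0 'k"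
type_synonym 'k laurent = "(nat \<Rightarrow>\<^sub>0 int) \<Rightarrow>\<^sub>0 'k"

lemma cring_poly_ring:
  "cring (poly_ring S :: ((nat \<Rightarrow>\<^sub>0 'm::comm_monoid_add) \<Rightarrow>\<^sub>0 'k::comm_ring_1) ring)"
proof -
  let ?R = "poly_ring S :: ((nat \<Rightarrow>\<^sub>0 'm) \<Rightarrow>\<^sub>0 'k) ring"
  have ops: "f \<oplus>\<^bsub>?R\<^esub> g = f + g" "f \<otimes>\<^bsub>?R\<^esub> g = f * g" "\<zero>\<^bsub>?R\<^esub> = 0" "\<one>\<^bsub>?R\<^esub> = 1" for f g
    by (simp_all add: poly_ring_def)
  have carrier: "f \<in> carrier ?R \<longleftrightarrow> (\<forall>a\<in>Poly_Mapping.keys f. Poly_Mapping.keys a \<subseteq> S)" for f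
    by (simp add: poly_ring_def)
  have zero: "0 \<in> carrier ?R" and one: "1 \<in> carrier ?R"
    unfolding carrier by simp_all
  have add: "f + g \<in> carrier ?R" if "f \<in> carrier ?R" "g \<in> carrier ?R" for f g
    using that Poly_Mapping.keys_add [of f g] unfolding carrier by blast
  have mult: "f * g \<in> carrier ?R" if fg: "f \<in> carrier ?R" "g \<in> carrier ?R" for f g
    unfolding carrier
  proof
    fix c assume "c \<in> Poly_Mapping.keys (f * g)"
    then obtain a b where "c = a + b" "a \<in> Poly_Mapping.keys f" "b \<in> Poly_Mapping.keys g"
      using Poly_Mapping.keys_mult [of f g] by blast
    then show "Poly_Mapping.keys c \<subseteq> S"
      using fg Poly_Mapping.keys_add [of a b] unfolding carrier by blast
  qed
  have uminus: "- f \<in> carrier ?R" if "f \<in> carrier ?R" for f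
    using that unfolding carrier by simp
  have inverse: "\<exists>g\<in>carrier ?R. g \<oplus>\<^bsub>?R\<^esub> f = \<zero>\<^bsub>?R\<^esub>" if "f \<in> carrier ?R" for f
    using uminus [OF that] by (intro bexI [of _ "- f"]) (simp_all add: ops)
  show ?thesis
  proof (rule cringI)
    show "abelian_group ?R"
      by (rule abelian_groupI) (use inverse in \<open>simp_all add: ops zero add ac_simps\<close>)
    show "comm_monoid ?R"
      by (rule comm_monoidI) (simp_all add: ops one mult ac_simps)
  qed (simp add: ops distrib_right)
qed

definition mpoly_eval :: "'k::comm_ring_1 mpoly \<Rightarrow> (nat \<Rightarrow> 'k) \<Rightarrow> 'k" where
  "mpoly_eval f x =
     (\<Sum>a\<in>Poly_Mapping.keys f. Poly_Mapping.lookup f a *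
        (\<Prod>i\<in>Poly_Mapping.keys a. x i ^ Poly_Mapping.lookup a i))"

text \<open>Set \<open>x\<^sub>j = 0\<close> for \<open>j \<in> U\<close>, and regard the result as a Laurent polynomial.\<close>
definition set_zero :: "nat set \<Rightarrow> 'k::comm_ring_1 mpoly \<Rightarrow> 'k laurent" where
  "set_zero U f =
     (\<Sum>a\<in>{a \<in> Poly_Mapping.keys f. Poly_Mapping.keys a \<inter> U = {}}.
        Poly_Mapping.single (Poly_Mapping.map int a) (Poly_Mapping.lookup f a))"

definition stratum_ideal :: "nat \<Rightarrow> nat set \<Rightarrow> 'k::comm_ring_1 mpoly set \<Rightarrow> 'k laurent set" where
  "stratum_ideal n U I = Idl\<^bsub>poly_ring ({..n} - U)\<^esub> (set_zero U ` I)"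


section \<open>Tropicalisation\<close>

text \<open>A valuation with values in \<open>\<real> \<union> {\<infinity>}\<close>; the trivial valuation is allowed.\<close>
definition real_valuation :: "('k::field \<Rightarrow> ereal) \<Rightarrow> bool" where
  "real_valuation val \<longleftrightarrow>
     (\<forall>x. val x \<noteq> -\<infinity>) \<and> (\<forall>x. val x = \<infinity> \<longleftrightarrow> x = 0) \<and>
     (\<forall>x y. val (x * y) = val x + val y) \<and> (\<forall>x y. min (val x) (val y) \<le> val (x + y))"

definition trop_weight :: "('k::field \<Rightarrow> ereal) \<Rightarrow> nat set \<Rightarrow> (nat \<Rightarrow> real) \<Rightarrow> 'k laurent \<Rightarrow>
    (nat \<Rightarrow>\<^sub>0 int) \<Rightarrow> ereal" where
  "trop_weight val S w f a =
     val (Poly_Mapping.lookup f a) + ereal (\<Sum>i\<in>S. w i * of_int (Poly_Mapping.lookup a i))"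

definition trop :: "('k::field \<Rightarrow> ereal) \<Rightarrow> nat set \<Rightarrow> 'k laurent set \<Rightarrow> (nat \<Rightarrow> real) set" where
  "trop val S J =
     {w \<in> S \<rightarrow>\<^sub>E UNIV. \<forall>f\<in>J. f \<noteq> 0 \<longrightarrow>
        (\<exists>a\<in>Poly_Mapping.keys f. \<exists>b\<in>Poly_Mapping.keys f. a \<noteq> b \<and>
           trop_weight val S w f a = trop_weight val S w f b \<and>
           (\<forall>c\<in>Poly_Mapping.keys f. trop_weight val S w f a \<le> trop_weight val S w f c))}"

text \<open>The point of \<open>TP n\<close> with coordinates \<open>\<infinity>\<close> on \<open>U\<close> and \<open>w\<close> elsewhere.\<close>
definition TP_point :: "nat \<Rightarrow> nat set \<Rightarrow> (nat \<Rightarrow> real) \<Rightarrow> (nat \<Rightarrow> ereal) set" where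
  "TP_point n U w = TP_rel n `` {\<lambda>i\<in>{..n}. if i \<in> U then \<infinity> else ereal (w i)}"

definition tropproj :: "('k::field \<Rightarrow> ereal) \<Rightarrow> nat \<Rightarrow> 'k mpoly set \<Rightarrow> (nat \<Rightarrow> ereal) set set" where
  "tropproj val n I =
     (\<Union>U\<in>{U. U \<subset> {..n}}. TP_point n U ` trop val ({..n} - U) (stratum_ideal n U I))"

text \<open>
  The defining ideal of the line in projective \<open>n\<close>-space through the points with homogeneous
  coordinates \<open>u\<close> and \<open>v\<close>: all polynomials vanishing at all homogeneous coordinates of all
  points of the line.
\<close>
definition line_ideal :: "nat \<Rightarrow> (nat \<Rightarrow> 'k::field) \<Rightarrow> (nat \<Rightarrow> 'k) \<Rightarrow> 'k mpoly set" where
  "line_ideal n u v =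
     {f \<in> carrier (poly_ring {..n}). \<forall>s t. (s, t) \<noteq> (0, 0) \<longrightarrow> mpoly_eval f (\<lambda>i. s * u i + t * v i) = 0}"

definition tropical_lines :: "('k::field \<Rightarrow> ereal) \<Rightarrow> nat \<Rightarrow> (nat \<Rightarrow> ereal) set set set" where
  "tropical_lines val n =
     {tropproj val n (line_ideal n u v) | u v.
        \<forall>s t. (\<forall>i\<le>n. s * u i + t * v i = 0) \<longrightarrow> s = 0 \<and> t = 0}"


section \<open>Tropical graph curves\<close>

definition tropical_graph_curve ::
    "('k::field \<Rightarrow> ereal) \<Rightarrow> 'v set \<Rightarrow> 'v set set \<Rightarrow> (nat \<Rightarrow> ereal) set set set \<Rightarrow> bool" where
  "tropical_graph_curve val V E \<A> \<longleftrightarrow>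
     (let g = genus V E; X = subtopology (TP (g - 1)) (\<Union>\<A>) in
        finite \<A> \<and> card \<A> = 2 * g - 2 \<and> \<A> \<subseteq> tropical_lines val (g - 1) \<and>
        (\<exists>S. deformation_retract_of_space S X \<and>
             subtopology X S homeomorphic_space graph_realisation V E))"

end

theory Submission
  imports
    Defs
    "HOL-Computational_Algebra.Formal_Laurent_Series"
    "HOL-Computational_Algebra.Polynomial_FPS"
begin

text \<open>
  Give every edge \<open>e\<close> a nonempty set \<open>T e\<close> of coordinates
  such that at each vertex \<open>v\<close> every coordinate lies in exactly two of the three sets or in none, and let
  \<open>S v\<close> be the union of the three sets. The sets \<open>S v - T e\<close> partition \<open>S v\<close>; making the coordinates in
  one part equal, and the values on the three parts a solution of \<open>z\<^sub>0 + z\<^sub>1 + z\<^sub>2 = 0\<close>, gives a line whose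
  tropicalisation is a star: its centre is \<open>0\<close> on \<open>S v\<close> and \<open>\<infinity>\<close> elsewhere, and its arms end at the
  points that are \<open>0\<close> on \<open>T e\<close> and \<open>\<infinity>\<close> elsewhere. If the sets \<open>T e\<close> are distinct, the sets \<open>S v\<close> are
  distinct, and \<open>S v = T e\<close> happens only for \<open>v \<in> e\<close>, these stars fit together to a copy of the graph.

  The coordinates are the edges outside a spanning tree, and \<open>T e\<close> consists of those whose fundamental
  cycle contains \<open>e\<close>. Distinct edges have distinct \<open>T e\<close> since there are no edge cuts of size at most
  two. The sets \<open>S v\<close> are separated if every edge that leads from a vertex \<open>v\<close> away from the root leads,
  after at most one edge outside the tree, out of the set of descendants of \<open>v\<close>; a connectivity
  argument with cuts constructs such a tree recursively.
\<close>

section \<open>Branching spanning trees\<close>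

text \<open>The distinctness of the sets \<open>S v\<close> decides which spanning trees can be
  used. For the complete graph on four vertices with a Hamiltonian path as tree, the two inner
  vertices of the path have the same \<open>S v\<close>; the culprit is an edge outside the tree
  that joins a vertex to one of its descendants. \<open>branching_tree\<close> forbids such edges
  and asks in addition for an exit from every subtree.

  The coincidence \<open>S v = T e\<close> does occur, and for the trees used here it always occurs
  at the root. One arm of the star then shrinks to its centre, and the edge \<open>e\<close> is
  covered by the arm from its other end.

  A lower bound for the tropicalisation needs points of prescribed valuation on the line, and a
  trivial valuation need not provide them over the ground field. The points are therefore Laurent
  series in a new variable that is given the valuation wanted. The upper bound comes from linear
  forms with at most three terms.

  There are \<open>g\<close> edges outside a spanning tree, one for each homogeneous coordinate, and
  \<open>3 * card V = 2 * card E\<close> turns this into \<open>2 * g - 2\<close> vertices, one line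
  for each.\<close>

locale cubic_graph =
  fixes V :: "'v set" and E :: "'v set set"
  assumes finite_V: "finite V"
    and edge_subset: "e \<in> E \<Longrightarrow> e \<subseteq> V"
    and card_edge: "e \<in> E \<Longrightarrow> card e = 2"
    and degree: "v \<in> V \<Longrightarrow> card {e \<in> E. v \<in> e} = 3"
    and card_cut: "X \<subseteq> V \<Longrightarrow> X \<noteq> {} \<Longrightarrow> X \<noteq> V \<Longrightarrow> 3 \<le> card {e \<in> E. e \<inter> X \<noteq> {} \<and> \<not> e \<subseteq> X}"
begin

section \<open>Cuts, connected sets and components\<close>

definition cut :: "'v set \<Rightarrow> 'v set set" where
  "cut X = {e \<in> E. e \<inter> X \<noteq> {} \<and> \<not> e \<subseteq> X}"

text \<open>Connectivity is expressed by cuts instead of walks, since the hypothesis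
  \<open>card_cut\<close> speaks of cuts and the extremal arguments below need nothing else.\<close>

definition conn :: "'v set \<Rightarrow> bool" where
  "conn D \<longleftrightarrow> D \<noteq> {} \<and> (\<forall>A. A \<subseteq> D \<longrightarrow> A \<noteq> {} \<longrightarrow> A \<noteq> D \<longrightarrow> (\<exists>a\<in>A. \<exists>b\<in>D - A. {a, b} \<in> E))"

text \<open>For \<open>x\<close> outside \<open>D\<close> this is the empty set; the proof of
  \<open>partition_between_neighbours\<close> relies on that value.\<close>

definition component :: "'v set \<Rightarrow> 'v \<Rightarrow> 'v set" where
  "component D x = \<Union>{K. conn K \<and> x \<in> K \<and> K \<subseteq> D}"

lemma finite_E: "finite E"
  using finite_V edge_subset by (meson Sup_le_iff finite_UnionD finite_subset)

lemma card_cut_ge: "X \<subseteq> V \<Longrightarrow> X \<noteq> {} \<Longrightarrow> X \<noteq> V \<Longrightarrow> 3 \<le> card (cut X)"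
  unfolding cut_def by (rule card_cut)

lemma finite_cut: "finite (cut X)"
  using finite_E unfolding cut_def by simp

lemma edgeE:
  assumes "e \<in> E" obtains u v where "e = {u, v}" "u \<noteq> v" "u \<in> V" "v \<in> V"
  using card_edge[OF assms] edge_subset[OF assms] by (auto simp: card_2_iff)

lemma edgeE':
  assumes "e \<in> E" "u \<in> e" obtains v where "e = {u, v}" "u \<noteq> v" "u \<in> V" "v \<in> V"
  using edgeE[OF assms(1)] assms(2) by (metis insertE insert_commute singletonD)

lemma adj_V: "{u, v} \<in> E \<Longrightarrow> u \<in> V" "{u, v} \<in> E \<Longrightarrow> v \<in> V"
  using edge_subset by blast+

lemma adj_neq: "{u, v} \<in> E \<Longrightarrow> u \<noteq> v"
  using card_edge by fastforce

lemma cutI: "{a, b} \<in> E \<Longrightarrow> a \<in> X \<Longrightarrow> b \<notin> X \<Longrightarrow> {a, b} \<in> cut X"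
  unfolding cut_def by auto

lemma cutE:
  assumes "e \<in> cut X" obtains a b where "e = {a, b}" "{a, b} \<in> E" "a \<in> X" "b \<notin> X" "b \<in> V"
proof -
  have "e \<in> E" using assms by (simp add: cut_def)
  then obtain u v where "e = {u, v}" "u \<in> V" "v \<in> V" by (rule edgeE)
  then show ?thesis
    using assms that[of u v] that[of v u] by (auto simp: cut_def insert_commute)
qed

lemma cut_pair: "{a, b} \<in> cut X \<longleftrightarrow> {a, b} \<in> E \<and> (a \<in> X \<longleftrightarrow> b \<notin> X)"
  unfolding cut_def by auto

lemma connE:
  assumes "conn D" "A \<subseteq> D" "A \<noteq> {}" "A \<noteq> D"
  obtains a b where "a \<in> A" "b \<in> D" "b \<notin> A" "{a, b} \<in> E"
  using assms unfolding conn_def by (metis Diff_iff)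

lemma conn_singleton: "conn {x}"
  unfolding conn_def by (metis insert_not_empty subset_singletonD)

lemma conn_insert:
  assumes "conn D" "a \<in> D" "{a, b} \<in> E" shows "conn (insert b D)"
  unfolding conn_def
proof (intro conjI allI impI)
  fix A assume A: "A \<subseteq> insert b D" "A \<noteq> {}" "A \<noteq> insert b D"
  show "\<exists>x\<in>A. \<exists>y\<in>insert b D - A. {x, y} \<in> E"
  proof (cases "b \<in> A")
    case False
    then have "A \<subseteq> D" using A by auto
    show ?thesis
    proof (cases "A = D")
      case True then show ?thesis using assms False by auto
    next
      case False
      then have "\<exists>x\<in>A. \<exists>y\<in>D - A. {x, y} \<in> E"
        using \<open>A \<subseteq> D\<close> A(2) assms(1) unfolding conn_def by auto
      then show ?thesis by blast
    qed
  next
    case True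
    show ?thesis
    proof (cases "a \<in> A")
      case False then show ?thesis using True assms by (metis Diff_iff insert_commute insert_iff)
    next
      case a: True
      have "A \<inter> D \<noteq> D" "A \<inter> D \<noteq> {}" using A True a assms(2) by auto
      then have "\<exists>x\<in>A \<inter> D. \<exists>y\<in>D - A \<inter> D. {x, y} \<in> E"
        using assms(1) unfolding conn_def by (metis Int_lower2)
      then show ?thesis by blast
    qed
  qed
qed simp

text \<open>Some member is properly cut by \<open>A\<close>: if \<open>x\<close> lies in
  \<open>A\<close>, a member not contained in \<open>A\<close>; otherwise any member that meets
  \<open>A\<close>, because it contains \<open>x\<close>.\<close>

lemma conn_Union:
  assumes "\<And>K. K \<in> F \<Longrightarrow> conn K \<and> x \<in> K" "F \<noteq> {}" shows "conn (\<Union>F)"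
  unfolding conn_def
proof (intro conjI allI impI)
  show "\<Union>F \<noteq> {}" using assms by blast
  fix A assume A: "A \<subseteq> \<Union>F" "A \<noteq> {}" "A \<noteq> \<Union>F"
  have "\<exists>K\<in>F. A \<inter> K \<noteq> {} \<and> A \<inter> K \<noteq> K"
  proof (cases "x \<in> A")
    case True then show ?thesis using A assms(1) by fastforce
  next
    case False
    obtain a K where a: "a \<in> A" "K \<in> F" "a \<in> K" using A(1,2) by blast
    moreover have "x \<in> K" using assms(1) a by blast
    ultimately show ?thesis using False by blast
  qed
  then obtain K where K: "K \<in> F" "A \<inter> K \<noteq> {}" "A \<inter> K \<noteq> K" by blast
  then have "\<exists>a\<in>A \<inter> K. \<exists>b\<in>K - A \<inter> K. {a, b} \<in> E"
    using assms(1)[OF K(1)] unfolding conn_def by (metis Int_lower2)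
  then show "\<exists>a\<in>A. \<exists>b\<in>\<Union>F - A. {a, b} \<in> E" using K by blast
qed

lemma component_subset: "component D x \<subseteq> D"
  unfolding component_def by auto

lemma component_upper: "conn K \<Longrightarrow> x \<in> K \<Longrightarrow> K \<subseteq> D \<Longrightarrow> K \<subseteq> component D x"
  unfolding component_def by auto

lemma component_self: "x \<in> D \<Longrightarrow> x \<in> component D x"
  using component_upper[OF conn_singleton] by auto

lemma conn_component: "x \<in> D \<Longrightarrow> conn (component D x)"
  unfolding component_def using conn_singleton by (intro conn_Union[where x = x]) auto

lemma component_empty: "x \<notin> D \<Longrightarrow> component D x = {}"
  unfolding component_def by auto

text \<open>Adding \<open>b\<close> keeps the component connected, and the component is the largest
  connected set.\<close>

lemma component_closed:
  assumes "a \<in> component D x" "b \<in> D" "{a, b} \<in> E" shows "b \<in> component D x"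
proof -
  have "x \<in> D" using assms(1) component_empty by auto
  then have "insert b (component D x) \<subseteq> component D x"
    using assms component_subset component_self
    by (intro component_upper conn_insert[OF conn_component]) auto
  then show ?thesis by simp
qed

section \<open>Splitting a connected set into two connected parts with exits\<close>

lemma extend_to_partition:
  assumes "finite H" "conn A0" "conn B0" "A0 \<inter> B0 = {}" "A0 \<subseteq> H" "B0 \<subseteq> H"
    and "\<And>R. R \<subseteq> H \<Longrightarrow> R \<noteq> {} \<Longrightarrow> R \<inter> (A0 \<union> B0) = {} \<Longrightarrow> \<exists>a\<in>R. \<exists>b\<in>H - R. {a, b} \<in> E"
  shows "\<exists>A B. A0 \<subseteq> A \<and> B0 \<subseteq> B \<and> conn A \<and> conn B \<and> A \<inter> B = {} \<and> A \<union> B = H"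
  using assms
proof (induction "card (H - (A0 \<union> B0))" arbitrary: A0 B0 rule: less_induct)
  case less
  show ?case
  proof (cases "A0 \<union> B0 = H")
    case True then show ?thesis using less.prems by blast
  next
    case False
    then have "H - (A0 \<union> B0) \<noteq> {}" using less.prems by blast
    \<comment> \<open>Greedy growth: the last hypothesis, applied to everything not yet assigned,
      yields a vertex \<open>a\<close> adjacent to one of the two sets, which it then joins.\<close>
    then obtain a b where ab: "a \<in> H - (A0 \<union> B0)" "b \<in> A0 \<union> B0" "{a, b} \<in> E"
      using less.prems(7)[of "H - (A0 \<union> B0)"] less.prems(5,6) by blast
    have ba: "{b, a} \<in> E" using ab by (simp add: insert_commute)
    have smaller: "card (H - (insert a (A0 \<union> B0))) < card (H - (A0 \<union> B0))"
      using ab less.prems(1) by (intro psubset_card_mono) auto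
    show ?thesis
    proof (cases "b \<in> A0")
      case True
      have "\<exists>A B. insert a A0 \<subseteq> A \<and> B0 \<subseteq> B \<and> conn A \<and> conn B \<and> A \<inter> B = {} \<and> A \<union> B = H"
      proof (rule less.hyps)
        show "card (H - (insert a A0 \<union> B0)) < card (H - (A0 \<union> B0))" using smaller by simp
        show "conn (insert a A0)" using conn_insert less.prems True ba by blast
      qed (use less.prems ab in auto)
      then show ?thesis by blast
    next
      case False
      have "\<exists>A B. A0 \<subseteq> A \<and> insert a B0 \<subseteq> B \<and> conn A \<and> conn B \<and> A \<inter> B = {} \<and> A \<union> B = H"
      proof (rule less.hyps)
        show "card (H - (A0 \<union> insert a B0)) < card (H - (A0 \<union> B0))" using smaller by simp
        show "conn (insert a B0)" using conn_insert less.prems False ab ba by blast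
      qed (use less.prems ab in auto)
      then show ?thesis by blast
    qed
  qed
qed

text \<open>The edges at \<open>u\<close> are shared out between the cuts of \<open>Z\<close> and of \<open>insert u Z\<close>, so these two
  cuts have at most \<open>1 + 1 + 3 < 3 + 3\<close> edges together.\<close>
lemma cut_next_to_vertex:
  assumes "cut Z \<subseteq> insert f {e \<in> E. u \<in> e}" "u \<in> V - Z" "Z \<subseteq> V" "Z \<noteq> {}" "insert u Z \<noteq> V"
  shows False
proof -
  let ?M = "{e \<in> E. u \<in> e}"
  have 1: "cut Z \<subseteq> insert f {e \<in> ?M. e \<inter> Z \<noteq> {}}"
    using assms(1) by (auto simp: cut_def)
  have 2: "cut (insert u Z) \<subseteq> insert f {e \<in> ?M. e \<inter> Z = {}}"
  proof
    fix e assume "e \<in> cut (insert u Z)"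
    then obtain a b where ab: "e = {a, b}" "{a, b} \<in> E" "a \<in> insert u Z" "b \<notin> insert u Z"
      by (rule cutE)
    show "e \<in> insert f {e \<in> ?M. e \<inter> Z = {}}"
    proof (cases "a = u")
      case True then show ?thesis using ab assms(2) by auto
    next
      case False
      then have "e \<in> cut Z" using ab cutI by auto
      then show ?thesis using assms(1) ab False by auto
    qed
  qed
  have "card (cut Z) \<le> card (insert f {e \<in> ?M. e \<inter> Z \<noteq> {}})"
    using 1 finite_E by (intro card_mono) auto
  also have "\<dots> \<le> Suc (card {e \<in> ?M. e \<inter> Z \<noteq> {}})"
    by (rule card_insert_le_m1) auto
  finally have c1: "card (cut Z) \<le> Suc (card {e \<in> ?M. e \<inter> Z \<noteq> {}})" .
  have "card (cut (insert u Z)) \<le> card (insert f {e \<in> ?M. e \<inter> Z = {}})"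
    using 2 finite_E by (intro card_mono) auto
  also have "\<dots> \<le> Suc (card {e \<in> ?M. e \<inter> Z = {}})"
    by (rule card_insert_le_m1) auto
  finally have c2: "card (cut (insert u Z)) \<le> Suc (card {e \<in> ?M. e \<inter> Z = {}})" .
  have "card {e \<in> ?M. e \<inter> Z \<noteq> {}} + card {e \<in> ?M. e \<inter> Z = {}} = card ?M"
    using finite_E by (subst card_Un_disjoint[symmetric]) (auto intro!: arg_cong[where f = card])
  moreover have "card ?M = 3" using degree assms(2) by auto
  moreover have "3 \<le> card (cut Z)" using assms by (intro card_cut_ge) auto
  moreover have "3 \<le> card (cut (insert u Z))" using assms by (intro card_cut_ge) auto
  ultimately show False using c1 c2 by linarith
qed

text \<open>Suppose that one part \<open>A\<close> never has an exit to the outside of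
  \<open>D\<close> when the other has one. A largest such \<open>A\<close>, the vertex
  \<open>c\<close> and a suitable piece of the other part form a set whose cut consists of
  \<open>{c, p}\<close> and edges at a single vertex \<open>u\<close>, which
  \<open>cut_next_to_vertex\<close> excludes.\<close>

lemma partition_between_neighbours:
  assumes D: "D \<subseteq> V" "conn D" "c \<in> D" and p: "p \<in> V - D"
    and nbrs: "\<And>y. {c, y} \<in> E \<longleftrightarrow> y = x \<or> y = x' \<or> y = p"
    and x: "x \<in> D" "x' \<in> D" "x \<noteq> x'"
  shows "\<exists>A B. x \<in> A \<and> x' \<in> B \<and> conn A \<and> conn B \<and> A \<inter> B = {} \<and> A \<union> B = D - {c} \<and>
           (\<exists>y\<in>A. \<exists>z\<in>V - D. {y, z} \<in> E) \<and> (\<exists>y\<in>B. \<exists>z\<in>V - D. {y, z} \<in> E)"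
proof -
  define H where "H = D - {c}"
  define exits where "exits A \<longleftrightarrow> (\<exists>y\<in>A. \<exists>z\<in>V - D. {y, z} \<in> E)" for A
  have fin: "finite H" "finite D" using D finite_V unfolding H_def by (auto intro: finite_subset)
  have cx: "{c, x} \<in> E" "{c, x'} \<in> E" "{c, p} \<in> E" using nbrs by auto
  have xH: "x \<in> H" "x' \<in> H" using x cx adj_neq unfolding H_def by auto
  \<comment> \<open>The edge that leaves \<open>R\<close> inside \<open>D\<close> cannot lead to
    \<open>c\<close>, whose only neighbours in \<open>D\<close> are \<open>x\<close> and
    \<open>x'\<close>.\<close>
  have grow: "\<exists>b\<in>H - R. \<exists>a\<in>R. {a, b} \<in> E"
    if "R \<subseteq> H" "R \<noteq> {}" "x \<notin> R" "x' \<notin> R" for R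
  proof -
    have "R \<subseteq> D" "R \<noteq> D" using that D unfolding H_def by auto
    then obtain a b where ab: "a \<in> R" "b \<in> D - R" "{a, b} \<in> E"
      using D(2) \<open>R \<noteq> {}\<close> unfolding conn_def by blast
    have "b \<noteq> c"
    proof
      assume "b = c"
      then have "{c, a} \<in> E" using ab by (simp add: insert_commute)
      then show False using nbrs ab that p \<open>R \<subseteq> D\<close> by auto
    qed
    then show ?thesis using ab unfolding H_def by auto
  qed
  have extend: "\<exists>A B. A0 \<subseteq> A \<and> B0 \<subseteq> B \<and> conn A \<and> conn B \<and> A \<inter> B = {} \<and> A \<union> B = H"
    if "conn A0" "conn B0" "A0 \<inter> B0 = {}" "A0 \<subseteq> H" "B0 \<subseteq> H" "{x, x'} \<subseteq> A0 \<union> B0" for A0 B0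
  proof (rule extend_to_partition[OF fin(1)])
    fix R assume R: "R \<subseteq> H" "R \<noteq> {}" "R \<inter> (A0 \<union> B0) = {}"
    then have "x \<notin> R" "x' \<notin> R" using that(6) by auto
    then show "\<exists>a\<in>R. \<exists>b\<in>H - R. {a, b} \<in> E" using grow[OF R(1,2)] by blast
  qed (use that in auto)
  define part where "part A B \<longleftrightarrow> conn A \<and> conn B \<and> A \<inter> B = {} \<and> A \<union> B = H" for A B
  have main: "\<exists>A B. part A B \<and> s \<in> A \<and> s' \<in> B \<and> exits A \<and> exits B"
    if s: "{s, s'} = {x, x'}" and st: "part A1 B1" "s \<in> A1" "s' \<in> B1" "\<not> exits A1" for s s' A1 B1
  proof (rule ccontr)
    assume no: "\<not> ?thesis"
    \<comment> \<open>First extremal choice: a part \<open>A\<close> without exit that is as large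
      as possible. The bound \<open>Suc (card H)\<close> only serves to make a maximum
      exist.\<close>
    define ok where "ok A \<longleftrightarrow> (\<exists>B. part A B \<and> s \<in> A \<and> s' \<in> B \<and> \<not> exits A)" for A
    have okH: "A \<subseteq> H" if "ok A" for A using that unfolding ok_def part_def by auto
    have "ok A1" using st unfolding ok_def by auto
    moreover have "\<forall>A. ok A \<longrightarrow> card A < Suc (card H)"
      using okH card_mono[OF fin(1)] by (simp add: less_Suc_eq_le)
    ultimately obtain A where A: "ok A" "\<And>A'. ok A' \<Longrightarrow> card A' \<le> card A"
      using ex_has_greatest_nat[of ok A1 card "Suc (card H)"] by (metis less_imp_le)
    then obtain B where B: "part A B" "s \<in> A" "s' \<in> B" "\<not> exits A"
      unfolding ok_def by auto
    have AB: "conn A" "conn B" "A \<inter> B = {}" "A \<union> B = H" using B unfolding part_def by auto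
    have fA: "finite A" "finite B" using AB fin by (metis finite_Un)+
    \<comment> \<open>Second extremal choice: among \<open>s'\<close> and the vertices of
      \<open>B\<close> adjacent to \<open>A\<close>, the vertex \<open>u\<close> whose removal
      leaves the largest component \<open>K u\<close> of \<open>s'\<close> in \<open>B\<close>. For
      \<open>u = s'\<close> this component is empty.\<close>
    define cand where "cand u \<longleftrightarrow> u \<in> B \<and> (u = s' \<or> (\<exists>a\<in>A. {a, u} \<in> E))" for u
    define K where "K u = component (B - {u}) s'" for u
    have "cand s'" using B unfolding cand_def by auto
    moreover have "card (K u) < Suc (card H)" for u
      using component_subset[of "B - {u}" s'] AB fin
      by (intro le_imp_less_Suc card_mono) (auto simp: K_def)
    ultimately obtain u where u: "cand u" "\<And>u'. cand u' \<Longrightarrow> card (K u') \<le> card (K u)"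
      using ex_has_greatest_nat[of cand s' "\<lambda>u. card (K u)" "Suc (card H)"] by (metis less_imp_le)
    have uB: "u \<in> B" using u unfolding cand_def by auto
    have KB: "K u \<subseteq> B - {u}" unfolding K_def by (rule component_subset)
    have Ku: "conn (insert u (K u)) \<and> s' \<in> insert u (K u)"
    proof (cases "u = s'")
      case True then show ?thesis by (simp add: K_def component_empty conn_singleton)
    next
      case False
      then have s'B: "s' \<in> B - {u}" using B by auto
      then have K1: "conn (K u)" "s' \<in> K u" unfolding K_def
        by (auto intro: conn_component component_self)
      have "K u \<subseteq> B" "K u \<noteq> {}" "K u \<noteq> B" using KB uB K1(2) by auto
      then obtain a b where ab: "a \<in> K u" "b \<in> B" "b \<notin> K u" "{a, b} \<in> E"
        by (rule connE[OF AB(2)])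
      have "b = u" using component_closed[of a "B - {u}" s' b] ab unfolding K_def by auto
      then show ?thesis using K1 ab conn_insert by auto
    qed
    \<comment> \<open>Move \<open>u\<close> to \<open>A\<close> and extend. By the maximality of
      \<open>A\<close> the enlarged part has an exit, so the other part, which contains
      \<open>K u\<close>, has none; otherwise the partition would be as desired.\<close>
    have K_noexit: "\<not> exits (K u)"
    proof (cases "u = s'")
      case True then show ?thesis by (simp add: K_def component_empty exits_def)
    next
      case False
      then obtain a where a: "a \<in> A" "{a, u} \<in> E" using u unfolding cand_def by auto
      have s'B: "s' \<in> B - {u}" using B False by auto
      have "{x, x'} \<subseteq> insert s' A" unfolding s[symmetric] using B(2) by simp
      then have sub: "{x, x'} \<subseteq> insert u A \<union> K u"
        using component_self[OF s'B] unfolding K_def by blast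
      have "conn (insert u A)" using conn_insert AB a by auto
      moreover have "conn (K u)" "s' \<in> K u" using s'B unfolding K_def
        by (auto intro: conn_component component_self)
      ultimately obtain A' B' where A': "insert u A \<subseteq> A'" "K u \<subseteq> B'" "part A' B'"
        using extend[of "insert u A" "K u", OF _ _ _ _ _ sub] KB AB uB unfolding part_def by blast
      have "finite A'" using A'(3) fin(1) unfolding part_def by (metis finite_Un)
      moreover have "A \<subset> A'" using A'(1) AB(3) uB by blast
      ultimately have "card A < card A'" by (rule psubset_card_mono)
      then have "\<not> ok A'" using A(2) by fastforce
      then have "exits A'" using A' B \<open>s' \<in> K u\<close> unfolding ok_def by blast
      then have "\<not> exits B'" using no A' B \<open>s' \<in> K u\<close> by blast
      then show ?thesis using A' unfolding exits_def by blast
    qed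
    \<comment> \<open>Otherwise \<open>u'\<close> would be a candidate with a larger component,
      since \<open>insert u (K u)\<close> is connected, contains \<open>s'\<close> and avoids
      \<open>u'\<close>.\<close>
    have Kall: "u' \<in> insert u (K u)" if u': "u' \<in> B" "a \<in> A" "{a, u'} \<in> E" for a u'
    proof (rule ccontr)
      assume n: "u' \<notin> insert u (K u)"
      have "cand u'" using u' unfolding cand_def by auto
      have "insert u (K u) \<subseteq> K u'"
        unfolding K_def[of u'] using Ku KB uB n by (intro component_upper) auto
      moreover have "finite (K u')" using component_subset fA unfolding K_def
        by (metis finite_Diff finite_subset)
      ultimately have "card (insert u (K u)) \<le> card (K u')" by (rule card_mono[rotated])
      moreover have "card (insert u (K u)) = Suc (card (K u))"
        using KB fA by (intro card_insert_disjoint) (auto intro: finite_subset)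
      ultimately show False using u(2)[OF \<open>cand u'\<close>] by simp
    qed
    \<comment> \<open>Neither \<open>A\<close> nor \<open>K u\<close> has an exit from
      \<open>D\<close>; the neighbours of \<open>A\<close> in \<open>B\<close> lie in
      \<open>insert u (K u)\<close>, and \<open>K u\<close> is closed under adjacency in
      \<open>B - {u}\<close>. So an edge that leaves \<open>Z\<close> ends in \<open>u\<close> or is
      \<open>{c, p}\<close>.\<close>
    define Z where "Z = insert c (A \<union> K u)"
    have HZ: "Z \<subseteq> D" using AB KB D unfolding Z_def H_def by auto
    have cut_Z: "cut Z \<subseteq> insert {c, p} {e \<in> E. u \<in> e}"
    proof
      fix e assume "e \<in> cut Z"
      then obtain a b where ab: "e = {a, b}" "{a, b} \<in> E" "a \<in> Z" "b \<notin> Z" "b \<in> V"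
        by (rule cutE)
      have sZ: "b \<noteq> s'" if "u \<noteq> s'" using that ab Ku unfolding Z_def by auto
      have sA: "s \<in> Z" using B unfolding Z_def by auto
      consider "a = c" | "a \<in> A" | "a \<in> K u" using ab unfolding Z_def by auto
      then show "e \<in> insert {c, p} {e \<in> E. u \<in> e}"
      proof cases
        case 1
        then have "b = x \<or> b = x' \<or> b = p" using ab nbrs by auto
        then have "b = s' \<or> b = p" using s sA ab by (metis doubleton_eq_iff)
        then show ?thesis using sZ 1 ab by auto
      next
        case 2
        then have "b \<in> D" using ab B(4) unfolding exits_def by auto
        then have "b \<in> B" using ab AB unfolding H_def Z_def by auto
        then have "b = u" using Kall[of b a] 2 ab unfolding Z_def by auto
        then show ?thesis using ab by auto
      next
        case 3
        then have "b \<in> D" using ab K_noexit unfolding exits_def by auto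
        then have "b \<in> B" using ab AB unfolding H_def Z_def by auto
        then have "b = u"
          using component_closed[of a "B - {u}" s' b] 3 ab unfolding Z_def K_def by auto
        then show ?thesis using ab by auto
      qed
    qed
    show False
    proof (rule cut_next_to_vertex[OF cut_Z])
      show "u \<in> V - Z" using uB AB KB D unfolding Z_def H_def by auto
      show "Z \<subseteq> V" using HZ D by auto
      show "insert u Z \<noteq> V" using HZ uB AB D p unfolding H_def by auto
    qed (simp add: Z_def)
  qed
  obtain A B where AB: "x \<in> A" "x' \<in> B" "part A B"
    using extend[of "{x}" "{x'}"] xH x conn_singleton unfolding part_def by auto
  consider "exits A" "exits B" | "\<not> exits A" | "\<not> exits B" by blast
  then have "\<exists>A B. part A B \<and> x \<in> A \<and> x' \<in> B \<and> exits A \<and> exits B"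
  proof cases
    case 1 then show ?thesis using AB by auto
  next
    case 2 show ?thesis by (rule main[of x x' A B]) (use AB 2 in auto)
  next
    case 3
    have "\<exists>B A. part B A \<and> x' \<in> B \<and> x \<in> A \<and> exits B \<and> exits A"
      by (rule main[of x' x B A]) (use AB 3 in \<open>auto simp: part_def\<close>)
    then show ?thesis unfolding part_def by (metis Int_commute Un_commute)
  qed
  then show ?thesis unfolding part_def exits_def H_def by blast
qed


section \<open>One step of the recursion, and the tree\<close>

lemma card_neighbours:
  assumes "c \<in> V" shows "card {y. {c, y} \<in> E} = 3"
proof -
  have "e \<in> (\<lambda>y. {c, y}) ` {y. {c, y} \<in> E}" if e: "e \<in> E" "c \<in> e" for e
  proof -
    obtain y where "e = {c, y}" using e by (rule edgeE')
    then show ?thesis using e by blast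
  qed
  then have "{e \<in> E. c \<in> e} \<subseteq> (\<lambda>y. {c, y}) ` {y. {c, y} \<in> E}" by (intro subsetI) simp
  moreover have "(\<lambda>y. {c, y}) ` {y. {c, y} \<in> E} \<subseteq> {e \<in> E. c \<in> e}" by (intro image_subsetI) simp
  moreover have "inj_on (\<lambda>y. {c, y}) {y. {c, y} \<in> E}"
    by (simp add: inj_on_def doubleton_eq_iff)
  ultimately have "card {y. {c, y} \<in> E} = card {e \<in> E. c \<in> e}"
    using card_image[of "\<lambda>y. {c, y}" "{y. {c, y} \<in> E}"] by (metis subset_antisym)
  then show ?thesis using degree[OF assms] by simp
qed

lemma neighboursE:
  assumes "{c, p} \<in> E"
  obtains a b where "a \<noteq> b" "a \<noteq> p" "b \<noteq> p" "\<And>y. {c, y} \<in> E \<longleftrightarrow> y = a \<or> y = b \<or> y = p"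
proof -
  have "card {y. {c, y} \<in> E} = 3" using card_neighbours adj_V[OF assms] by simp
  then obtain x y z where xyz: "{y. {c, y} \<in> E} = {x, y, z}" "x \<noteq> y" "y \<noteq> z" "x \<noteq> z"
    by (auto simp: card_3_iff)
  have iff: "{c, w} \<in> E \<longleftrightarrow> w = x \<or> w = y \<or> w = z" for w using xyz(1) by auto
  then consider "p = x" | "p = y" | "p = z" using assms by auto
  then show ?thesis
    by cases (use that[of y z] that[of x z] that[of x y] xyz iff in auto)
qed

text \<open>A cut of \<open>D - {c}\<close> becomes a cut of \<open>D\<close> when \<open>c\<close>
  is put on the side of its only neighbour \<open>a\<close>, and then no edge at \<open>c\<close>
  crosses it.\<close>

lemma conn_remove_leaf:
  assumes D: "conn D" "c \<in> D" and a: "a \<in> D" "a \<noteq> c" and only: "\<And>y. y \<in> D \<Longrightarrow> {c, y} \<in> E \<Longrightarrow> y = a"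
  shows "conn (D - {c})"
  unfolding conn_def
proof (intro conjI allI impI)
  show "D - {c} \<noteq> {}" using a by auto
  fix A assume A: "A \<subseteq> D - {c}" "A \<noteq> {}" "A \<noteq> D - {c}"
  show "\<exists>x\<in>A. \<exists>y\<in>D - {c} - A. {x, y} \<in> E"
  proof (cases "a \<in> A")
    case True
    have "insert c A \<subseteq> D" "insert c A \<noteq> {}" "insert c A \<noteq> D" using A D by auto
    then obtain x y where xy: "x \<in> insert c A" "y \<in> D" "y \<notin> insert c A" "{x, y} \<in> E"
      by (rule connE[OF D(1)])
    then have "x \<noteq> c" using only True by auto
    then show ?thesis using xy by blast
  next
    case False
    have "A \<subseteq> D" "A \<noteq> D" using A D by auto
    then obtain x y where xy: "x \<in> A" "y \<in> D" "y \<notin> A" "{x, y} \<in> E"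
      using connE[OF D(1) _ A(2)] by metis
    have "y \<noteq> c"
    proof
      assume "y = c"
      then have "{c, x} \<in> E" using xy by (simp add: insert_commute)
      then show False using only[of x] xy A False by auto
    qed
    then show ?thesis using xy by blast
  qed
qed

text \<open>\<open>Q x\<close> is going to be the set of descendants of \<open>x\<close>. Every
  neighbour of \<open>c\<close> in \<open>D\<close> becomes a child of \<open>c\<close> with a set
  of its own, so that no edge outside the tree can join \<open>c\<close> to a descendant.\<close>

definition branching :: "'v set \<Rightarrow> 'v \<Rightarrow> ('v \<Rightarrow> 'v set) \<Rightarrow> bool" where
  "branching D c Q \<longleftrightarrow>
     (\<forall>x\<in>D. {c, x} \<in> E \<longrightarrow> conn (Q x) \<and> x \<in> Q x \<and> Q x \<subseteq> D - {c} \<and> (\<exists>y\<in>Q x. \<exists>z\<in>V - D. {y, z} \<in> E)) \<and>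
     (\<forall>x\<in>D. \<forall>x'\<in>D. {c, x} \<in> E \<longrightarrow> {c, x'} \<in> E \<longrightarrow> x \<noteq> x' \<longrightarrow> Q x \<inter> Q x' = {}) \<and>
     (\<forall>u\<in>D - {c}. \<exists>x\<in>D. {c, x} \<in> E \<and> u \<in> Q x)"

text \<open>Without an exit, the only edges leaving \<open>D\<close> would be \<open>{c, b}\<close>
  and \<open>{c, p}\<close>, and this cut is too small.\<close>

lemma branching_one:
  assumes D: "D \<subseteq> V" "conn D" "c \<in> D" and p: "p \<in> V - D"
    and nbrs: "\<And>y. {c, y} \<in> E \<longleftrightarrow> y = a \<or> y = b \<or> y = p"
    and ab: "a \<in> D" "b \<notin> D"
  shows "branching D c (\<lambda>_. D - {c})"
proof -
  have only: "y = a" if "y \<in> D" "{c, y} \<in> E" for y using that nbrs p ab by auto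
  have ac: "a \<noteq> c" using adj_neq[of c a] nbrs by auto
  have conn: "conn (D - {c})" using conn_remove_leaf[OF D(2,3) ab(1) ac] only by blast
  have "\<exists>y\<in>D - {c}. \<exists>z\<in>V - D. {y, z} \<in> E"
  proof (rule ccontr)
    assume no: "\<not> ?thesis"
    have "cut D \<subseteq> {{c, b}, {c, p}}"
    proof
      fix e assume "e \<in> cut D"
      then obtain x y where xy: "e = {x, y}" "{x, y} \<in> E" "x \<in> D" "y \<notin> D" "y \<in> V" by (rule cutE)
      then have "x = c" using no by auto
      then show "e \<in> {{c, b}, {c, p}}" using xy nbrs ab by auto
    qed
    then have "card (cut D) \<le> card {{c, b}, {c, p}}" by (intro card_mono) auto
    also have "\<dots> \<le> 2" by (simp add: card_insert_if)
    finally show False using card_cut_ge[of D] D p by auto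
  qed
  then show ?thesis
    using conn only ab ac unfolding branching_def by (auto simp: nbrs) 
qed

text \<open>The cases are distinguished by which of the two neighbours of \<open>c\<close> other
  than \<open>p\<close> lie in \<open>D\<close>. If both do, \<open>D - {c}\<close> has to be split
  between them; if neither does, \<open>D\<close> is just \<open>{c}\<close>.\<close>

lemma branching_exists:
  assumes D: "D \<subseteq> V" "conn D" "c \<in> D" and p: "p \<in> V - D" "{c, p} \<in> E"
  shows "\<exists>Q. branching D c Q"
proof -
  obtain a b where ab: "a \<noteq> b" "a \<noteq> p" "b \<noteq> p" and
    nbrs: "\<And>y. {c, y} \<in> E \<longleftrightarrow> y = a \<or> y = b \<or> y = p"
    using neighboursE[OF p(2)] by metis
  consider "a \<in> D" "b \<in> D" | "a \<in> D" "b \<notin> D" | "a \<notin> D" "b \<in> D" | "a \<notin> D" "b \<notin> D" by blast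
  then show ?thesis
  proof cases
    case 1
    obtain A B where A: "a \<in> A" "b \<in> B" "conn A" "conn B" "A \<inter> B = {}" "A \<union> B = D - {c}"
      "\<exists>y\<in>A. \<exists>z\<in>V - D. {y, z} \<in> E" "\<exists>y\<in>B. \<exists>z\<in>V - D. {y, z} \<in> E"
      using partition_between_neighbours[OF D p(1) nbrs 1 ab(1)]
      by - (elim exE conjE, rule that, assumption+)
    let ?Q = "\<lambda>x. if x = a then A else B"
    have "\<exists>x\<in>D. {c, x} \<in> E \<and> u \<in> ?Q x" if "u \<in> D - {c}" for u
    proof (cases "u \<in> A")
      case True then show ?thesis using 1 nbrs by (intro bexI[of _ a]) auto
    next
      case False
      then have "u \<in> B" using that A(6) by blast
      then show ?thesis using 1 nbrs ab by (intro bexI[of _ b]) auto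
    qed
    moreover have "A \<subseteq> D - {c}" "B \<subseteq> D - {c}" using A by blast+
    ultimately have "branching D c ?Q"
      unfolding branching_def using A(1-5,7-8) p nbrs by auto
    then show ?thesis by blast
  next
    case 2 then show ?thesis using branching_one[OF D p(1) nbrs] by blast
  next
    case 3
    have nbrs': "{c, y} \<in> E \<longleftrightarrow> y = b \<or> y = a \<or> y = p" for y using nbrs by auto
    show ?thesis using branching_one[OF D p(1) nbrs'] 3 by blast
  next
    case 4
    have "D = {c}"
    proof (rule ccontr)
      assume "D \<noteq> {c}"
      then have "{c} \<subseteq> D" "{c} \<noteq> {}" "{c} \<noteq> D" using D by auto
      then obtain x y where "x \<in> {c}" "y \<in> D" "{x, y} \<in> E" by (rule connE[OF D(2)])
      then show False using nbrs 4 p by auto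
    qed
    moreover have "{c} \<notin> E" using adj_neq[of c c] by auto
    ultimately show ?thesis unfolding branching_def by simp
  qed
qed

text \<open>A spanning tree of \<open>D\<close> with root \<open>c\<close>: \<open>par\<close> is the parent (\<open>p\<close> for \<open>c\<close>) and \<open>Ds v\<close> the set
  of descendants of \<open>v\<close>. The last two conditions say that each of the two edges from \<open>v\<close> other
  than the one to its parent leads to the outside of \<open>Ds v\<close> after at most one non-tree edge.\<close>
definition branching_tree ::
    "'v set \<Rightarrow> 'v \<Rightarrow> 'v \<Rightarrow> ('v \<Rightarrow> 'v set) \<Rightarrow> ('v \<Rightarrow> 'v) \<Rightarrow> bool" where
  "branching_tree D c p Ds par \<longleftrightarrow> Ds c = D \<and> par c = p \<and>
     (\<forall>v\<in>D. v \<in> Ds v \<and> Ds v \<subseteq> D \<and> {v, par v} \<in> E \<and> par v \<notin> Ds v) \<and>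
     (\<forall>v\<in>D. v \<noteq> c \<longrightarrow> par v \<in> D \<and> Ds v \<subseteq> Ds (par v)) \<and>
     (\<forall>v\<in>D. \<forall>u\<in>Ds v. Ds u \<subseteq> Ds v) \<and>
     (\<forall>v\<in>D. \<forall>u\<in>Ds v. u \<noteq> v \<longrightarrow> par u \<in> Ds v \<and> v \<notin> Ds u) \<and>
     (\<forall>v\<in>D. \<forall>w\<in>D. Ds v \<inter> Ds w \<noteq> {} \<longrightarrow> v \<in> Ds w \<or> w \<in> Ds v) \<and>
     (\<forall>v\<in>D. \<forall>u\<in>Ds v. u \<noteq> v \<longrightarrow> (\<exists>x\<in>Ds v. x \<noteq> v \<and> par x = v \<and> u \<in> Ds x)) \<and>
     (\<forall>v\<in>D. \<forall>x\<in>Ds v. {v, x} \<in> E \<longrightarrow> par x = v) \<and>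
     (\<forall>v\<in>D. \<forall>x\<in>Ds v. x \<noteq> v \<longrightarrow> par x = v \<longrightarrow> (\<exists>y\<in>Ds x. \<exists>z\<in>V - Ds v. {y, z} \<in> E))"

lemma branching_treeD:
  assumes "branching_tree D c p Ds par"
  shows "Ds c = D" "par c = p"
    and "\<forall>v\<in>D. v \<in> Ds v \<and> Ds v \<subseteq> D \<and> {v, par v} \<in> E \<and> par v \<notin> Ds v"
    and "\<forall>v\<in>D. v \<noteq> c \<longrightarrow> par v \<in> D \<and> Ds v \<subseteq> Ds (par v)"
    and "\<forall>v\<in>D. \<forall>u\<in>Ds v. Ds u \<subseteq> Ds v"
    and "\<forall>v\<in>D. \<forall>u\<in>Ds v. u \<noteq> v \<longrightarrow> par u \<in> Ds v \<and> v \<notin> Ds u"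
    and "\<forall>v\<in>D. \<forall>w\<in>D. Ds v \<inter> Ds w \<noteq> {} \<longrightarrow> v \<in> Ds w \<or> w \<in> Ds v"
    and "\<forall>v\<in>D. \<forall>u\<in>Ds v. u \<noteq> v \<longrightarrow> (\<exists>x\<in>Ds v. x \<noteq> v \<and> par x = v \<and> u \<in> Ds x)"
    and "\<forall>v\<in>D. \<forall>x\<in>Ds v. {v, x} \<in> E \<longrightarrow> par x = v"
    and "\<forall>v\<in>D. \<forall>x\<in>Ds v. x \<noteq> v \<longrightarrow> par x = v \<longrightarrow> (\<exists>y\<in>Ds x. \<exists>z\<in>V - Ds v. {y, z} \<in> E)"
  using assms unfolding branching_tree_def by - (elim conjE, assumption)+

text \<open>Each set \<open>Q x\<close> receives a tree with root \<open>x\<close> and parent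
  \<open>c\<close>. The exits demanded at \<open>c\<close> are supplied by \<open>branching\<close>;
  those demanded at deeper vertices are inherited, because they refer to \<open>V - Ds v\<close> and
  not to \<open>D\<close>.\<close>

lemma branching_tree_exists:
  assumes "D \<subseteq> V" "conn D" "c \<in> D" "p \<in> V - D" "{c, p} \<in> E"
  shows "\<exists>Ds par. branching_tree D c p Ds par"
  using assms
proof (induction "card D" arbitrary: D c p rule: less_induct)
  case less
  note D = less.prems
  have finD: "finite D" using D finite_V by (auto intro: finite_subset)
  obtain Q where Q: "branching D c Q" using branching_exists D by blast
  define X where "X = {x \<in> D. {c, x} \<in> E}"
  have Qx: "conn (Q x)" "x \<in> Q x" "Q x \<subseteq> D - {c}" "\<exists>y\<in>Q x. \<exists>z\<in>V - D. {y, z} \<in> E" if "x \<in> X" for x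
    using Q that unfolding branching_def X_def by blast+
  have Qdisj: "Q x \<inter> Q x' = {}" if "x \<in> X" "x' \<in> X" "x \<noteq> x'" for x x'
    using Q that unfolding branching_def X_def by blast
  have Qcov: "\<exists>x\<in>X. u \<in> Q x" if "u \<in> D" "u \<noteq> c" for u
    using Q that unfolding branching_def X_def by blast
  have "\<exists>Ds par. branching_tree (Q x) x c Ds par" if x: "x \<in> X" for x
  proof (rule less.hyps)
    show "card (Q x) < card D"
      using Qx(3)[OF x] D(3) by (intro psubset_card_mono finD) auto
    show "c \<in> V - Q x" "{x, c} \<in> E" "Q x \<subseteq> V"
      using Qx(3)[OF x] D x unfolding X_def by (auto simp: insert_commute)
  qed (use Qx[OF x] in auto)
  then obtain F P where FP: "\<And>x. x \<in> X \<Longrightarrow> branching_tree (Q x) x c (F x) (P x)" by metis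
  \<comment> \<open>The child of \<open>c\<close> below which \<open>u\<close> lies; it tells which
    of the smaller trees is responsible for \<open>u\<close>.\<close>
  define r where "r u = (THE x. x \<in> X \<and> u \<in> Q x)" for u
  have r: "r u = x" if "x \<in> X" "u \<in> Q x" for u x
    unfolding r_def using that Qdisj by (intro the_equality) blast+
  define Ds where "Ds v = (if v = c then D else F (r v) v)" for v
  define par where "par v = (if v = c then p else P (r v) v)" for v
  have Ds_c: "Ds c = D" "par c = p" by (auto simp: Ds_def par_def)
  have Ds_Q: "Ds u = F x u" "par u = P x u" if "x \<in> X" "u \<in> Q x" for u x
    using r[OF that] Qx(3)[OF that(1)] that by (auto simp: Ds_def par_def)
  note T = branching_treeD[OF FP]
  have T1: "F x x = Q x" "P x x = c" if "x \<in> X" for x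
    by (fact T(1,2)[OF that])+
  have T2: "v \<in> F x v" "F x v \<subseteq> Q x" "{v, P x v} \<in> E" "P x v \<notin> F x v" if "x \<in> X" "v \<in> Q x" for x v
    using T(3)[OF that(1)] that(2) by blast+
  have T3: "P x v \<in> Q x" "F x v \<subseteq> F x (P x v)" if "x \<in> X" "v \<in> Q x" "v \<noteq> x" for x v
    using T(4)[OF that(1)] that(2,3) by blast+
  have T4: "F x u \<subseteq> F x v" if "x \<in> X" "v \<in> Q x" "u \<in> F x v" for x u v
    using T(5)[OF that(1)] that(2,3) by blast
  have T5: "P x u \<in> F x v" "v \<notin> F x u" if "x \<in> X" "v \<in> Q x" "u \<in> F x v" "u \<noteq> v" for x u v
    using T(6)[OF that(1)] that(2-4) by blast+
  have T6: "v \<in> F x w \<or> w \<in> F x v" if "x \<in> X" "v \<in> Q x" "w \<in> Q x" "F x v \<inter> F x w \<noteq> {}" for x v w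
    using T(7)[OF that(1)] that(2-4) by blast
  have T7: "\<exists>y\<in>F x v. y \<noteq> v \<and> P x y = v \<and> u \<in> F x y" if "x \<in> X" "v \<in> Q x" "u \<in> F x v" "u \<noteq> v" for x u v
    using T(8)[OF that(1)] that(2-4) by blast
  have T8: "P x y = v" if "x \<in> X" "v \<in> Q x" "y \<in> F x v" "{v, y} \<in> E" for x y v
    using T(9)[OF that(1)] that(2-4) by blast
  have T9: "\<exists>a\<in>F x y. \<exists>z\<in>V - F x v. {a, z} \<in> E"
    if "x \<in> X" "v \<in> Q x" "y \<in> F x v" "y \<noteq> v" "P x y = v" for x y v
    using T(10)[OF that(1)] that(2-5) by blast
  have inQ: "Ds v = F x v" "par v = P x v" "\<And>u. u \<in> Ds v \<Longrightarrow> Ds u = F x u \<and> par u = P x u \<and> u \<in> Q x \<and> u \<in> F x v"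
    if "x \<in> X" "v \<in> Q x" for x v
    using that T2(2)[OF that] Ds_Q by auto
  have child_c: "u \<in> X" if u: "u \<in> D" "u \<noteq> c" "par u = c" for u
  proof -
    obtain x where x: "x \<in> X" "u \<in> Q x" using Qcov u by blast
    have "u = x"
    proof (rule ccontr)
      assume "u \<noteq> x"
      then have "c \<in> Q x" using T3(1)[OF x] Ds_Q(2)[OF x] u by simp
      then show False using Qx(3)[OF x(1)] by auto
    qed
    then show ?thesis using x by simp
  qed
  have "branching_tree D c p Ds par"
    unfolding branching_tree_def
  proof (intro conjI ballI impI)
    show "Ds c = D" "par c = p" by fact+
    fix v assume v: "v \<in> D"
    have cases: "v = c \<or> (\<exists>x\<in>X. v \<in> Q x)" using Qcov v by blast
    have "v \<in> Ds v \<and> {v, par v} \<in> E \<and> Ds v \<subseteq> D \<and> par v \<notin> Ds v"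
    proof (cases "v = c")
      case True then show ?thesis using Ds_c D by simp
    next
      case False
      then obtain x where x: "x \<in> X" "v \<in> Q x" using cases by blast
      then show ?thesis using inQ(1,2)[OF x] T2[OF x] Qx(3)[OF x(1)] by auto
    qed
    then show "v \<in> Ds v" "{v, par v} \<in> E" "Ds v \<subseteq> D" "par v \<notin> Ds v" by blast+
    show "par v \<in> D" "Ds v \<subseteq> Ds (par v)" if vc: "v \<noteq> c"
    proof -
      obtain x where x: "x \<in> X" "v \<in> Q x" using cases vc by blast
      have "par v \<in> D \<and> Ds v \<subseteq> Ds (par v)"
      proof (cases "v = x")
        case True
        then have "par v = c" using inQ(2)[OF x] T1[OF x(1)] by simp
        then show ?thesis using D(3) Ds_c inQ(1)[OF x] T2(2)[OF x] Qx(3)[OF x(1)] by auto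
      next
        case False
        have "P x v \<in> Q x" by (rule T3(1)[OF x False])
        then show ?thesis
          using T3(2)[OF x False] inQ(1,2)[OF x] inQ(1)[OF x(1)] Qx(3)[OF x(1)] by auto
      qed
      then show "par v \<in> D" "Ds v \<subseteq> Ds (par v)" by blast+
    qed
    show "\<And>u. u \<in> Ds v \<Longrightarrow> Ds u \<subseteq> Ds v"
    proof -
      fix u assume u: "u \<in> Ds v"
      show "Ds u \<subseteq> Ds v"
      proof (cases "v = c")
        case True
        show ?thesis
        proof (cases "u = c")
          case False
          then obtain x where x: "x \<in> X" "u \<in> Q x" using Qcov u True Ds_c by auto
          then show ?thesis using inQ[OF x] T2(2)[OF x] Qx(3)[OF x(1)] Ds_c True by auto
        qed (use True in simp)
      next
        case False
        then obtain x where x: "x \<in> X" "v \<in> Q x" using cases by blast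
        then show ?thesis using inQ[OF x] T4[OF x] u by auto
      qed
    qed
    show "\<And>u. u \<in> Ds v \<Longrightarrow> u \<noteq> v \<Longrightarrow> par u \<in> Ds v"
      "\<And>u. u \<in> Ds v \<Longrightarrow> u \<noteq> v \<Longrightarrow> v \<notin> Ds u"
      "\<And>u. u \<in> Ds v \<Longrightarrow> u \<noteq> v \<Longrightarrow> \<exists>x\<in>Ds v. x \<noteq> v \<and> par x = v \<and> u \<in> Ds x"
    proof -
      fix u assume u: "u \<in> Ds v" "u \<noteq> v"
      have "par u \<in> Ds v \<and> v \<notin> Ds u \<and> (\<exists>x\<in>Ds v. x \<noteq> v \<and> par x = v \<and> u \<in> Ds x)"
      proof (cases "v = c")
        case True
        then obtain x where x: "x \<in> X" "u \<in> Q x" using Qcov u Ds_c by auto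
        have xx: "x \<in> Q x" using Qx[OF x(1)] by blast
        have "par u \<in> D" using T1[OF x(1)] T3[OF x] inQ[OF x] Qx(3)[OF x(1)] D(3)
          by (cases "u = x") auto
        moreover have "v \<notin> Ds u" using True inQ(1)[OF x] T2(2)[OF x] Qx(3)[OF x(1)] by auto
        moreover have "x \<in> D" "x \<noteq> c" "par x = c" "u \<in> Ds x"
          using Qx(3)[OF x(1)] xx inQ[OF x(1) xx] T1[OF x(1)] x by auto
        ultimately show ?thesis using True Ds_c by auto
      next
        case False
        then obtain x where x: "x \<in> X" "v \<in> Q x" using cases by blast
        have uF: "u \<in> F x v" using inQ(1)[OF x] u by simp
        obtain y where "y \<in> F x v" "y \<noteq> v" "P x y = v" "u \<in> F x y" using T7[OF x uF u(2)] by blast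
        then have "\<exists>x\<in>Ds v. x \<noteq> v \<and> par x = v \<and> u \<in> Ds x" using inQ[OF x] by auto
        moreover have "par u \<in> Ds v" "v \<notin> Ds u"
          using inQ(1)[OF x] inQ(3)[OF x u(1)] T5[OF x uF u(2)] by auto
        ultimately show ?thesis by blast
      qed
      then show "par u \<in> Ds v" "v \<notin> Ds u" "\<exists>x\<in>Ds v. x \<noteq> v \<and> par x = v \<and> u \<in> Ds x" by blast+
    qed
    show "v \<in> Ds w \<or> w \<in> Ds v" if w: "w \<in> D" and i: "Ds v \<inter> Ds w \<noteq> {}" for w
    proof -
      consider "v = c" | "w = c" | x y where "x \<in> X" "y \<in> X" "v \<in> Q x" "w \<in> Q y"
        using cases Qcov w by metis
      then show ?thesis
      proof cases
        case 1 then show ?thesis using w Ds_c by simp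
      next
        case 2 then show ?thesis using v Ds_c by simp
      next
        case 3
        have "x = y"
          using i Qdisj[OF 3(1,2)] inQ(1)[OF 3(1,3)] inQ(1)[OF 3(2,4)] T2(2)[OF 3(1,3)] T2(2)[OF 3(2,4)]
          by blast
        then show ?thesis using T6[of x v w] 3 i inQ(1)[OF 3(1,3)] inQ(1)[of x w] by auto
      qed
    qed
    show "par x = v" if x: "x \<in> Ds v" "{v, x} \<in> E" for x
    proof (cases "v = c")
      case True
      then have "x \<in> X" using x Ds_c unfolding X_def by simp
      then show ?thesis using True T1(2) inQ(2) Qx(2) by auto
    next
      case False
      then obtain y where y: "y \<in> X" "v \<in> Q y" using cases by blast
      then show ?thesis using inQ[OF y] T8[OF y] x by auto
    qed
    show "\<exists>y\<in>Ds x. \<exists>z\<in>V - Ds v. {y, z} \<in> E" if x: "x \<in> Ds v" "x \<noteq> v" "par x = v" for x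
    proof (cases "v = c")
      case True
      then have "x \<in> X" using child_c x Ds_c by simp
      then show ?thesis using True T1(1) inQ(1) Qx Ds_c by auto
    next
      case False
      then obtain y where y: "y \<in> X" "v \<in> Q y" using cases by blast
      have "x \<in> F y v" "P y x = v" using inQ[OF y] x by auto
      then show ?thesis using inQ[OF y] T9[OF y] x by auto
    qed
  qed
  then show ?case by blast
qed

end

section \<open>Codes of edges and vertices\<close>

context cubic_graph begin

lemma cut_complement_vertex:
  assumes "r \<in> V" shows "cut (V - {r}) = {e \<in> E. r \<in> e}"
proof -
  have "e \<inter> (V - {r}) \<noteq> {} \<and> \<not> e \<subseteq> V - {r} \<longleftrightarrow> r \<in> e" if e: "e \<in> E" for e
  proof -
    obtain u v where "e = {u, v}" "u \<noteq> v" "u \<in> V" "v \<in> V" using e by (rule edgeE)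
    then show ?thesis using assms by auto
  qed
  then show ?thesis unfolding cut_def by blast
qed

text \<open>The cuts of the two sides of a separation would be disjoint sets of edges at
  \<open>r\<close> with three elements each, but \<open>r\<close> has only three edges.\<close>

lemma conn_remove_vertex:
  assumes r: "r \<in> V" and ne: "V \<noteq> {r}" shows "conn (V - {r})"
  unfolding conn_def
proof (intro conjI allI impI)
  show "V - {r} \<noteq> {}" using assms by auto
  fix A assume A: "A \<subseteq> V - {r}" "A \<noteq> {}" "A \<noteq> V - {r}"
  show "\<exists>a\<in>A. \<exists>b\<in>V - {r} - A. {a, b} \<in> E"
  proof (rule ccontr)
    assume no: "\<not> ?thesis"
    define B where "B = V - {r} - A"
    have no': "{a, b} \<notin> E" "{b, a} \<notin> E" if "a \<in> A" "b \<in> B" for a b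
      using no that unfolding B_def by (auto simp: insert_commute)
    have sub: "cut A \<subseteq> {e \<in> E. r \<in> e}" "cut B \<subseteq> {e \<in> E. r \<in> e}"
    proof -
      have "b = r" if "a \<in> A" "b \<notin> A" "{a, b} \<in> E" "b \<in> V" for a b
        using that no'(1)[of a b] unfolding B_def by auto
      then show "cut A \<subseteq> {e \<in> E. r \<in> e}" by (auto elim!: cutE)
      have "b = r" if "a \<in> B" "b \<notin> B" "{a, b} \<in> E" "b \<in> V" for a b
        using that no'(2)[of b a] unfolding B_def by auto
      then show "cut B \<subseteq> {e \<in> E. r \<in> e}" by (auto elim!: cutE)
    qed
    have "cut A \<inter> cut B = {}"
    proof (rule ccontr)
      assume "cut A \<inter> cut B \<noteq> {}"
      then obtain e where e: "e \<in> cut A" "e \<in> cut B" by blast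
      then have "r \<in> e" "e \<in> E" using sub by auto
      then obtain v where v: "e = {r, v}" using edgeE' by metis
      show False using e v A unfolding B_def cut_def by auto
    qed
    then have "card (cut A) + card (cut B) = card (cut A \<union> cut B)"
      using finite_cut by (simp add: card_Un_disjoint)
    also have "\<dots> \<le> card {e \<in> E. r \<in> e}" using sub finite_E by (intro card_mono) auto
    also have "\<dots> = 3" using degree r by simp
    finally have "card (cut A) + card (cut B) \<le> 3" .
    moreover have "3 \<le> card (cut A)" using A r by (intro card_cut_ge) auto
    moreover have "3 \<le> card (cut B)" using A r unfolding B_def by (intro card_cut_ge) auto
    ultimately show False by simp
  qed
qed

end

text \<open>The root \<open>r\<close> stays outside the recursion and serves as the parent of
  \<open>c\<close>. Hence \<open>c\<close> is its only child and the two other edges at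
  \<open>r\<close> are not in the tree.\<close>

locale cubic_graph_tree = cubic_graph +
  fixes r c :: 'a and Ds :: "'a \<Rightarrow> 'a set" and par :: "'a \<Rightarrow> 'a"
  assumes r: "r \<in> V" and c: "c \<in> V - {r}"
    and tree: "branching_tree (V - {r}) c r Ds par"
begin

abbreviation "W \<equiv> V - {r}"

definition up :: "'a \<Rightarrow> 'a set" where "up v = {v, par v}"
definition nontree :: "'a set set" where "nontree = E - up ` W"
text \<open>The fundamental cut of the tree edge \<open>up v\<close> without that edge;
  equivalently, the edges outside the tree whose fundamental cycle passes through
  \<open>up v\<close>.\<close>

definition above :: "'a \<Rightarrow> 'a set set" where "above v = nontree \<inter> cut (Ds v)"
text \<open>An edge outside the tree lies on exactly one fundamental cycle, its own. For a tree
  edge, \<open>inv_into W up\<close> recovers the lower end; it is unique by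
  \<open>inj_up\<close>.\<close>

definition code :: "'a set \<Rightarrow> 'a set set" where
  "code e = (if e \<in> nontree then {e} else above (inv_into W up e))"
definition vcode :: "'a \<Rightarrow> 'a set set" where "vcode v = \<Union>(code ` {e \<in> E. v \<in> e})"

section \<open>Descendants, fundamental cuts and codes of edges\<close>

lemmas treeD = branching_treeD[OF tree]

lemma Ds_c: "Ds c = W" and par_c: "par c = r"
  by (fact treeD(1) treeD(2))+

lemma Ds_self: "v \<in> W \<Longrightarrow> v \<in> Ds v"
  and Ds_W: "v \<in> W \<Longrightarrow> Ds v \<subseteq> W"
  and up_E: "v \<in> W \<Longrightarrow> up v \<in> E"
  and par_notin: "v \<in> W \<Longrightarrow> par v \<notin> Ds v"
  using treeD(3) unfolding up_def by blast+

lemma par_W: "v \<in> W \<Longrightarrow> v \<noteq> c \<Longrightarrow> par v \<in> W"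
  and Ds_par: "v \<in> W \<Longrightarrow> v \<noteq> c \<Longrightarrow> Ds v \<subseteq> Ds (par v)"
  using treeD(4) by blast+

lemma Ds_mono: "v \<in> W \<Longrightarrow> u \<in> Ds v \<Longrightarrow> Ds u \<subseteq> Ds v"
  using treeD(5) by blast

lemma par_Ds: "v \<in> W \<Longrightarrow> u \<in> Ds v \<Longrightarrow> u \<noteq> v \<Longrightarrow> par u \<in> Ds v"
  and Ds_antisym: "v \<in> W \<Longrightarrow> u \<in> Ds v \<Longrightarrow> u \<noteq> v \<Longrightarrow> v \<notin> Ds u"
  using treeD(6) by blast+

lemma Ds_laminar: "v \<in> W \<Longrightarrow> w \<in> W \<Longrightarrow> Ds v \<inter> Ds w \<noteq> {} \<Longrightarrow> v \<in> Ds w \<or> w \<in> Ds v"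
  using treeD(7) by blast

lemma childE:
  assumes "v \<in> W" "u \<in> Ds v" "u \<noteq> v"
  obtains x where "x \<in> Ds v" "x \<noteq> v" "par x = v" "u \<in> Ds x"
  using treeD(8) assms by blast

lemma adjacent_below: "v \<in> W \<Longrightarrow> x \<in> Ds v \<Longrightarrow> {v, x} \<in> E \<Longrightarrow> par x = v"
  using treeD(9) by blast

lemma child_exit:
  assumes "v \<in> W" "x \<in> Ds v" "x \<noteq> v" "par x = v"
  obtains y z where "y \<in> Ds x" "z \<in> V" "z \<notin> Ds v" "{y, z} \<in> E"
  using treeD(10) assms by blast

lemma par_eq: assumes "x \<in> W" "par x = v" "v \<in> W" shows "x \<in> Ds v" "x \<noteq> v"
proof -
  have "x \<noteq> c" using assms par_c by auto
  then show "x \<in> Ds v" using Ds_par[OF assms(1)] Ds_self[OF assms(1)] assms(2) by auto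
  show "x \<noteq> v" using up_E[OF assms(1)] adj_neq[of x v] assms(2) unfolding up_def by auto
qed

lemma inj_up: "inj_on up W"
proof (rule inj_onI)
  fix v w assume vw: "v \<in> W" "w \<in> W" "up v = up w"
  show "v = w"
  proof (rule ccontr)
    assume ne: "v \<noteq> w"
    then have "par v = w" "par w = v" using vw(3) unfolding up_def by (auto simp: doubleton_eq_iff)
    then have "v \<in> Ds w" "w \<in> Ds v" using par_eq vw by auto
    then show False using Ds_antisym vw ne by blast
  qed
qed

lemma code_up: "v \<in> W \<Longrightarrow> code (up v) = above v"
  unfolding code_def nontree_def using inv_into_f_f[OF inj_up] by auto

lemma code_nontree: "e \<in> nontree \<Longrightarrow> code e = {e}"
  unfolding code_def by simp

lemma nontreeE:
  assumes "j \<in> nontree" obtains x y where "j = {x, y}" "x \<noteq> y" "x \<in> V" "y \<in> V" "{x, y} \<in> E"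
  using assms edgeE unfolding nontree_def by (metis DiffD1)

lemma up_notin: "v \<in> W \<Longrightarrow> up v \<notin> nontree"
  unfolding nontree_def by auto

lemma code_nontree_subset: "e \<in> E \<Longrightarrow> code e \<subseteq> nontree"
  unfolding code_def above_def by auto

text \<open>The parent of a proper descendant of \<open>v\<close> is a descendant of
  \<open>v\<close>, and so is every child of a descendant. Hence \<open>up v\<close> is the only
  tree edge across this cut.\<close>

lemma cut_Ds: assumes v: "v \<in> W" shows "cut (Ds v) = insert (up v) (above v)"
proof
  show "insert (up v) (above v) \<subseteq> cut (Ds v)"
    using Ds_self[OF v] par_notin[OF v] up_E[OF v] by (auto simp: above_def up_def intro: cutI)
  show "cut (Ds v) \<subseteq> insert (up v) (above v)"
  proof
    fix e assume e: "e \<in> cut (Ds v)"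
    show "e \<in> insert (up v) (above v)"
    proof (cases "e \<in> nontree")
      case True then show ?thesis using e unfolding above_def by simp
    next
      case False
      moreover have "e \<in> E" using e unfolding cut_def by simp
      ultimately obtain x where x: "x \<in> W" "e = {x, par x}" unfolding nontree_def up_def by auto
      have xor: "x \<in> Ds v \<longleftrightarrow> par x \<notin> Ds v" using e x cut_pair by auto
      have "x = v"
      proof (cases "x \<in> Ds v")
        case True then show ?thesis using par_Ds[OF v] xor by auto
      next
        case False
        then have "par x \<in> Ds v" using xor by simp
        then have "par x \<in> W" using Ds_W v by auto
        then have "x \<in> Ds (par x)" using par_eq x by auto
        then show ?thesis using Ds_mono[OF v \<open>par x \<in> Ds v\<close>] False by auto
      qed
      then show ?thesis using x unfolding up_def by simp
    qed
  qed
qed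

lemma finite_above: "finite (above v)"
  unfolding above_def using finite_cut by simp

lemma card_above: assumes v: "v \<in> W" shows "2 \<le> card (above v)"
proof -
  have "3 \<le> card (cut (Ds v))"
    using Ds_W[OF v] Ds_self[OF v] r by (intro card_cut_ge) auto
  also have "\<dots> \<le> Suc (card (above v))"
    unfolding cut_Ds[OF v] by (rule card_insert_le_m1) auto
  finally show ?thesis by simp
qed

text \<open>Two tree edges with the same code would form a two-edge cut: the cut of the symmetric
  difference of the sets of descendants.\<close>
lemma inj_above: "inj_on above W"
proof (rule inj_onI)
  fix v w assume vw: "v \<in> W" "w \<in> W" and eq: "above v = above w"
  show "v = w"
  proof (rule ccontr)
    assume ne: "v \<noteq> w"
    let ?X = "(Ds v - Ds w) \<union> (Ds w - Ds v)"
    have "cut ?X \<subseteq> {up v, up w}"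
    proof
      fix e assume "e \<in> cut ?X"
      then obtain a b where ab: "e = {a, b}" "{a, b} \<in> E" "a \<in> ?X" "b \<notin> ?X" by (rule cutE)
      then have "e \<in> cut (Ds v) \<longleftrightarrow> e \<notin> cut (Ds w)" by (auto simp: cut_pair)
      then show "e \<in> {up v, up w}" using cut_Ds vw eq by auto
    qed
    then have "card (cut ?X) \<le> card {up v, up w}" by (intro card_mono) auto
    also have "\<dots> \<le> 2" by (simp add: card_insert_if)
    finally have "card (cut ?X) \<le> 2" .
    moreover have "3 \<le> card (cut ?X)"
    proof (rule card_cut_ge)
      show "?X \<subseteq> V" "?X \<noteq> V" using Ds_W vw r by blast+
      have "Ds v \<noteq> Ds w" using Ds_antisym[OF vw(1)] Ds_self[OF vw(1)] Ds_self[OF vw(2)] ne by metis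
      then show "?X \<noteq> {}" by blast
    qed
    ultimately show False by simp
  qed
qed

lemma edges_at:
  assumes "v \<in> W"
  obtains a b where "a \<noteq> b" "a \<noteq> par v" "b \<noteq> par v"
    "\<And>y. {v, y} \<in> E \<longleftrightarrow> y = a \<or> y = b \<or> y = par v"
  using neighboursE[of v "par v"] up_E[OF assms] unfolding up_def by metis

text \<open>A tree edge at \<open>v\<close> goes to \<open>par v\<close> or to a child, and children
  belong to \<open>Ds v\<close>.\<close>

lemma down_nontree:
  assumes v: "v \<in> W" and a: "{v, a} \<in> E" "a \<noteq> par v" "a \<notin> Ds v"
  shows "{v, a} \<in> nontree"
proof -
  have "{v, a} \<noteq> up u" if u: "u \<in> W" for u
  proof
    assume "{v, a} = up u"
    then have "u = a" "par a = v" using a unfolding up_def by (auto simp: doubleton_eq_iff)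
    then show False using par_eq[of a v] u v a by simp
  qed
  then show ?thesis using a unfolding nontree_def by auto
qed

lemma down_child:
  assumes v: "v \<in> W" and a: "{v, a} \<in> E" "a \<in> Ds v"
  shows "a \<in> W" "a \<noteq> v" "par a = v" "{v, a} = up a" "code {v, a} = above a"
    "v \<notin> Ds a" "Ds a \<subseteq> Ds v" "{v, a} \<notin> nontree"
proof -
  show W: "a \<in> W" using Ds_W v a by blast
  show "a \<noteq> v" using a adj_neq by auto
  show p: "par a = v" using adjacent_below v a by blast
  show u: "{v, a} = up a" unfolding up_def p by (rule insert_commute)
  show "code {v, a} = above a" unfolding u by (rule code_up[OF W])
  show "v \<notin> Ds a" using Ds_antisym v a \<open>a \<noteq> v\<close> by blast
  show "Ds a \<subseteq> Ds v" using Ds_mono v a by blast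
  show "{v, a} \<notin> nontree" unfolding u by (rule up_notin[OF W])
qed

text \<open>By laminarity one sibling would lie below the other, and then so would their common
  parent \<open>v\<close>.\<close>

lemma siblings_disjoint:
  assumes v: "v \<in> W" and a: "{v, a} \<in> E" "a \<in> Ds v" and b: "{v, b} \<in> E" "b \<in> Ds v" and ab: "a \<noteq> b"
  shows "Ds a \<inter> Ds b = {}"
proof (rule ccontr)
  note A = down_child[OF v a] and B = down_child[OF v b]
  assume "Ds a \<inter> Ds b \<noteq> {}"
  then have "a \<in> Ds b \<or> b \<in> Ds a" using Ds_laminar A(1) B(1) by blast
  then have "par a \<in> Ds b \<or> par b \<in> Ds a" using par_Ds A(1) B(1) ab by metis
  then show False using A(3,6) B(3,6) by auto
qed

text \<open>The fundamental cycle of \<open>j\<close> uses none or two of the edges at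
  \<open>v\<close>, so the three codes add up to zero modulo 2. In terms of cuts:
  \<open>Ds v\<close> is the disjoint union of \<open>{v}\<close> and the subtrees below
  \<open>v\<close>, and for an edge \<open>j\<close> that avoids \<open>v\<close> the cuts of the
  subtrees add up to the cut of \<open>Ds v\<close>.\<close>

lemma code_xor:
  assumes v: "v \<in> W" and ab: "a \<noteq> b" "a \<noteq> par v" "b \<noteq> par v"
    and nbrs: "\<And>y. {v, y} \<in> E \<longleftrightarrow> y = a \<or> y = b \<or> y = par v"
  shows "j \<in> above v \<longleftrightarrow> (j \<in> code {v, a} \<longleftrightarrow> j \<notin> code {v, b})"
proof (cases "j \<in> nontree")
  case False
  have "{v, a} \<in> E" "{v, b} \<in> E" using nbrs by auto
  then show ?thesis using False code_nontree_subset unfolding above_def by blast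
next
  case j: True
  have E: "{v, a} \<in> E" "{v, b} \<in> E" using nbrs by auto
  have va: "v \<noteq> a" "v \<noteq> b" using adj_neq E by auto
  \<comment> \<open>The subtree behind the edge \<open>{v, y}\<close>, or the empty set if that edge
    is not in the tree.\<close>
  define B where "B y = (if y \<in> Ds v then Ds y else {})" for y
  obtain x y where xy: "j = {x, y}" "x \<noteq> y" "{x, y} \<in> E" using j by (rule nontreeE)
  have codeB: "j \<in> code {v, z} \<longleftrightarrow> (z \<in> Ds v \<and> (x \<in> B z \<longleftrightarrow> y \<notin> B z)) \<or> (z \<notin> Ds v \<and> j = {v, z})"
    if z: "z = a \<or> z = b" for z
  proof (cases "z \<in> Ds v")
    case True
    have "{v, z} \<in> E" using z E by auto
    from down_child[OF v this True] show ?thesis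
      using True j xy by (simp add: above_def B_def cut_pair)
  next
    case False
    then have "{v, z} \<in> nontree" using z E ab down_nontree[OF v] by blast
    then show ?thesis using False code_nontree by auto
  qed
  have Dv: "u \<in> Ds v \<longleftrightarrow> u = v \<or> u \<in> B a \<or> u \<in> B b" for u
  proof
    assume u: "u \<in> Ds v"
    show "u = v \<or> u \<in> B a \<or> u \<in> B b"
    proof (cases "u = v")
      case False
      then obtain z where z: "z \<in> Ds v" "z \<noteq> v" "par z = v" "u \<in> Ds z" using childE v u by metis
      then have "z \<in> W" using Ds_W v by blast
      then have "{v, z} \<in> E" using up_E[of z] z(3) unfolding up_def by (simp add: insert_commute)
      moreover have "z \<noteq> par v" using z(1) par_notin[OF v] by metis
      ultimately have "z = a \<or> z = b" using nbrs by blast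
      then show ?thesis using z unfolding B_def by auto
    qed simp
  next
    assume "u = v \<or> u \<in> B a \<or> u \<in> B b"
    then show "u \<in> Ds v"
      using Ds_self[OF v] down_child(7)[OF v] E unfolding B_def by (auto split: if_splits)
  qed
  have vB: "v \<notin> B a" "v \<notin> B b" using down_child(6)[OF v] E unfolding B_def by auto
  have disj: "\<not> (u \<in> B a \<and> u \<in> B b)" for u
    using siblings_disjoint[OF v E(1) _ E(2) _ ab(1)] unfolding B_def by auto
  have main: "j \<in> above v \<longleftrightarrow> (x \<in> Ds v \<longleftrightarrow> y \<notin> Ds v)"
    unfolding above_def using j xy by (auto simp: cut_pair)
  have aB: "z \<notin> Ds v" if "j = {v, z}" for z
  proof
    assume "z \<in> Ds v"
    then show False using down_child(8)[OF v _ \<open>z \<in> Ds v\<close>] that j xy by auto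
  qed
  show ?thesis
  proof (cases "v \<in> j")
    \<comment> \<open>Here \<open>j\<close> is itself \<open>{v, a}\<close> or
      \<open>{v, b}\<close>. It lies in its own code and, as its other end is outside
      \<open>Ds v\<close>, in \<open>above v\<close>, but not in the code of the remaining
      edge.\<close>
    case True
    then obtain z where z: "j = {v, z}" using xy by auto
    then have zE: "{v, z} \<in> E" using xy by auto
    have "z \<noteq> par v" using z j up_notin[OF v] unfolding up_def by auto
    then have "z = a \<or> z = b" using zE nbrs by auto
    moreover have "{v, a} = {v, b} \<longleftrightarrow> a = b" using va by (auto simp: doubleton_eq_iff)
    moreover have "z \<notin> Ds v" using aB z by simp
    moreover have "{x, y} = {v, z}" using xy z by simp
    ultimately show ?thesis
      using main codeB[of a] codeB[of b] Dv vB disj ab va z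
      by (auto simp: doubleton_eq_iff)
  next
    case False
    then have "j \<noteq> {v, a}" "j \<noteq> {v, b}" "x \<noteq> v" "y \<noteq> v" using xy by auto
    then have code: "j \<in> code {v, z} \<longleftrightarrow> (x \<in> B z \<longleftrightarrow> y \<notin> B z)" if "z = a \<or> z = b" for z
      using codeB[OF that] that unfolding B_def by auto
    show ?thesis
      unfolding main code[of a, simplified] code[of b, simplified] Dv
      using disj[of x] disj[of y] \<open>x \<noteq> v\<close> \<open>y \<noteq> v\<close> by argo
  qed
qed


section \<open>Separation of the codes of vertices\<close>

lemma vcode_eq:
  assumes v: "v \<in> W"
    and nbrs: "\<And>y. {v, y} \<in> E \<longleftrightarrow> y = a \<or> y = b \<or> y = par v"
  shows "vcode v = code {v, a} \<union> code {v, b} \<union> above v"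
proof -
  have "{e \<in> E. v \<in> e} = {{v, a}, {v, b}, up v}"
  proof (intro subset_antisym subsetI)
    fix e assume "e \<in> {e \<in> E. v \<in> e}"
    then obtain y where "e = {v, y}" "{v, y} \<in> E" using edgeE'[of e v] by auto
    then show "e \<in> {{v, a}, {v, b}, up v}" using nbrs unfolding up_def by auto
  qed (use nbrs in \<open>auto simp: up_def\<close>)
  then show ?thesis unfolding vcode_def using code_up[OF v] by auto
qed

lemma above_vcode: "v \<in> W \<Longrightarrow> above v \<subseteq> vcode v"
  unfolding vcode_def using up_E code_up by (fastforce simp: up_def)

lemma code_down:
  assumes v: "v \<in> W" and a: "{v, a} \<in> E" "a \<noteq> par v" and j: "j \<in> code {v, a}"
  shows "j \<inter> Ds v \<noteq> {}"
proof (cases "a \<in> Ds v")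
  case True
  then have "j \<in> cut (Ds a)" "Ds a \<subseteq> Ds v" using down_child[OF v a(1)] j unfolding above_def by auto
  then show ?thesis unfolding cut_def by auto
next
  case False
  then have "j = {v, a}" using down_nontree[OF v a] code_nontree j by auto
  then show ?thesis using Ds_self[OF v] by auto
qed

text \<open>Together with \<open>vcode_inside\<close> this locates the code of \<open>v\<close>: its
  elements cross the boundary of \<open>Ds v\<close> or lie inside \<open>Ds v\<close>, but never
  outside.\<close>

lemma vcode_meets: assumes v: "v \<in> W" and j: "j \<in> vcode v" shows "j \<inter> Ds v \<noteq> {}"
proof -
  obtain a b where ab: "a \<noteq> b" "a \<noteq> par v" "b \<noteq> par v" and
    nbrs: "\<And>y. {v, y} \<in> E \<longleftrightarrow> y = a \<or> y = b \<or> y = par v" using edges_at[OF v] by metis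
  consider "j \<in> code {v, a}" | "j \<in> code {v, b}" | "j \<in> above v" using j vcode_eq[OF v nbrs] by blast
  then show ?thesis
  proof cases
    case 3 then show ?thesis unfolding above_def cut_def by auto
  qed (use code_down[OF v] nbrs ab in auto)
qed

lemma vcode_nontree: "vcode v \<subseteq> nontree"
  unfolding vcode_def using code_nontree_subset by blast

lemma vcode_inside:
  assumes v: "v \<in> W" and j: "j \<in> vcode v" "j \<notin> above v" shows "j \<subseteq> Ds v"
  using vcode_meets[OF v j(1)] j(2) vcode_nontree j(1) unfolding above_def cut_def nontree_def by auto

text \<open>This is what the branching condition is made for. Let \<open>w\<close> lie below the
  child \<open>x\<close> of \<open>v\<close>, and let \<open>{v, b}\<close> be the other edge away
  from the root. If it is outside the tree, it is itself the element wanted; otherwise the exit from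
  \<open>Ds b\<close> to the outside of \<open>Ds v\<close> is.\<close>

lemma vcode_misses:
  assumes v: "v \<in> W" and w: "w \<in> Ds v" "w \<noteq> v" obtains j where "j \<in> vcode v" "j \<inter> Ds w = {}"
proof -
  obtain x where x: "x \<in> Ds v" "x \<noteq> v" "par x = v" "w \<in> Ds x" using childE[OF v w] by metis
  have xW: "x \<in> W" using Ds_W v x by blast
  have xE: "{v, x} \<in> E" using up_E[OF xW] x unfolding up_def by (simp add: insert_commute)
  obtain p q where pq: "p \<noteq> q" "p \<noteq> par v" "q \<noteq> par v" and
    nbrs: "\<And>y. {v, y} \<in> E \<longleftrightarrow> y = p \<or> y = q \<or> y = par v" using edges_at[OF v] by metis
  have "x \<noteq> par v" using x(1) par_notin[OF v] by metis
  then obtain b where b: "b \<noteq> x" "b \<noteq> par v" "{v, b} \<in> E" using nbrs pq xE by metis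
  have wx: "Ds w \<subseteq> Ds x" using Ds_mono[OF xW x(4)] .
  have bv: "code {v, b} \<subseteq> vcode v" using b unfolding vcode_def by auto
  note X = down_child[OF v xE x(1)]
  show ?thesis
  proof (cases "b \<in> Ds v")
    case False
    then have "{v, b} \<in> code {v, b}" using code_nontree down_nontree[OF v b(3,2)] by simp
    moreover have "{v, b} \<inter> Ds w = {}" using X(6,7) wx False by auto
    ultimately show ?thesis using that bv by blast
  next
    case True
    note B = down_child[OF v b(3) True]
    obtain y z where yz: "y \<in> Ds b" "z \<in> V" "z \<notin> Ds v" "{y, z} \<in> E"
      using child_exit[OF v True B(2,3)] by metis
    have zb: "z \<notin> Ds b" using yz B(7) by auto
    have "{y, z} \<in> cut (Ds b)" using cutI[OF yz(4,1) zb] .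
    moreover have "{y, z} \<noteq> up b"
      using yz Ds_self[OF v] zb Ds_self[OF B(1)] B(3) unfolding up_def by (auto simp: doubleton_eq_iff)
    ultimately have "{y, z} \<in> code {v, b}" using cut_Ds[OF B(1)] B(5) by auto
    moreover have "{y, z} \<inter> Ds w = {}"
      using siblings_disjoint[OF v xE x(1) b(3) True b(1)[symmetric]] yz wx X(7) by auto
    ultimately show ?thesis using that bv by blast
  qed
qed

text \<open>Each element of \<open>above w\<close> has exactly one end in \<open>Ds w\<close>. If
  \<open>w\<close> is below \<open>v\<close>, this contradicts \<open>vcode_misses\<close>.
  Otherwise it prevents the elements of \<open>vcode v\<close> from lying inside
  \<open>Ds v\<close>, so that \<open>vcode v = above v\<close> and \<open>inj_above\<close>
  applies.\<close>

lemma vcode_neq_above: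
  assumes vw: "v \<in> W" "w \<in> W" "v \<noteq> w" shows "vcode v \<noteq> above w"
proof
  assume eq: "vcode v = above w"
  have meets: "j \<inter> Ds w \<noteq> {}" "\<not> j \<subseteq> Ds w" if "j \<in> vcode v" for j
    using that eq unfolding above_def cut_def by auto
  consider "w \<in> Ds v" | "v \<in> Ds w" | "Ds v \<inter> Ds w = {}" using Ds_laminar vw by blast
  then show False
  proof cases
    case 1 then show ?thesis using vcode_misses[OF vw(1) 1] vw(3) meets by metis
  next
    case 2
    have "vcode v = above v"
    proof (intro subset_antisym above_vcode[OF vw(1)] subsetI)
      fix j assume j: "j \<in> vcode v"
      then show "j \<in> above v" using vcode_inside[OF vw(1) j] meets[OF j] Ds_mono[OF vw(2) 2] by blast
    qed
    then show ?thesis using eq inj_above vw unfolding inj_on_def by auto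
  next
    case 3
    have "vcode v = above v"
    proof (intro subset_antisym above_vcode[OF vw(1)] subsetI)
      fix j assume j: "j \<in> vcode v"
      then show "j \<in> above v" using vcode_inside[OF vw(1) j] meets[OF j] 3 by blast
    qed
    then show ?thesis using eq inj_above vw unfolding inj_on_def by auto
  qed
qed

lemma vcode_neq_below:
  assumes vw: "v \<in> W" "w \<in> Ds v" "v \<noteq> w" shows "vcode v \<noteq> vcode w"
proof -
  obtain j where "j \<in> vcode v" "j \<inter> Ds w = {}"
    using vcode_misses[OF vw(1,2) vw(3)[symmetric]] by metis
  moreover have "w \<in> W" using Ds_W vw by blast
  ultimately show ?thesis using vcode_meets[of w j] by auto
qed

text \<open>By \<open>vcode_neq_below\<close> only disjoint \<open>Ds v\<close> and
  \<open>Ds w\<close> remain. An element of the common code meets both sets, hence crosses the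
  boundary of \<open>Ds v\<close>; this makes the code of \<open>w\<close> equal to
  \<open>above v\<close>.\<close>

lemma inj_vcode_W: "inj_on vcode W"
proof (rule inj_onI)
  fix v w assume vw: "v \<in> W" "w \<in> W" "vcode v = vcode w"
  show "v = w"
  proof (rule ccontr)
    assume ne: "v \<noteq> w"
    have "Ds v \<inter> Ds w = {}"
      using Ds_laminar[OF vw(1,2)] vcode_neq_below[OF vw(1) _ ne] vcode_neq_below[OF vw(2) _ ne[symmetric]] vw(3)
      by auto
    then have "vcode v \<subseteq> above v"
    proof (intro subsetI)
      fix j assume D: "Ds v \<inter> Ds w = {}" and j: "j \<in> vcode v"
      then have "j \<inter> Ds w \<noteq> {}" using vcode_meets[OF vw(2)] vw(3) by simp
      then have "\<not> j \<subseteq> Ds v" using D by blast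
      then show "j \<in> above v" using vcode_inside[OF vw(1) j] by metis
    qed
    then show False using above_vcode[OF vw(1)] vcode_neq_above[OF vw(2,1)] ne vw(3) by auto
  qed
qed

lemma above_c: "above c = {e \<in> E. r \<in> e} - {up c}"
proof -
  have "insert (up c) (above c) = {e \<in> E. r \<in> e}"
    using cut_Ds[OF c] cut_complement_vertex[OF r] Ds_c by simp
  moreover have "up c \<notin> above c" using up_notin[OF c] unfolding above_def by simp
  ultimately show ?thesis by blast
qed

lemma edges_root: "{e \<in> E. r \<in> e} = insert (up c) (above c)"
  using cut_Ds[OF c] cut_complement_vertex[OF r] Ds_c by simp

text \<open>The two edges at \<open>r\<close> outside the tree both cross the fundamental cut of
  \<open>up c\<close>. So the root is a vertex whose code equals the code of an edge.\<close>

lemma vcode_root: "vcode r = above c"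
proof -
  have "code e = {e}" if "e \<in> above c" for e
    using that code_nontree unfolding above_def by simp
  then show ?thesis unfolding vcode_def edges_root using code_up[OF c] by auto
qed

lemma card_above_c: "card (above c) = 2"
proof -
  have "up c \<in> {e \<in> E. r \<in> e}" using edges_root by blast
  then show ?thesis unfolding above_c using degree[OF r] by (simp add: card_Diff_singleton)
qed

text \<open>Both neighbours of \<open>c\<close> other than \<open>r\<close> are children, as
  \<open>Ds c\<close> is everything but \<open>r\<close>. Their codes would be subsets with at least
  two elements of the two-element set \<open>above c\<close>, hence equal to each other.\<close>

lemma vcode_c: "vcode c \<noteq> above c"
proof
  assume eq: "vcode c = above c"
  obtain a b where ab: "a \<noteq> b" "a \<noteq> par c" "b \<noteq> par c" and
    nbrs: "\<And>y. {c, y} \<in> E \<longleftrightarrow> y = a \<or> y = b \<or> y = par c" using edges_at[OF c] by metis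
  have E: "{c, a} \<in> E" "{c, b} \<in> E" using nbrs by auto
  have D: "a \<in> Ds c" "b \<in> Ds c" using E adj_V ab unfolding Ds_c par_c by auto
  note A = down_child[OF c E(1) D(1)] and B = down_child[OF c E(2) D(2)]
  have "above a \<subseteq> above c" "above b \<subseteq> above c"
    using eq vcode_eq[OF c nbrs] A(5) B(5) by auto
  then have "above a = above c" "above b = above c"
    using card_above[OF A(1)] card_above[OF B(1)] card_above_c finite_above[of c]
    by (metis card_seteq)+
  then show False using inj_above A(1) B(1) ab unfolding inj_on_def by auto
qed

lemma inj_vcode: "inj_on vcode V"
proof -
  have "vcode v \<noteq> vcode r" if "v \<in> W" for v
    using that vcode_root vcode_c vcode_neq_above c by metis
  then show ?thesis using inj_vcode_W unfolding inj_on_def by (metis DiffI singletonD)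
qed

section \<open>Codes of edges compared with each other and with codes of vertices\<close>

lemma E_cases:
  assumes "e \<in> E" obtains "e \<in> nontree" "code e = {e}" | v where "v \<in> W" "e = up v" "code e = above v"
  using assms code_nontree code_up unfolding nontree_def by blast

lemma card_vcode: assumes "v \<in> V" shows "2 \<le> card (vcode v)"
proof (cases "v = r")
  case True then show ?thesis using vcode_root card_above_c by simp
next
  case False
  have "finite (vcode v)" using vcode_nontree finite_E unfolding nontree_def
    by (meson Diff_subset finite_subset)
  then have "card (above v) \<le> card (vcode v)" using above_vcode False assms by (intro card_mono) auto
  then show ?thesis using card_above[of v] False assms by simp
qed

text \<open>The code of an edge outside the tree is a singleton and thus too small. For a tree edge
  \<open>up w\<close> the separation results leave only \<open>v = w\<close> or, with
  \<open>w = c\<close>, the root.\<close>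

lemma vcode_eq_code:
  assumes v: "v \<in> V" and e: "e \<in> E" and eq: "vcode v = code e" shows "v \<in> e"
  using e
proof (cases rule: E_cases)
  case 1 then show ?thesis using card_vcode[OF v] eq by simp
next
  case (2 w)
  show ?thesis
  proof (cases "v = r")
    case True
    then have "w = c" using 2 eq vcode_root inj_above c unfolding inj_on_def by auto
    then show ?thesis using 2 True par_c unfolding up_def by simp
  next
    case False
    then have "v = w" using vcode_neq_above[of v w] v 2 eq by auto
    then show ?thesis using 2 unfolding up_def by simp
  qed
qed

lemma inj_code: "inj_on code E"
proof (rule inj_onI)
  fix e f assume ef: "e \<in> E" "f \<in> E" "code e = code f"
  have two: "above v \<noteq> {x}" if "v \<in> W" for v x
    using card_above[OF that] by auto
  show "e = f" using ef(1)
  proof (cases rule: E_cases)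
    case 1
    show ?thesis using ef(2) by (cases rule: E_cases) (use 1 two ef in auto)
  next
    case (2 v)
    note v = this
    show ?thesis using ef(2)
    proof (cases rule: E_cases)
      case 1 then show ?thesis using two[OF v(1), of f] v ef(3) by simp
    next
      case (2 w)
      then have "v = w" using inj_onD[OF inj_above, of v w] v ef(3) by simp
      then show ?thesis using v 2 by simp
    qed
  qed
qed

lemma code_nonempty: "e \<in> E \<Longrightarrow> code e \<noteq> {}"
  using card_above by (elim E_cases) fastforce+

text \<open>Away from the root, \<open>code_xor\<close> puts \<open>j\<close> into exactly two of
  the three codes at \<open>v\<close>. The edge that misses \<open>j\<close> determines the class of
  the coordinate \<open>j\<close> on the line of \<open>v\<close>.\<close>

lemma code_missing_once:
  assumes v: "v \<in> V" and j: "j \<in> vcode v" shows "\<exists>!e. e \<in> E \<and> v \<in> e \<and> j \<notin> code e"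
proof (cases "v = r")
  case True
  have "j \<in> above c" using j True vcode_root by simp
  moreover obtain x y where xy: "above c = {x, y}" "x \<noteq> y"
    using card_above_c by (auto simp: card_2_iff)
  moreover have "code x = {x}" "code y = {y}" "code (up c) = {x, y}"
    using code_nontree code_up[OF c] xy unfolding above_def by auto
  moreover have "e \<in> E \<and> r \<in> e \<longleftrightarrow> e = up c \<or> e = x \<or> e = y" for e
    using edges_root xy by auto
  \<comment> \<open>At the root the three codes are \<open>{x}\<close>, \<open>{y}\<close> and
    \<open>{x, y}\<close>, so the missing edge is the one of \<open>x\<close> and \<open>y\<close>
    that differs from \<open>j\<close>.\<close>
  ultimately show ?thesis
    using True by (intro ex1I[of _ "if j = x then y else x"]) (metis insert_iff singleton_iff)+
next
  case False
  then have vW: "v \<in> W" using v by simp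
  obtain a b where ab: "a \<noteq> b" "a \<noteq> par v" "b \<noteq> par v" and
    nbrs: "\<And>y. {v, y} \<in> E \<longleftrightarrow> y = a \<or> y = b \<or> y = par v" using edges_at[OF vW] by metis
  have E: "e \<in> E \<and> v \<in> e \<longleftrightarrow> e = {v, a} \<or> e = {v, b} \<or> e = up v" for e
  proof
    assume "e \<in> E \<and> v \<in> e"
    then obtain y where "e = {v, y}" "{v, y} \<in> E" using edgeE'[of e v] by auto
    then show "e = {v, a} \<or> e = {v, b} \<or> e = up v" using nbrs unfolding up_def by auto
  qed (use nbrs in \<open>auto simp: up_def\<close>)
  have "j \<in> code {v, a} \<or> j \<in> code {v, b} \<or> j \<in> above v"
    using j vcode_eq[OF vW nbrs] by blast
  moreover have "j \<in> above v \<longleftrightarrow> (j \<in> code {v, a} \<longleftrightarrow> j \<notin> code {v, b})"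
    by (rule code_xor[OF vW ab nbrs])
  ultimately consider
      "j \<notin> code {v, a}" "j \<in> code {v, b}" "j \<in> code (up v)"
    | "j \<in> code {v, a}" "j \<notin> code {v, b}" "j \<in> code (up v)"
    | "j \<in> code {v, a}" "j \<in> code {v, b}" "j \<notin> code (up v)"
    unfolding code_up[OF vW] by argo
  then obtain e0 where "e \<in> E \<and> v \<in> e \<and> j \<notin> code e \<longleftrightarrow> e = e0" for e
    by cases (metis E)+
  then show ?thesis by simp
qed

end

section \<open>Existence of the tree; the numbers of vertices and edges\<close>

lemma (in cubic_graph) tree_exists:
  assumes "r \<in> V" shows "\<exists>c Ds par. cubic_graph_tree V E r c Ds par"
proof -
  have "{e \<in> E. r \<in> e} \<noteq> {}" using degree[OF assms] by force
  then obtain e where "e \<in> E" "r \<in> e" by blast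
  then obtain c where "{r, c} \<in> E" "r \<noteq> c" "c \<in> V" using edgeE' by (metis edge_subset insert_subset)
  then have "\<exists>Ds par. branching_tree (V - {r}) c r Ds par"
    using assms by (intro branching_tree_exists conn_remove_vertex) (auto simp: insert_commute)
  then show ?thesis
    using assms \<open>r \<noteq> c\<close> \<open>c \<in> V\<close> cubic_graph_axioms
    unfolding cubic_graph_tree_def cubic_graph_tree_axioms_def by blast
qed

lemma (in cubic_graph) sum_degrees: "3 * card V = 2 * card E"
proof -
  have "(\<Sum>v\<in>V. card {e \<in> E. v \<in> e}) = 2 * card E"
  proof (rule sum_multicount[OF finite_V finite_E], rule ballI)
    fix e assume e: "e \<in> E"
    then have "{v \<in> V. v \<in> e} = e" using edge_subset by blast
    then show "card {v \<in> V. v \<in> e} = 2" using card_edge e by simp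
  qed
  then show ?thesis using degree by simp
qed

context cubic_graph_tree begin

lemma card_nontree: "card E = card nontree + (card V - 1)"
proof -
  have "up ` W \<subseteq> E" using up_E by auto
  then have "card nontree = card E - card (up ` W)"
    unfolding nontree_def using finite_E by (meson card_Diff_subset finite_subset)
  moreover have "card (up ` W) = card V - 1" using card_image[OF inj_up] r by simp
  moreover have "card (up ` W) \<le> card E" using \<open>up ` W \<subseteq> E\<close> finite_E by (rule card_mono[rotated])
  ultimately show ?thesis by simp
qed

end

section \<open>The genus\<close>

lemma sum_fun_apply: "(\<Sum>x\<in>A. f x) p = (\<Sum>x\<in>A. f x p)"
  for f :: "'a \<Rightarrow> 'b \<Rightarrow> 'c::comm_monoid_add"
  by (induction A rule: infinite_finite_induct) auto

text \<open>The 1-chain of the edge oriented from \<open>a\<close> to \<open>b\<close>;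
  \<open>sum_dart\<close> computes its boundary.\<close>

definition dart :: "'v \<Rightarrow> 'v \<Rightarrow> 'v \<times> 'v \<Rightarrow> real" where
  "dart a b p = of_bool (p = (a, b)) - of_bool (p = (b, a))"

lemma dart_antisym: "dart a b (v, u) = - dart a b (u, v)"
  by (simp add: dart_def conj_commute)

lemma dart_support: "{u, v} \<noteq> {a, b} \<Longrightarrow> dart a b (u, v) = 0"
  unfolding dart_def by (auto simp: insert_commute)

lemma sum_dart:
  assumes "finite V" "a \<in> V" "b \<in> V"
  shows "(\<Sum>w\<in>V. dart a b (v, w)) = of_bool (v = a) - of_bool (v = b)"
proof -
  have "(\<Sum>w\<in>V. dart a b (v, w)) = (\<Sum>w\<in>V. of_bool (v = a) * of_bool (w = b)) - (\<Sum>w\<in>V. of_bool (v = b) * of_bool (w = a))"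
    unfolding dart_def sum_subtractf[symmetric] by (simp only: prod.inject of_bool_conj)
  moreover have "(\<Sum>w\<in>V. of_bool (w = x)) = (1::real)" if "x \<in> V" for x
    using that assms(1) by (simp add: of_bool_def)
  ultimately show ?thesis using assms by (simp flip: sum_distrib_left)
qed

lemma cycle_spaceD:
  assumes "f \<in> cycle_space V E"
  shows "f (v, u) = - f (u, v)" "{u, v} \<notin> E \<Longrightarrow> f (u, v) = 0" "u \<in> V \<Longrightarrow> (\<Sum>v\<in>V. f (u, v)) = 0"
  using assms unfolding cycle_space_def by blast+

context cubic_graph_tree begin

text \<open>The vertices \<open>x\<close> with \<open>u\<close> in \<open>Ds x\<close> are those on
  the tree path from \<open>u\<close> to \<open>r\<close>, without \<open>r\<close>. The boundaries
  of the edges of this path telescope.\<close>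

lemma sum_root_path:
  assumes u: "u \<in> V" and v: "v \<in> V"
  shows "(\<Sum>x\<in>W. of_bool (u \<in> Ds x) * (of_bool (v = x) - of_bool (v = par x)))
         = (of_bool (v = u) - of_bool (v = r) :: real)"
proof -
  have fW: "finite W" using finite_V by simp
  let ?C = "{x \<in> W. par x = v \<and> u \<in> Ds x}"
  have "(\<Sum>x\<in>W. of_bool (u \<in> Ds x) * (of_bool (v = x) - of_bool (v = par x)))
      = (\<Sum>x\<in>W. of_bool (v = x) * of_bool (u \<in> Ds x)) - (\<Sum>x\<in>W. of_bool (v = par x \<and> u \<in> Ds x) :: real)"
    unfolding sum_subtractf[symmetric] by (simp only: of_bool_conj right_diff_distrib mult.commute)
  also have "(\<Sum>x\<in>W. of_bool (v = x) * of_bool (u \<in> Ds x) :: real) = of_bool (v \<in> W \<and> u \<in> Ds v)"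
  proof -
    have "(\<Sum>x\<in>W. of_bool (v = x) * of_bool (u \<in> Ds x) :: real)
        = (\<Sum>x\<in>W. if v = x then of_bool (u \<in> Ds v) else 0)"
      by (rule sum.cong) (simp_all del: Diff_iff)
    also have "\<dots> = (if v \<in> W then of_bool (u \<in> Ds v) else 0)" by (rule sum.delta'[OF fW])
    finally show ?thesis by simp
  qed
  also have "(\<Sum>x\<in>W. of_bool (v = par x \<and> u \<in> Ds x) :: real) = real (card ?C)"
    using fW by (simp add: of_bool_def sum.If_cases Int_def eq_commute conj_ac)
  \<comment> \<open>The number of children through which the path from \<open>u\<close> to the root
    enters \<open>v\<close>: one if the path reaches \<open>v\<close> from below, none
    otherwise.\<close>
  also have "card ?C = of_bool (v \<noteq> u \<and> (v = r \<or> u \<in> Ds v))"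
  proof (cases "v = r")
    case True
    have "?C = (if u = r then {} else {c})"
    proof -
      have "x = c" if "x \<in> W" "par x = r" for x using par_W that by blast
      moreover have "u \<in> Ds x \<Longrightarrow> u \<noteq> r" if "x \<in> W" for x using Ds_W that by blast
      moreover have "c \<in> W" "c \<in> ?C \<longleftrightarrow> u \<noteq> r" using c par_c Ds_c u True by auto
      ultimately show ?thesis using True by (auto simp del: Diff_iff)
    qed
    then show ?thesis using True by auto
  next
    case False
    then have vW: "v \<in> W" using v by simp
    show ?thesis
    proof (cases "u \<in> Ds v \<and> u \<noteq> v")
      case True
      then obtain x where x: "x \<in> Ds v" "x \<noteq> v" "par x = v" "u \<in> Ds x" using childE[OF vW] by metis
      have xW: "x \<in> W" using x Ds_W vW by blast
      have "y = x" if "y \<in> ?C" for y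
      proof (rule ccontr)
        assume "y \<noteq> x"
        have y: "y \<in> Ds v" using par_eq[of y v] that vW by simp
        have "{v, y} \<in> E" "{v, x} \<in> E" using up_E[of y] up_E[of x] that x xW
          unfolding up_def by (auto simp: insert_commute)
        then have "Ds y \<inter> Ds x = {}" using siblings_disjoint[OF vW _ y _ x(1) \<open>y \<noteq> x\<close>] by blast
        then show False using that x by blast
      qed
      then have "?C = {x}" using x xW by blast
      then show ?thesis using True False by auto
    next
      case nb: False
      have "x \<notin> ?C" for x
      proof
        assume x: "x \<in> ?C"
        then have xd: "x \<in> Ds v" "x \<noteq> v" using par_eq[of x v] vW by auto
        then have "u \<in> Ds v" using Ds_mono[OF vW xd(1)] x by auto
        then have "u = v" using nb by blast
        then show False using Ds_antisym[OF vW xd] x by simp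
      qed
      then have C0: "?C = {}" by blast
      show ?thesis unfolding C0 using nb False by auto
    qed
  qed
  finally have "(\<Sum>x\<in>W. of_bool (u \<in> Ds x) * (of_bool (v = x) - of_bool (v = par x)))
      = of_bool (v \<in> W \<and> u \<in> Ds v) - (of_bool (v \<noteq> u \<and> (v = r \<or> u \<in> Ds v)) :: real)"
    by simp
  also have "\<dots> = of_bool (v = u) - of_bool (v = r)"
    using v Ds_self[of v] by (cases "v = r"; cases "v = u") simp_all
  finally show ?thesis .
qed

text \<open>Summing the conservation law over \<open>Ds x\<close> cancels the flow inside by
  antisymmetry. The rest crosses the fundamental cut, where only \<open>up x\<close> can carry a
  nonzero value, so this value is zero too.\<close>

lemma cycle_space_zero:
  assumes g: "g \<in> cycle_space V E" and zero: "\<And>u v. {u, v} \<in> nontree \<Longrightarrow> g (u, v) = 0"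
  shows "g = (\<lambda>_. 0)"
proof -
  have anti: "g (v, u) = - g (u, v)" and supp: "{u, v} \<notin> E \<Longrightarrow> g (u, v) = 0"
    and cons: "u \<in> V \<Longrightarrow> (\<Sum>v\<in>V. g (u, v)) = 0" for u v
    by (fact cycle_spaceD[OF g])+
  have tree_zero: "g (x, par x) = 0" if x: "x \<in> W" for x
  proof -
    let ?D = "Ds x"
    have D: "?D \<subseteq> V" "finite ?D" using Ds_W[OF x] finite_V by (auto intro: finite_subset)
    have "(\<Sum>u\<in>?D. \<Sum>v\<in>?D. g (u, v)) = (\<Sum>u\<in>?D. \<Sum>v\<in>?D. - g (u, v))"
      by (subst sum.swap) (intro sum.cong refl anti)
    then have inner: "(\<Sum>u\<in>?D. \<Sum>v\<in>?D. g (u, v)) = 0" by (simp add: sum_negf)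
    have "0 = (\<Sum>u\<in>?D. \<Sum>v\<in>V. g (u, v))" using cons D by (simp add: subset_iff)
    also have "\<dots> = (\<Sum>u\<in>?D. (\<Sum>v\<in>?D. g (u, v)) + (\<Sum>v\<in>V - ?D. g (u, v)))"
      using D finite_V by (simp add: sum.subset_diff add.commute)
    also have "\<dots> = (\<Sum>u\<in>?D. \<Sum>v\<in>V - ?D. g (u, v))"
      using inner by (simp add: sum.distrib)
    also have "\<dots> = (\<Sum>p\<in>?D \<times> (V - ?D). g p)" by (simp add: sum.cartesian_product)
    also have "\<dots> = (\<Sum>p\<in>{(x, par x)}. g p)"
    proof (rule sum.mono_neutral_right)
      show "finite (?D \<times> (V - ?D))" using D finite_V by simp
      show "{(x, par x)} \<subseteq> ?D \<times> (V - ?D)"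
        using Ds_self[OF x] par_notin[OF x] adj_V(2)[of x "par x"] up_E[OF x] unfolding up_def by auto
      show "\<forall>p\<in>?D \<times> (V - ?D) - {(x, par x)}. g p = 0"
      proof
        fix p assume p: "p \<in> ?D \<times> (V - ?D) - {(x, par x)}"
        obtain u v where uv: "p = (u, v)" "u \<in> ?D" "v \<notin> ?D" using p by auto
        show "g p = 0"
        proof (cases "{u, v} \<in> E")
          case True
          have "{u, v} \<in> insert (up x) (above x)" using cutI[OF True uv(2,3)] cut_Ds[OF x] by simp
          moreover have "{u, v} \<noteq> up x"
            using p uv Ds_self[OF x] par_notin[OF x] unfolding up_def by (auto simp: doubleton_eq_iff)
          ultimately show ?thesis using zero uv unfolding above_def by auto
        next
          case False then show ?thesis using supp uv by simp
        qed
      qed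
    qed
    finally show ?thesis by simp
  qed
  have "g (u, v) = 0" for u v
  proof (cases "{u, v} \<in> E")
    case False then show ?thesis using supp by simp
  next
    case True
    show ?thesis
    proof (cases "{u, v} \<in> nontree")
      case True then show ?thesis using zero by simp
    next
      case False
      then obtain x where "x \<in> W" "{u, v} = {x, par x}" using True unfolding nontree_def up_def by auto
      then show ?thesis using tree_zero[of x] anti[of x "par x"] by (auto simp: doubleton_eq_iff)
    qed
  qed
  then show ?thesis by auto
qed

text \<open>The fundamental cycles form a basis. Evaluation at the edges outside the tree is dual to
  them, which gives independence; subtracting the combination with the right values leaves a cycle
  covered by \<open>cycle_space_zero\<close>, which gives spanning.\<close>

lemma genus_eq: "genus V E = card nontree"
proof -
  interpret F: vector_space "\<lambda>(c :: real) (f :: 'a \<times> 'a \<Rightarrow> real) p. c * f p" by (rule vector_space_fun)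
  have finN: "finite nontree" using finite_E unfolding nontree_def by simp
  have fW: "finite W" using finite_V by simp
  have "\<exists>x y. j = {x, y} \<and> x \<noteq> y \<and> x \<in> V \<and> y \<in> V \<and> {x, y} \<in> E" if "j \<in> nontree" for j
    using nontreeE[OF that] by metis
  then obtain s t where st: "\<And>j. j \<in> nontree \<Longrightarrow> j = {s j, t j} \<and> s j \<noteq> t j \<and> s j \<in> V \<and> t j \<in> V \<and> {s j, t j} \<in> E"
    by metis
  \<comment> \<open>The coefficients of the way from \<open>t j\<close> to the root and from the
    root to \<open>s j\<close>; on the common part they cancel.\<close>
  define k where "k j x = (of_bool (t j \<in> Ds x) - of_bool (s j \<in> Ds x) :: real)" for j x
  define cyc where "cyc j p = dart (s j) (t j) p + (\<Sum>x\<in>W. k j x * dart x (par x) p)" for j p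
  have parV: "par x \<in> V" "x \<in> V" "{x, par x} \<in> E" if "x \<in> W" for x
    using up_E[OF that] adj_V unfolding up_def by auto
  have cyc_space: "cyc j \<in> cycle_space V E" if j: "j \<in> nontree" for j
    unfolding cycle_space_def
  proof (intro CollectI conjI allI ballI impI)
    show "cyc j (v, u) = - cyc j (u, v)" for u v
      unfolding cyc_def dart_antisym[of _ _ v u] by (simp add: sum_negf)
    show "cyc j (u, v) = 0" if "{u, v} \<notin> E" for u v
    proof -
      have "{u, v} \<noteq> {s j, t j}" using st[OF j] that by auto
      moreover have "{u, v} \<noteq> {x, par x}" if "x \<in> W" for x using parV[OF that] \<open>{u, v} \<notin> E\<close> by auto
      ultimately show ?thesis unfolding cyc_def by (simp add: dart_support)
    qed
    fix v assume v: "v \<in> V"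
    have "(\<Sum>w\<in>V. cyc j (v, w)) = (\<Sum>w\<in>V. dart (s j) (t j) (v, w)) + (\<Sum>x\<in>W. k j x * (\<Sum>w\<in>V. dart x (par x) (v, w)))"
      unfolding cyc_def sum.distrib sum_distrib_left by (intro arg_cong2[where f = "(+)"] refl sum.swap)
    also have "(\<Sum>w\<in>V. dart (s j) (t j) (v, w)) = of_bool (v = s j) - of_bool (v = t j)"
      using st[OF j] finite_V by (intro sum_dart) auto
    also have "(\<Sum>x\<in>W. k j x * (\<Sum>w\<in>V. dart x (par x) (v, w))) = (\<Sum>x\<in>W. k j x * (of_bool (v = x) - of_bool (v = par x)))"
      by (rule sum.cong[OF refl]) (simp only: sum_dart[OF finite_V parV(2) parV(1)])
    also have "\<dots> = (of_bool (v = t j) - of_bool (v = r)) - (of_bool (v = s j) - of_bool (v = r))"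
      unfolding k_def left_diff_distrib sum_subtractf
      using st[OF j] v by (simp add: sum_root_path)
    finally show "(\<Sum>w\<in>V. cyc j (v, w)) = 0" by simp
  qed
  have cyc_eval: "cyc j (s i, t i) = of_bool (i = j)" if ij: "i \<in> nontree" "j \<in> nontree" for i j
  proof -
    have "dart x (par x) (s i, t i) = 0" if "x \<in> W" for x
      using up_notin[OF that] st[OF ij(1)] ij(1) unfolding up_def by (intro dart_support) metis
    moreover have "dart (s j) (t j) (s i, t i) = of_bool (i = j)"
    proof (cases "i = j")
      case True then show ?thesis using st[OF ij(1)] unfolding dart_def by auto
    next
      case False
      then have "{s i, t i} \<noteq> {s j, t j}" using st ij by metis
      then show ?thesis using False by (simp add: dart_support)
    qed
    ultimately show ?thesis unfolding cyc_def by simp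
  qed
  have inj: "inj_on cyc nontree"
  proof (rule inj_onI)
    fix i j assume "i \<in> nontree" "j \<in> nontree" "cyc i = cyc j"
    then have "of_bool (i = j) = (1::real)" using cyc_eval[of i i] cyc_eval[of i j] by simp
    then show "i = j" by simp
  qed
  have "F.dim (cycle_space V E) = card nontree"
  proof (rule F.dim_unique)
    show "cyc ` nontree \<subseteq> cycle_space V E" using cyc_space by auto
    show "card (cyc ` nontree) = card nontree" using inj by (rule card_image)
    show "F.independent (cyc ` nontree)"
    proof (rule F.independent_if_scalars_zero)
      show "finite (cyc ` nontree)" using finN by simp
      fix f x assume z: "(\<Sum>x\<in>cyc ` nontree. (\<lambda>p. f x * x p)) = 0" and "x \<in> cyc ` nontree"
      then obtain i where i: "i \<in> nontree" "x = cyc i" by auto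
      have "0 = (\<Sum>x\<in>cyc ` nontree. (\<lambda>p. f x * x p)) (s i, t i)" using z by simp
      also have "\<dots> = (\<Sum>j\<in>nontree. f (cyc j) * cyc j (s i, t i))"
        unfolding sum_fun_apply using inj by (simp add: sum.reindex)
      also have "\<dots> = (\<Sum>j\<in>nontree. if i = j then f (cyc j) else 0)"
        using cyc_eval[OF i(1)] by (intro sum.cong) auto
      also have "\<dots> = f x" using finN i by simp
      finally show "f x = 0" by simp
    qed
    show "cycle_space V E \<subseteq> F.span (cyc ` nontree)"
    proof
      fix f assume f: "f \<in> cycle_space V E"
      define h where "h p = (\<Sum>j\<in>nontree. f (s j, t j) * cyc j p)" for p
      have cs: "cyc j (v, u) = - cyc j (u, v)" "{u, v} \<notin> E \<Longrightarrow> cyc j (u, v) = 0"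
        "u \<in> V \<Longrightarrow> (\<Sum>v\<in>V. cyc j (u, v)) = 0" if "j \<in> nontree" for j u v
        by (fact cycle_spaceD[OF cyc_space[OF that]])+
      have fs: "f (v, u) = - f (u, v)" "{u, v} \<notin> E \<Longrightarrow> f (u, v) = 0"
        "u \<in> V \<Longrightarrow> (\<Sum>v\<in>V. f (u, v)) = 0" for u v
        by (fact cycle_spaceD[OF f])+
      have "(\<lambda>p. f p - h p) \<in> cycle_space V E"
        unfolding cycle_space_def
      proof (intro CollectI conjI allI ballI impI)
        show "f (v, u) - h (v, u) = - (f (u, v) - h (u, v))" for u v
        proof -
          have "h (v, u) = - h (u, v)"
            unfolding h_def sum_negf[symmetric] by (intro sum.cong refl) (simp add: cs(1)[of _ v u])
          then show ?thesis using fs(1)[of v u] by simp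
        qed
        show "f (u, v) - h (u, v) = 0" if "{u, v} \<notin> E" for u v
          using fs(2) cs(2) that unfolding h_def by simp
        show "(\<Sum>v\<in>V. f (u, v) - h (u, v)) = 0" if "u \<in> V" for u
        proof -
          have "(\<Sum>v\<in>V. h (u, v)) = (\<Sum>j\<in>nontree. f (s j, t j) * (\<Sum>v\<in>V. cyc j (u, v)))"
            unfolding h_def by (subst sum.swap) (simp add: sum_distrib_left)
          then show ?thesis using fs(3) cs(3) that by (simp add: sum_subtractf)
        qed
      qed
      moreover have "f (u, v) - h (u, v) = 0" if uv: "{u, v} \<in> nontree" for u v
      proof -
        have hst: "h (s i, t i) = f (s i, t i)" if i: "i \<in> nontree" for i
        proof -
          have "h (s i, t i) = (\<Sum>j\<in>nontree. if i = j then f (s j, t j) else 0)"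
            unfolding h_def using cyc_eval[OF i] by (intro sum.cong) auto
          then show ?thesis using finN i by simp
        qed
        have "h (v, u) = - h (u, v)" for u v
            unfolding h_def sum_negf[symmetric] by (intro sum.cong refl) (simp add: cs(1)[of _ v u])
        then have "h (v, u) = - h (u, v)" by blast
        moreover have "u = s {u, v} \<and> v = t {u, v} \<or> u = t {u, v} \<and> v = s {u, v}"
          using st[OF uv] by (metis doubleton_eq_iff)
        moreover have "h (u, v) = f (u, v)" if "u = s {u, v}" "v = t {u, v}"
          using hst[OF uv] that by simp
        moreover have "h (v, u) = f (v, u)" if "u = t {u, v}" "v = s {u, v}"
          using hst[OF uv] that by simp
        ultimately show ?thesis using fs(1)[of v u] by force
      qed
      ultimately have "(\<lambda>p. f p - h p) = (\<lambda>_. 0)" by (rule cycle_space_zero)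
      then have zero: "f p - h p = 0" for p by (rule fun_cong)
      have "f = (\<Sum>j\<in>nontree. (\<lambda>p. f (s j, t j) * cyc j p))"
      proof (rule ext)
        fix p show "f p = (\<Sum>j\<in>nontree. (\<lambda>p. f (s j, t j) * cyc j p)) p"
          using zero[of p] unfolding sum_fun_apply h_def by linarith
      qed
      moreover have "(\<Sum>j\<in>nontree. (\<lambda>p. f (s j, t j) * cyc j p)) \<in> F.span (cyc ` nontree)"
        by (intro F.span_sum F.span_scale F.span_base) auto
      ultimately show "f \<in> F.span (cyc ` nontree)" by simp
    qed
  qed
  then show ?thesis unfolding genus_def .
qed

end

section \<open>From edge connectivity to sets of numbered coordinates\<close>

lemma card_cut_edge_connected:
  assumes sg: "finite_simple_graph V E" and ec: "edge_connected k V E"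
    and X: "X \<subseteq> V" "X \<noteq> {}" "X \<noteq> V"
  shows "k \<le> card {e \<in> E. e \<inter> X \<noteq> {} \<and> \<not> e \<subseteq> X}"
proof (rule ccontr)
  define F where "F = {e \<in> E. e \<inter> X \<noteq> {} \<and> \<not> e \<subseteq> X}"
  assume "\<not> ?thesis"
  then have small: "card F < k" unfolding F_def by simp
  have "F \<subseteq> Pow V" using sg unfolding finite_simple_graph_def F_def by auto
  moreover have "finite V" using sg unfolding finite_simple_graph_def by auto
  ultimately have "finite F" by (simp add: finite_subset)
  have F_sub: "F \<subseteq> E" unfolding F_def by blast
  then have conn: "connected_graph V (E - F)"
    using ec small \<open>finite F\<close> F_sub unfolding edge_connected_def by (elim conjE allE impE) auto
  obtain u v where uv: "u \<in> X" "v \<in> V" "v \<notin> X" using X by blast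
  have "(u, v) \<in> {(a, b). {a, b} \<in> E - F}\<^sup>*"
    using conn uv X unfolding connected_graph_def by blast
  \<comment> \<open>A walk that starts in \<open>X\<close> and avoids the cut \<open>F\<close> never
    leaves \<open>X\<close>.\<close>
  then have "v \<in> X"
  proof induction
    case base show ?case by (rule uv(1))
  next
    case (step y z)
    then show ?case unfolding F_def by auto
  qed
  then show False using uv by simp
qed

definition vertex_code :: "'v set set \<Rightarrow> ('v set \<Rightarrow> nat set) \<Rightarrow> 'v \<Rightarrow> nat set" where
  "vertex_code E T v = \<Union>(T ` {e \<in> E. v \<in> e})"

text \<open>The interface between combinatorics and geometry: the tree is forgotten and the
  coordinates are numbers. \<open>missing_once\<close> says that the sets \<open>S v - T e\<close>,
  for the three edges at \<open>v\<close>, partition \<open>S v\<close>.\<close>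

locale coded_graph =
  fixes V :: "'v set" and E :: "'v set set" and n :: nat and T :: "'v set \<Rightarrow> nat set"
  assumes finite_V: "finite V"
    and edge_subset: "e \<in> E \<Longrightarrow> e \<subseteq> V"
    and card_edge: "e \<in> E \<Longrightarrow> card e = 2"
    and degree: "v \<in> V \<Longrightarrow> card {e \<in> E. v \<in> e} = 3"
    and T_subset: "e \<in> E \<Longrightarrow> T e \<subseteq> {..n}"
    and T_nonempty: "e \<in> E \<Longrightarrow> T e \<noteq> {}"
    and inj_T: "inj_on T E"
    and missing_once: "v \<in> V \<Longrightarrow> i \<in> vertex_code E T v \<Longrightarrow> \<exists>!e. e \<in> E \<and> v \<in> e \<and> i \<notin> T e"
    and inj_S: "inj_on (vertex_code E T) V"
    and S_eq_T: "v \<in> V \<Longrightarrow> e \<in> E \<Longrightarrow> vertex_code E T v = T e \<Longrightarrow> v \<in> e"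

lemma coded_graph_exists:
  assumes sg: "finite_simple_graph V E" and reg: "regular_graph 3 V E" and ec: "edge_connected 3 V E"
  shows "\<exists>T. coded_graph V E (genus V E - 1) T" "card V = 2 * genus V E - 2"
proof -
  interpret cubic_graph V E
  proof
    show "finite V" "\<And>e. e \<in> E \<Longrightarrow> e \<subseteq> V" "\<And>e. e \<in> E \<Longrightarrow> card e = 2"
      using sg unfolding finite_simple_graph_def by blast+
    show "\<And>v. v \<in> V \<Longrightarrow> card {e \<in> E. v \<in> e} = 3" using reg unfolding regular_graph_def by blast
  qed (rule card_cut_edge_connected[OF sg ec])
  have V1: "card V > 1" using ec unfolding edge_connected_def by blast
  then obtain r where r: "r \<in> V" by fastforce
  obtain c Ds par where "cubic_graph_tree V E r c Ds par" using tree_exists[OF r] by blast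
  then interpret cubic_graph_tree V E r c Ds par .
  have "3 * card V = 2 * card E" "card E = card nontree + (card V - 1)"
    by (rule sum_degrees card_nontree)+
  then have V: "card V = 2 * card nontree - 2" using V1 by linarith
  then show "card V = 2 * genus V E - 2" using genus_eq by simp
  \<comment> \<open>The \<open>g\<close> edges outside the tree number the coordinates
    \<open>0\<close> to \<open>g - 1\<close>. The truncated subtraction is harmless:
    \<open>card V > 1\<close> forces \<open>g\<close> to be positive.\<close>
  have g: "{0..<card nontree} = {..genus V E - 1}" using V V1 genus_eq by auto
  have "finite nontree" using finite_E unfolding nontree_def by simp
  then obtain h where h: "bij_betw h nontree {..genus V E - 1}"
    using ex_bij_betw_finite_nat unfolding g[symmetric] by blast
  have inj: "inj_on h nontree" using h by (rule bij_betw_imp_inj_on)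
  have injP: "inj_on ((`) h) (Pow nontree)" using inj by (rule inj_on_image_Pow)
  define T where "T e = h ` code e" for e
  have S: "vertex_code E T v = h ` vcode v" for v
    unfolding vertex_code_def vcode_def T_def by blast
  have sub: "code e \<in> Pow nontree" if "e \<in> E" for e using code_nontree_subset that by blast
  have subv: "vcode v \<in> Pow nontree" for v using vcode_nontree by blast
  have "coded_graph V E (genus V E - 1) T"
  proof
    show "\<And>e. e \<in> E \<Longrightarrow> T e \<noteq> {}" unfolding T_def using code_nonempty by simp
    show "T e \<subseteq> {..genus V E - 1}" if "e \<in> E" for e
      unfolding T_def using h code_nontree_subset[OF that] unfolding bij_betw_def by blast
    show "inj_on T E"
    proof (rule inj_onI)
      fix e f assume ef: "e \<in> E" "f \<in> E" "T e = T f"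
      then have "code e = code f" using inj_onD[OF injP _ sub sub] unfolding T_def by blast
      then show "e = f" using inj_code ef unfolding inj_on_def by blast
    qed
    show "inj_on (vertex_code E T) V"
    proof (rule inj_onI)
      fix v w assume vw: "v \<in> V" "w \<in> V" "vertex_code E T v = vertex_code E T w"
      then have "vcode v = vcode w" using inj_onD[OF injP _ subv subv] unfolding S by blast
      then show "v = w" using inj_vcode vw unfolding inj_on_def by blast
    qed
    show "v \<in> e" if "v \<in> V" "e \<in> E" "vertex_code E T v = T e" for v e
    proof -
      have "vcode v = code e" using inj_onD[OF injP _ subv sub[OF that(2)]] that(3) unfolding S T_def by blast
      then show ?thesis using vcode_eq_code that by blast
    qed
    show "\<exists>!e. e \<in> E \<and> v \<in> e \<and> i \<notin> T e" if v: "v \<in> V" and i: "i \<in> vertex_code E T v" for v i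
    proof -
      obtain j where j: "j \<in> vcode v" "i = h j" using i unfolding S by blast
      have "i \<in> T e \<longleftrightarrow> j \<in> code e" if "e \<in> E" for e
        unfolding T_def j(2) using j(1) vcode_nontree code_nontree_subset[OF that]
        by (intro inj_on_image_mem_iff[OF inj]) auto
      then have "(e \<in> E \<and> v \<in> e \<and> i \<notin> T e) = (e \<in> E \<and> v \<in> e \<and> j \<notin> code e)" for e by blast
      then show ?thesis using code_missing_once[OF v j(1)] by simp
    qed
  qed (fact finite_V edge_subset card_edge degree)+
  then show "\<exists>T. coded_graph V E (genus V E - 1) T" by blast
qed

section \<open>Tropical lines with three classes of coordinates\<close>

abbreviation "keys \<equiv> Poly_Mapping.keys"
abbreviation "lookup \<equiv> Poly_Mapping.lookup"

section \<open>Evaluation of Laurent polynomials at Laurent series\<close>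

lemma poly_mapping_add_induct [case_names single add]:
  assumes "\<And>a c. P (Poly_Mapping.single a c)" and "\<And>f g. P f \<Longrightarrow> P g \<Longrightarrow> P (f + g)"
  shows "P (f :: 'a \<Rightarrow>\<^sub>0 'b::comm_monoid_add)"
proof (induction f rule: Poly_Mapping.update_induct)
  case const
  show ?case using assms(1)[of undefined 0] by simp
next
  case (update f a b)
  have "Poly_Mapping.update a b f = f + Poly_Mapping.single a b"
    using update by (intro poly_mapping_eqI)
      (auto simp: Poly_Mapping.lookup_update Poly_Mapping.lookup_add Poly_Mapping.lookup_single
        in_keys_iff when_def)
  then show ?case using assms update by simp
qed

definition laurent_monom :: "(nat \<Rightarrow> 'k::field fls) \<Rightarrow> (nat \<Rightarrow>\<^sub>0 int) \<Rightarrow> 'k fls" where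
  "laurent_monom y a = (\<Prod>i\<in>keys a. y i powi lookup a i)"

definition laurent_eval :: "(nat \<Rightarrow> 'k::field fls) \<Rightarrow> 'k laurent \<Rightarrow> 'k fls" where
  "laurent_eval y F = (\<Sum>a\<in>keys F. fls_const (lookup F a) * laurent_monom y a)"

lemma laurent_monom_superset:
  assumes "finite A" "keys a \<subseteq> A"
  shows "laurent_monom y a = (\<Prod>i\<in>A. y i powi lookup a i)"
  unfolding laurent_monom_def using assms
  by (intro prod.mono_neutral_left) (auto simp: in_keys_iff)

lemma laurent_monom_add:
  assumes "\<And>i. y i \<noteq> 0"
  shows "laurent_monom y (a + b) = laurent_monom y a * laurent_monom y b"
proof -
  have "finite (keys a \<union> keys b)" "keys (a + b) \<subseteq> keys a \<union> keys b"
    by (simp_all add: Poly_Mapping.keys_add)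
  then show ?thesis
    using assms
    by (simp add: laurent_monom_superset[of "keys a \<union> keys b"] Poly_Mapping.lookup_add
        power_int_add prod.distrib)
qed

lemma laurent_eval_add: "laurent_eval y (F + G) = laurent_eval y F + laurent_eval y G"
  unfolding laurent_eval_def
  by (rule setsum_keys_plus_distrib) (simp_all add: distrib_right flip: fls_plus_const)

lemma laurent_eval_single:
  "laurent_eval y (Poly_Mapping.single a c) = fls_const c * laurent_monom y a"
  unfolding laurent_eval_def by simp

lemma laurent_eval_mult:
  assumes y: "\<And>i. y i \<noteq> 0"
  shows "laurent_eval y (F * G) = laurent_eval y F * laurent_eval y G"
proof (induction F rule: poly_mapping_add_induct)
  case (single a c)
  show ?case
  proof (induction G rule: poly_mapping_add_induct)
    case (single b d)
    show ?case
      by (simp add: laurent_eval_single mult_single laurent_monom_add[OF y] mult_ac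
          flip: fls_const_mult_const)
  qed (simp add: distrib_left laurent_eval_add)
qed (simp add: distrib_right laurent_eval_add)



lemma laurent_eval_zero: "laurent_eval y 0 = 0"
  unfolding laurent_eval_def by simp

lemma laurent_eval_uminus: "laurent_eval y (- F) = - laurent_eval y F"
  using laurent_eval_add[of y F "- F"] by (simp add: laurent_eval_zero eq_neg_iff_add_eq_0 add.commute)

lemma ring_poly_ring: "ring (poly_ring S :: ((nat \<Rightarrow>\<^sub>0 'm::comm_monoid_add) \<Rightarrow>\<^sub>0 'k::comm_ring_1) ring)"
  by (intro cring.axioms(1) cring_poly_ring)

text \<open>This lets vanishing at \<open>y\<close> pass from the generators of
  \<open>stratum_ideal\<close> to the whole ideal, by the minimality of a generated ideal.\<close>

lemma ideal_laurent_eval_kernel: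
  assumes y: "\<And>i. y i \<noteq> 0"
  shows "ideal {F \<in> carrier (poly_ring S). laurent_eval y F = 0} (poly_ring S)"
proof (rule idealI[OF ring_poly_ring])
  interpret R: ring "poly_ring S :: ((nat \<Rightarrow>\<^sub>0 int) \<Rightarrow>\<^sub>0 'a) ring" by (rule ring_poly_ring)
  have ops: "f \<oplus>\<^bsub>poly_ring S\<^esub> g = f + g" "f \<otimes>\<^bsub>poly_ring S\<^esub> g = f * g" "\<zero>\<^bsub>poly_ring S\<^esub> = 0"
    for f g :: "'a laurent" by (simp_all add: poly_ring_def)
  have minus: "\<ominus>\<^bsub>poly_ring S\<^esub> f = - f" if "f \<in> carrier (poly_ring S)" for f :: "'a laurent"
    using that by (intro R.minus_equality) (simp_all add: ops poly_ring_def)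
  show "subgroup {F \<in> carrier (poly_ring S). laurent_eval y F = 0} (add_monoid (poly_ring S))"
  proof (rule R.add.subgroupI)
    show "{F \<in> carrier (poly_ring S). laurent_eval y F = 0} \<noteq> {}"
      using R.zero_closed laurent_eval_zero by (auto simp: ops)
  next
    fix F G assume "F \<in> {F \<in> carrier (poly_ring S). laurent_eval y F = 0}"
      "G \<in> {F \<in> carrier (poly_ring S). laurent_eval y F = 0}"
    then show "F \<oplus>\<^bsub>poly_ring S\<^esub> G \<in> {F \<in> carrier (poly_ring S). laurent_eval y F = 0}"
      using R.add.m_closed[of F G] by (simp add: ops laurent_eval_add)
  next
    fix F assume F: "F \<in> {F \<in> carrier (poly_ring S). laurent_eval y F = 0}"
    then have "\<ominus>\<^bsub>poly_ring S\<^esub> F \<in> carrier (poly_ring S)" by simp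
    then show "\<ominus>\<^bsub>poly_ring S\<^esub> F \<in> {F \<in> carrier (poly_ring S). laurent_eval y F = 0}"
      using F minus[of F] by (simp add: laurent_eval_uminus)
  qed auto
next
  interpret R: ring "poly_ring S :: ((nat \<Rightarrow>\<^sub>0 int) \<Rightarrow>\<^sub>0 'a) ring" by (rule ring_poly_ring)
  have ops: "f \<otimes>\<^bsub>poly_ring S\<^esub> g = f * g"
    for f g :: "'a laurent" by (simp add: poly_ring_def)
  fix F G :: "'a laurent"
  assume "F \<in> {F \<in> carrier (poly_ring S). laurent_eval y F = 0}" "G \<in> carrier (poly_ring S)"
  then show "G \<otimes>\<^bsub>poly_ring S\<^esub> F \<in> {F \<in> carrier (poly_ring S). laurent_eval y F = 0}"
    "F \<otimes>\<^bsub>poly_ring S\<^esub> G \<in> {F \<in> carrier (poly_ring S). laurent_eval y F = 0}"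
    using R.m_closed[of F G] R.m_closed[of G F] laurent_eval_mult[OF y] by (auto simp: ops)
qed

subsection \<open>Valuations\<close>

locale valued_field =
  fixes val :: "'k::field \<Rightarrow> ereal"
  assumes val: "real_valuation val"
begin

lemma val_mult: "val (x * y) = val x + val y"
  and val_add: "min (val x) (val y) \<le> val (x + y)"
  and val_eq_infty: "val x = \<infinity> \<longleftrightarrow> x = 0"
  and val_ninfty: "val x \<noteq> - \<infinity>"
  using val unfolding real_valuation_def by auto

lemma val_0: "val 0 = \<infinity>" by (simp add: val_eq_infty)

lemma val_real: assumes "x \<noteq> 0" obtains r where "val x = ereal r"
  using val_eq_infty[of x] val_ninfty[of x] assms by (cases "val x") auto

lemma val_1: "val 1 = 0"
proof -
  obtain r where r: "val 1 = ereal r" by (rule val_real[of 1]) auto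
  have "val 1 = val 1 + val 1" using val_mult[of 1 1] by simp
  then show ?thesis using r by (simp add: zero_ereal_def)
qed

lemma val_minus_1: "val (- 1) = 0"
proof -
  obtain r where r: "val (- 1) = ereal r" by (rule val_real[of "- 1"]) auto
  have "val (- 1) + val (- 1) = 0" using val_mult[of "- 1" "- 1"] val_1 by simp
  then show ?thesis using r by (simp add: zero_ereal_def)
qed

lemma val_uminus: "val (- x) = val x"
  using val_mult[of "- 1" x] val_minus_1 by simp

lemma val_sum_ge: "finite A \<Longrightarrow> (\<And>x. x \<in> A \<Longrightarrow> r \<le> val (f x)) \<Longrightarrow> r \<le> val (sum f A)"
proof (induction A rule: finite_induct)
  case (insert x A)
  then show ?case using val_add[of "f x" "sum f A"] by (force simp: min_def split: if_splits)
qed (simp add: val_0)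

lemma val_sum_gr: "finite A \<Longrightarrow> r < \<infinity> \<Longrightarrow> (\<And>x. x \<in> A \<Longrightarrow> r < val (f x)) \<Longrightarrow> r < val (sum f A)"
proof (induction A rule: finite_induct)
  case (insert x A)
  then have "r < min (val (f x)) (val (sum f A))" by simp
  also have "\<dots> \<le> val (f x + sum f A)" by (rule val_add)
  finally show ?case using insert by simp
qed (simp add: val_0)

text \<open>Series of Gauss valuation 0 whose minimum is visible at the constant term. Constant
  terms \<open>1\<close> and \<open>- 1\<close> are enough, as only \<open>1\<close>,
  \<open>1 + fls_X\<close>, their negatives and the inverses of these are substituted.\<close>

definition val_unit :: "'k fls \<Rightarrow> bool" where
  "val_unit u \<longleftrightarrow> (\<exists>g. u = fps_to_fls g \<and> (\<forall>k. 0 \<le> val (fps_nth g k)) \<and> (fps_nth g 0 = 1 \<or> fps_nth g 0 = - 1))"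

lemma val_unit_mult: assumes "val_unit u" "val_unit w" shows "val_unit (u * w)"
proof -
  obtain g h where g: "u = fps_to_fls g" "\<forall>k. 0 \<le> val (fps_nth g k)" "fps_nth g 0 = 1 \<or> fps_nth g 0 = - 1"
    and h: "w = fps_to_fls h" "\<forall>k. 0 \<le> val (fps_nth h k)" "fps_nth h 0 = 1 \<or> fps_nth h 0 = - 1"
    using assms unfolding val_unit_def by metis
  have "0 \<le> val (fps_nth (g * h) k)" for k
    unfolding fps_mult_nth using g(2) h(2) by (intro val_sum_ge) (auto simp: val_mult)
  moreover have "fps_nth (g * h) 0 = 1 \<or> fps_nth (g * h) 0 = - 1" using g(3) h(3) by auto
  moreover have "u * w = fps_to_fls (g * h)" using g h by (simp add: fls_times_fps_to_fls)
  ultimately show ?thesis unfolding val_unit_def by blast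
qed

lemma val_unit_1: "val_unit 1"
  unfolding val_unit_def by (intro exI[of _ 1]) (simp add: val_1 val_0)

lemma val_unit_uminus: assumes "val_unit u" shows "val_unit (- u)"
proof -
  obtain g where g: "u = fps_to_fls g" "\<forall>k. 0 \<le> val (fps_nth g k)" "fps_nth g 0 = 1 \<or> fps_nth g 0 = - 1"
    using assms unfolding val_unit_def by metis
  then show ?thesis unfolding val_unit_def by (intro exI[of _ "- g"]) (auto simp: val_uminus)
qed

lemma val_unit_1_X: "val_unit (1 + fls_X)"
proof -
  have "0 \<le> val (fps_nth (1 + fps_X) k)" for k
    by (cases "k = 0"; cases "k = 1") (auto simp: val_1 val_0)
  moreover have "1 + fls_X = fps_to_fls (1 + fps_X :: 'k fps)" by simp
  ultimately show ?thesis unfolding val_unit_def by (intro exI[of _ "1 + fps_X"]) auto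
qed

lemma val_unit_inverse_1_X: "val_unit (inverse (1 + fls_X))"
proof -
  have v: "val ((- 1) ^ k) = 0" for k
    by (induction k) (simp_all add: val_1 val_mult val_minus_1 val_uminus)
  have "subdegree (1 + fps_X :: 'k fps) = 0" by (intro subdegree_eq_0) simp
  then have "inverse (1 + fls_X :: 'k fls) = fps_to_fls (Abs_fps (\<lambda>n. (- 1) ^ n))"
    using fls_inverse_fps_to_fls[of "1 + fps_X :: 'k fps"] fps_inverse_fps_X_plus1 by simp
  then show ?thesis unfolding val_unit_def using v by (intro exI[of _ "Abs_fps (\<lambda>n. (- 1) ^ n)"]) simp
qed

lemma val_unit_power_int:
  assumes "val_unit u" "val_unit (inverse u)" shows "val_unit (u powi m)"
proof -
  have "val_unit (w ^ k)" if "val_unit w" for w k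
    using that by (induction k) (auto intro: val_unit_1 val_unit_mult)
  then show ?thesis using assms unfolding power_int_def by simp
qed

lemma val_unit_prod: "(\<And>i. i \<in> A \<Longrightarrow> val_unit (f i)) \<Longrightarrow> val_unit (prod f A)"
  by (induction A rule: infinite_finite_induct) (auto intro: val_unit_1 val_unit_mult)

lemma val_unit_nth: "val_unit u \<Longrightarrow> 0 \<le> val (fls_nth u k)"
  unfolding val_unit_def by (auto simp: val_0)

lemma val_unit_nth_neg: "val_unit u \<Longrightarrow> k < 0 \<Longrightarrow> fls_nth u k = 0"
  unfolding val_unit_def by auto

lemma val_unit_nth_0: "val_unit u \<Longrightarrow> fls_nth u 0 = 1 \<or> fls_nth u 0 = - 1"
  unfolding val_unit_def by auto

text \<open>The Gauss valuation with \<open>val fls_X = t\<close> has \<open>val (y i) = w i\<close>, so a root \<open>y\<close> of \<open>F\<close> makes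
  two terms of \<open>F\<close> minimal. Comparing coefficients avoids that this valuation is multiplicative.\<close>
lemma trop_weight_minimum_twice:
  assumes F: "F \<noteq> 0" "laurent_eval y F = 0" and S: "finite S" "\<And>a. a \<in> keys F \<Longrightarrow> keys a \<subseteq> S"
    and y: "\<And>i. i \<in> S \<Longrightarrow> y i = fls_X powi (h i) * \<epsilon> i"
    and eps: "\<And>i. i \<in> S \<Longrightarrow> val_unit (\<epsilon> i) \<and> val_unit (inverse (\<epsilon> i))"
    and w: "\<And>i. i \<in> S \<Longrightarrow> w i = t * of_int (h i)" and t: "0 \<le> t"
  shows "\<exists>a\<in>keys F. \<exists>b\<in>keys F. a \<noteq> b \<and> trop_weight val S w F a = trop_weight val S w F b \<and>
           (\<forall>c\<in>keys F. trop_weight val S w F a \<le> trop_weight val S w F c)"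
proof (rule ccontr)
  assume no: "\<not> ?thesis"
  define deg where "deg a = (\<Sum>i\<in>S. h i * lookup a i)" for a
  define u where "u a = (\<Prod>i\<in>S. \<epsilon> i powi lookup a i)" for a
  have weight: "trop_weight val S w F a = val (lookup F a) + ereal (t * of_int (deg a))" for a
    unfolding trop_weight_def deg_def using w
    by (simp add: sum_distrib_left mult_ac cong: sum.cong)
  have unit: "val_unit (u a)" for a
    unfolding u_def using eps by (intro val_unit_prod val_unit_power_int) auto
  have monom: "laurent_monom y a = fls_X_intpow (deg a) * u a" if "a \<in> keys F" for a
  proof -
    have "laurent_monom y a = (\<Prod>i\<in>S. y i powi lookup a i)"
      using S that by (intro laurent_monom_superset) auto
    also have "\<dots> = (\<Prod>i\<in>S. fls_X powi (h i * lookup a i) * \<epsilon> i powi lookup a i)"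
      by (intro prod.cong refl) (simp only: y power_int_mult_distrib power_int_mult)
    also have "\<dots> = (\<Prod>i\<in>S. fls_X powi (h i * lookup a i)) * u a"
      unfolding u_def by (rule prod.distrib)
    also have "(\<Prod>i\<in>S. fls_X powi (h i * lookup a i)) = (fls_X powi deg a :: 'k fls)"
      unfolding deg_def using S(1)
      by (induction S rule: finite_induct) (simp_all add: power_int_add del: fls_X_power_int)
    finally show ?thesis by simp
  qed
  have "keys F \<noteq> {}" using F(1) by simp
  then obtain a0 where a0: "a0 \<in> keys F"
    "\<And>c. c \<in> keys F \<Longrightarrow> trop_weight val S w F a0 \<le> trop_weight val S w F c"
    using arg_min_if_finite(1)[OF finite_keys, of F "trop_weight val S w F"]
      arg_min_least[OF finite_keys, of F _ "trop_weight val S w F"] by blast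
  have strict: "trop_weight val S w F a0 < trop_weight val S w F c" if "c \<in> keys F" "c \<noteq> a0" for c
    using no a0 that by (metis order_le_less)
  have coeff: "fls_nth (fls_const (lookup F a) * laurent_monom y a) m
      = lookup F a * fls_nth (u a) (m - deg a)" if "a \<in> keys F" for a m
    unfolding monom[OF that] by (simp add: fls_X_intpow_times_conv_shift)
  have nz: "lookup F a \<noteq> 0" if "a \<in> keys F" for a using that by (simp add: in_keys_iff)
  obtain r0 where r0: "val (lookup F a0) = ereal r0" using nz[OF a0(1)] val_real by metis
  \<comment> \<open>The contribution of the term \<open>a\<close> to the coefficient at exponent
    \<open>deg a0\<close>. That of \<open>a0\<close> has valuation \<open>r0\<close>, as the
    constant term of \<open>u a0\<close> is \<open>1\<close> or \<open>- 1\<close>; the others will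
    turn out to have larger valuation, so they cannot cancel it.\<close>
  define c where "c a = lookup F a * fls_nth (u a) (deg a0 - deg a)" for a
  have "0 = fls_nth (laurent_eval y F) (deg a0)" using F by simp
  also have "\<dots> = (\<Sum>a\<in>keys F. c a)"
    unfolding laurent_eval_def c_def fls_nth_sum by (intro sum.cong refl coeff)
  also have "\<dots> = c a0 + (\<Sum>a\<in>keys F - {a0}. c a)" using a0 by (simp add: sum.remove)
  finally have eq: "(\<Sum>a\<in>keys F - {a0}. c a) = - c a0" by (simp add: eq_neg_iff_add_eq_0 add.commute)
  have "val (c a0) = val (lookup F a0)"
    using val_unit_nth_0[OF unit[of a0]] unfolding c_def by (auto simp: val_uminus)
  moreover have "ereal r0 < val (\<Sum>a\<in>keys F - {a0}. c a)"
  proof (rule val_sum_gr)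
    fix a assume a: "a \<in> keys F - {a0}"
    show "ereal r0 < val (c a)"
    \<comment> \<open>For \<open>deg a\<close> above \<open>deg a0\<close> there is no contribution,
      as \<open>u a\<close> is a power series. Otherwise strict minimality at \<open>a0\<close> and
      \<open>0 \<le> t\<close> give \<open>r0 < r\<close>.\<close>
    proof (cases "deg a \<le> deg a0")
      case True
      obtain r where r: "val (lookup F a) = ereal r" using nz a val_real by (metis DiffD1)
      have "r0 + t * of_int (deg a0) < r + t * of_int (deg a)"
        using strict[of a] a r r0 unfolding weight by simp
      moreover have "t * of_int (deg a) \<le> t * of_int (deg a0)" using True t by (intro mult_left_mono) auto
      ultimately have "ereal r0 < val (lookup F a)" using r by simp
      also have "\<dots> \<le> val (c a)"
        unfolding c_def val_mult using val_unit_nth[OF unit, of a "deg a0 - deg a"]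
        by (simp add: add_increasing2)
      finally show ?thesis .
    next
      case False
      then have "c a = 0" unfolding c_def using val_unit_nth_neg[OF unit] by simp
      then show ?thesis by (simp add: val_0)
    qed
  qed auto
  ultimately show False using eq r0 val_uminus by simp
qed

end

section \<open>The line attached to three classes of coordinates\<close>

lemma infinite_alg_closed_field: "infinite (UNIV :: 'k::alg_closed_field set)"
proof
  assume fin: "finite (UNIV :: 'k set)"
  define p :: "'k poly" where "p = (\<Prod>a\<in>UNIV. [:- a, 1:])"
  have deg: "degree p = card (UNIV :: 'k set)"
    unfolding p_def by (subst degree_prod_sum_eq) auto
  have "0 < card (UNIV :: 'k set)" using fin by (simp add: card_gt_0_iff)
  \<comment> \<open>\<open>p\<close> vanishes at every element of the field, so \<open>p + 1\<close>
    would be a nonconstant polynomial without roots.\<close>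
  then have "0 < degree (p + 1)" using deg by (simp add: degree_add_eq_left)
  then obtain x where "poly (p + 1) x = 0" using alg_closed_imp_poly_has_root by blast
  moreover have "poly p x = 0" unfolding p_def poly_prod using fin by (intro prod_zero) auto
  ultimately show False by simp
qed

lemma poly_eq_0_alg_closed: "(\<And>x. poly p x = 0) \<Longrightarrow> p = (0 :: 'k::alg_closed_field poly)"
  using poly_roots_finite[of p] infinite_alg_closed_field by auto

text \<open>The line consists of the points \<open>class_point P z\<close> with \<open>z 0 + z 1 + z 2 = 0\<close>.\<close>
definition class_point :: "(nat \<Rightarrow> nat set) \<Rightarrow> (nat \<Rightarrow> 'b) \<Rightarrow> nat \<Rightarrow> 'b::zero" where
  "class_point P z i = (if i \<in> P 0 then z 0 else if i \<in> P 1 then z 1 else if i \<in> P 2 then z 2 else 0)"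

text \<open>The vectors \<open>(1, 0, -1)\<close> and \<open>(0, 1, -1)\<close> form a basis of the
  plane of all \<open>z\<close> with coordinate sum zero.\<close>

definition class_ideal :: "nat \<Rightarrow> (nat \<Rightarrow> nat set) \<Rightarrow> 'k::field mpoly set" where
  "class_ideal n P = line_ideal n (class_point P (\<lambda>k. if k = 0 then 1 else if k = 1 then 0 else - 1))
     (class_point P (\<lambda>k. if k = 0 then 0 else if k = 1 then 1 else - 1))"

lemma class_ideal_iff:
  "f \<in> class_ideal n P \<longleftrightarrow> f \<in> carrier (poly_ring {..n}) \<and>
     (\<forall>z. z 0 + z 1 + z 2 = 0 \<longrightarrow> (z 0 \<noteq> 0 \<or> z 1 \<noteq> 0) \<longrightarrow> mpoly_eval f (class_point P z) = 0)"
proof -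
  let ?u = "class_point P (\<lambda>k. if k = 0 then 1 else if k = 1 then 0 else - 1) :: nat \<Rightarrow> 'a"
  let ?v = "class_point P (\<lambda>k. if k = 0 then 0 else if k = 1 then 1 else - 1) :: nat \<Rightarrow> 'a"
  have z: "class_point P z = (\<lambda>i. z 0 * ?u i + z 1 * ?v i)" if "z 0 + z 1 + z 2 = 0" for z :: "nat \<Rightarrow> 'a"
  proof
    fix i
    have "z 2 = - (z 0 + z 1)" using that by (metis add.commute eq_neg_iff_add_eq_0)
    then show "class_point P z i = z 0 * ?u i + z 1 * ?v i" unfolding class_point_def by simp
  qed
  show ?thesis
  proof (intro iffI conjI allI impI; (elim conjE)?)
    fix z :: "nat \<Rightarrow> 'a"
    assume f: "f \<in> class_ideal n P" and "z 0 + z 1 + z 2 = 0" "z 0 \<noteq> 0 \<or> z 1 \<noteq> 0"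
    then show "mpoly_eval f (class_point P z) = 0"
      unfolding z[OF \<open>z 0 + z 1 + z 2 = 0\<close>] class_ideal_def line_ideal_def by blast
  next
    assume "f \<in> class_ideal n P"
    then show "f \<in> carrier (poly_ring {..n})" unfolding class_ideal_def line_ideal_def by simp
  next
    assume f: "f \<in> carrier (poly_ring {..n})"
      and 0: "\<forall>z. z 0 + z 1 + z 2 = 0 \<longrightarrow> (z 0 \<noteq> 0 \<or> z 1 \<noteq> 0) \<longrightarrow> mpoly_eval f (class_point P z) = 0"
    have "mpoly_eval f (\<lambda>i. s * ?u i + t * ?v i) = 0" if "(s, t) \<noteq> (0, 0)" for s t
    proof -
      let ?z = "\<lambda>k::nat. if k = 0 then s else if k = 1 then t else - (s + t)"
      have "mpoly_eval f (class_point P ?z) = 0" using 0[rule_format, of ?z] that by auto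
      then show ?thesis using z[of ?z] by simp
    qed
    then show "f \<in> class_ideal n P" unfolding class_ideal_def line_ideal_def using f by blast
  qed
qed

text \<open>The conditions \<open>ne\<close> allow at most one empty class, and two nonempty classes
  already determine \<open>s\<close> and \<open>t\<close>. An empty class is the case
  \<open>S v = T e\<close>.\<close>

lemma class_ideal_tropical_line:
  assumes P: "P 0 \<union> P 1 \<union> P 2 \<subseteq> {..n}" "P 0 \<inter> P 1 = {}" "P 0 \<inter> P 2 = {}" "P 1 \<inter> P 2 = {}"
    and ne: "P 1 \<union> P 2 \<noteq> {}" "P 0 \<union> P 2 \<noteq> {}" "P 0 \<union> P 1 \<noteq> {}"
  shows "tropproj val n (class_ideal n P) \<in> tropical_lines val n"
proof -
  let ?u = "class_point P (\<lambda>k. if k = 0 then 1 else if k = 1 then 0 else - 1) :: nat \<Rightarrow> 'a"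
  let ?v = "class_point P (\<lambda>k. if k = 0 then 0 else if k = 1 then 1 else - 1) :: nat \<Rightarrow> 'a"
  have "s = 0 \<and> t = 0" if st: "\<forall>i\<le>n. s * ?u i + t * ?v i = 0" for s t
  proof -
    have 0: "s = 0" if "i \<in> P 0" for i using st[rule_format, of i] P that unfolding class_point_def by auto
    have 1: "t = 0" if i: "i \<in> P 1" for i
    proof -
      have "i \<le> n" "i \<notin> P 0" using i P by auto
      then show ?thesis using st[rule_format, of i] i unfolding class_point_def by simp
    qed
    have 2: "s + t = 0" if i: "i \<in> P 2" for i
    proof -
      have "i \<le> n" "i \<notin> P 0" "i \<notin> P 1" using i P by auto
      then have "- s - t = 0" using st[rule_format, of i] i unfolding class_point_def by simp
      then show ?thesis by (metis add.inverse_inverse add_eq_0_iff diff_eq_diff_eq diff_zero eq_iff_diff_eq_0 uminus_add_conv_diff)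
    qed
    show ?thesis using 0 1 2 ne by (metis UnE add.left_neutral add.right_neutral all_not_in_conv)
  qed
  then show ?thesis unfolding tropical_lines_def class_ideal_def by blast
qed

subsection \<open>Points of the tropicalisation\<close>

lemma set_zero_sum:
  "set_zero U f = (\<Sum>a\<in>keys f. if keys a \<inter> U = {} then Poly_Mapping.single (Poly_Mapping.map int a) (lookup f a) else 0)"
  unfolding set_zero_def by (rule sum.inter_filter[OF finite_keys])

lemma laurent_eval_sum: "laurent_eval y (sum F A) = (\<Sum>x\<in>A. laurent_eval y (F x))"
  by (induction A rule: infinite_finite_induct) (simp_all add: laurent_eval_zero laurent_eval_add)

lemma lookup_map_int: "lookup (Poly_Mapping.map int a) i = int (lookup a i)"
  by (simp add: Poly_Mapping.map.rep_eq when_def)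

lemma keys_map_int: "keys (Poly_Mapping.map int a) = keys a"
  by (auto simp: in_keys_iff lookup_map_int)

lemma set_zero_carrier:
  assumes "f \<in> carrier (poly_ring {..n})" shows "set_zero U f \<in> carrier (poly_ring ({..n} - U))"
proof -
  have "keys (set_zero U f) \<subseteq> (\<Union>a\<in>{a \<in> keys f. keys a \<inter> U = {}}. {Poly_Mapping.map int a})"
    unfolding set_zero_def by (rule order_trans[OF keys_sum]) auto
  then show ?thesis using assms unfolding poly_ring_def by (force simp: keys_map_int)
qed

text \<open>The entry that is constantly \<open>1\<close> keeps the path away from the zero vector,
  which represents no point of the line. The composite polynomial then vanishes at all elements of
  an infinite field.\<close>

lemma mpoly_poly_path:
  fixes q :: "nat \<Rightarrow> 'k::alg_closed_field poly"
  assumes f: "f \<in> class_ideal n P"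
    and q: "q 0 + q 1 + q 2 = 0" "q 0 = 1 \<or> q 1 = 1 \<or> q 2 = 1"
  shows "(\<Sum>a\<in>keys f. [:lookup f a:] * (\<Prod>i\<in>keys a. class_point P q i ^ lookup a i)) = 0" (is "?p = 0")
proof (rule poly_eq_0_alg_closed)
  fix s
  have cp: "poly (class_point P q i) s = class_point P (\<lambda>k. poly (q k) s) i" for i
    unfolding class_point_def by simp
  have sum: "poly (q 0) s + poly (q 1) s + poly (q 2) s = 0" using q(1) by (metis poly_0 poly_add)
  have "poly (q 0) s = 1 \<or> poly (q 1) s = 1 \<or> poly (q 2) s = 1" using q(2) by auto
  then have "poly (q 0) s \<noteq> 0 \<or> poly (q 1) s \<noteq> 0" using sum by auto
  then have "mpoly_eval f (class_point P (\<lambda>k. poly (q k) s)) = 0"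
    using f sum unfolding class_ideal_iff by (elim conjE allE[of _ "\<lambda>k. poly (q k) s"]) simp
  then show "poly ?p s = 0"
    unfolding mpoly_eval_def by (simp add: poly_sum poly_prod cp)
qed

text \<open>A polynomial path on the line, read in the Laurent series field, is a root of everything
  in the ideal of the stratum where its coordinates are nonzero. The exponents \<open>h i\<close>,
  scaled by \<open>t\<close>, are its valuations.\<close>

lemma class_path_in_trop:
  fixes q :: "nat \<Rightarrow> 'k::alg_closed_field poly"
  assumes val: "valued_field (val :: 'k \<Rightarrow> ereal)"
    and q: "q 0 + q 1 + q 2 = 0" "q 0 = 1 \<or> q 1 = 1 \<or> q 2 = 1"
    and U: "\<And>i. i \<le> n \<Longrightarrow> i \<in> U \<longleftrightarrow> class_point P q i = 0" "U \<subseteq> {..n}"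
    and h: "\<And>i. i \<in> {..n} - U \<Longrightarrow> fps_to_fls (fps_of_poly (class_point P q i)) = fls_X powi (h i) * \<epsilon> i"
    and eps: "\<And>i. i \<in> {..n} - U \<Longrightarrow> valued_field.val_unit val (\<epsilon> i) \<and> valued_field.val_unit val (inverse (\<epsilon> i))"
    and w: "w \<in> ({..n} - U) \<rightarrow>\<^sub>E UNIV" "\<And>i. i \<in> {..n} - U \<Longrightarrow> w i = t * of_int (h i)" and t: "0 \<le> t"
  shows "w \<in> trop val ({..n} - U) (stratum_ideal n U (class_ideal n P))"
proof -
  interpret valued_field val by (rule val)
  define hom where "hom p = fps_to_fls (fps_of_poly p)" for p :: "'k poly"
  have hom_mult: "hom (p * r) = hom p * hom r" for p r
    unfolding hom_def by (simp add: fps_of_poly_mult fls_times_fps_to_fls)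
  have hom_0: "hom 0 = 0" and hom_1: "hom 1 = 1" unfolding hom_def by simp_all
  have hom_add: "hom (p + r) = hom p + hom r" for p r unfolding hom_def by (simp add: fps_of_poly_add)
  have hom_sum: "hom (sum g A) = (\<Sum>x\<in>A. hom (g x))" for g :: "(nat \<Rightarrow>\<^sub>0 nat) \<Rightarrow> 'k poly" and A
    by (induction A rule: infinite_finite_induct) (simp_all add: hom_0 hom_add)
  have hom_power: "hom (p ^ m) = hom p ^ m" for p m by (induction m) (simp_all add: hom_1 hom_mult)
  have hom_prod: "hom (prod g A) = (\<Prod>x\<in>A. hom (g x))" for g :: "nat \<Rightarrow> 'k poly" and A
    by (induction A rule: infinite_finite_induct) (simp_all add: hom_1 hom_mult)
  have hom_const: "hom [:c:] = fls_const c" for c unfolding hom_def by (simp add: fps_of_poly_const)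
  have hom_smult: "hom (smult c p) = fls_const c * hom p" for c p
    using hom_mult[of "[:c:]" p] hom_const by simp
  have hom_eq_0: "hom p = 0 \<longleftrightarrow> p = 0" for p unfolding hom_def by simp
  \<comment> \<open>The value \<open>1\<close> off the stratum keeps every \<open>y i\<close>
    invertible, as multiplicativity of evaluation demands; these variables do not occur in the ring
    of the stratum.\<close>
  define y where "y i = (if i \<in> {..n} - U then hom (class_point P q i) else 1)" for i
  have y0: "y i \<noteq> 0" for i using U(1)[of i] unfolding y_def by (auto simp: hom_eq_0)
  have root: "laurent_eval y (set_zero U f) = 0" if f: "f \<in> class_ideal n P" for f
  proof -
    have fc: "keys a \<subseteq> {..n}" if "a \<in> keys f" for a
      using f that unfolding class_ideal_iff poly_ring_def by auto
    have "laurent_eval y (set_zero U f)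
        = (\<Sum>a\<in>keys f. hom ([:lookup f a:] * (\<Prod>i\<in>keys a. class_point P q i ^ lookup a i)))"
      unfolding set_zero_sum laurent_eval_sum
    proof (rule sum.cong[OF refl])
      fix a assume a: "a \<in> keys f"
      show "laurent_eval y (if keys a \<inter> U = {} then Poly_Mapping.single (Poly_Mapping.map int a) (lookup f a) else 0)
        = hom ([:lookup f a:] * (\<Prod>i\<in>keys a. class_point P q i ^ lookup a i))"
      proof (cases "keys a \<inter> U = {}")
        case True
        then have "y i = hom (class_point P q i)" if "i \<in> keys a" for i
          using fc[OF a] that unfolding y_def by auto
        then show ?thesis using True
          by (simp add: laurent_eval_single laurent_monom_def keys_map_int lookup_map_int hom_mult
              hom_smult hom_prod hom_power)
      next
        case False
        then obtain i where i: "i \<in> keys a" "i \<in> U" by blast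
        then have "class_point P q i ^ lookup a i = 0"
          using U by (auto simp: in_keys_iff)
        then have "(\<Prod>i\<in>keys a. class_point P q i ^ lookup a i) = 0"
          using i(1) by (intro prod_zero) auto
        then show ?thesis using False by (simp only: if_False laurent_eval_zero hom_0 mult_zero_right)
      qed
    qed
    also have "\<dots> = hom (\<Sum>a\<in>keys f. [:lookup f a:] * (\<Prod>i\<in>keys a. class_point P q i ^ lookup a i))"
      by (simp only: hom_sum)
    also have "\<dots> = 0" unfolding mpoly_poly_path[OF f q] by (rule hom_0)
    finally show ?thesis .
  qed
  interpret R: ring "poly_ring ({..n} - U) :: ((nat \<Rightarrow>\<^sub>0 int) \<Rightarrow>\<^sub>0 'k) ring" by (rule ring_poly_ring)
  let ?K = "{F \<in> carrier (poly_ring ({..n} - U)). laurent_eval y F = 0}"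
  have "stratum_ideal n U (class_ideal n P) \<subseteq> ?K"
    unfolding stratum_ideal_def
  proof (rule R.genideal_minimal)
    show "ideal ?K (poly_ring ({..n} - U))" by (rule ideal_laurent_eval_kernel[OF y0])
    show "set_zero U ` class_ideal n P \<subseteq> ?K"
      using root set_zero_carrier by (auto simp: class_ideal_iff)
  qed
  then have K: "F \<in> carrier (poly_ring ({..n} - U))" "laurent_eval y F = 0"
    if "F \<in> stratum_ideal n U (class_ideal n P)" for F using that by auto
  show ?thesis unfolding trop_def
  proof (intro CollectI conjI ballI impI w(1))
    fix F :: "'k laurent" assume F: "F \<in> stratum_ideal n U (class_ideal n P)" "F \<noteq> 0"
    show "\<exists>a\<in>keys F. \<exists>b\<in>keys F. a \<noteq> b \<and>
           trop_weight val ({..n} - U) w F a = trop_weight val ({..n} - U) w F b \<and>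
           (\<forall>c\<in>keys F. trop_weight val ({..n} - U) w F a \<le> trop_weight val ({..n} - U) w F c)"
    proof (rule trop_weight_minimum_twice[OF F(2) K(2)[OF F(1)] _ _ _ eps w(2) t])
      show "keys a \<subseteq> {..n} - U" if "a \<in> keys F" for a
        using K(1)[OF F(1)] that unfolding poly_ring_def by auto
      show "y i = fls_X powi h i * \<epsilon> i" if "i \<in> {..n} - U" for i
        using h[OF that] that unfolding y_def hom_def by simp
    qed auto
  qed
qed

subsection \<open>Linear forms in the ideal of a line\<close>

text \<open>The exponent type is left open so that the same form can be used before
  \<open>set_zero\<close>, with natural exponents, and after it, with integral ones.\<close>

definition lin_form :: "(nat \<Rightarrow> 'k) \<Rightarrow> nat set \<Rightarrow> (nat \<Rightarrow>\<^sub>0 'm::{zero,one}) \<Rightarrow>\<^sub>0 'k::comm_ring_1" where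
  "lin_form c A = (\<Sum>i\<in>A. Poly_Mapping.single (Poly_Mapping.single i 1) (c i))"

lemma single_1_eq_iff:
  "Poly_Mapping.single i (1 :: 'm::zero_neq_one) = Poly_Mapping.single j 1 \<longleftrightarrow> i = j"
  by (metis lookup_single_eq lookup_single_not_eq zero_neq_one)

lemma lookup_lin_form:
  assumes "finite A"
  shows "lookup (lin_form c A) (Poly_Mapping.single i (1 :: 'm::zero_neq_one)) = (if i \<in> A then c i else 0)"
  unfolding lin_form_def Poly_Mapping.lookup_sum
  using assms by (simp add: lookup_single when_def single_1_eq_iff)

lemma keys_lin_form:
  assumes "finite A" "\<And>i. i \<in> A \<Longrightarrow> c i \<noteq> 0"
  shows "keys (lin_form c A) = (\<lambda>i. Poly_Mapping.single i (1 :: 'm::zero_neq_one)) ` A"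
proof (rule subset_antisym)
  show "keys (lin_form c A :: (nat \<Rightarrow>\<^sub>0 'm) \<Rightarrow>\<^sub>0 'a) \<subseteq> (\<lambda>i. Poly_Mapping.single i 1) ` A"
    unfolding lin_form_def by (rule order_trans[OF keys_sum]) (auto split: if_splits)
  show "(\<lambda>i. Poly_Mapping.single i 1) ` A \<subseteq> keys (lin_form c A :: (nat \<Rightarrow>\<^sub>0 'm) \<Rightarrow>\<^sub>0 'a)"
    using assms by (auto simp: in_keys_iff lookup_lin_form)
qed

lemma set_zero_add: "set_zero U (f + g) = set_zero U f + set_zero U g"
  unfolding set_zero_sum
  by (rule setsum_keys_plus_distrib) (simp_all add: single_add)

lemma set_zero_0: "set_zero U 0 = 0"
  unfolding set_zero_def by simp

lemma set_zero_lin_form: assumes "finite A" shows "set_zero U (lin_form c A) = lin_form c (A - U)"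
proof -
  have single: "set_zero U (Poly_Mapping.single (Poly_Mapping.single i 1) d)
      = (if i \<in> U then 0 else Poly_Mapping.single (Poly_Mapping.single i 1) d)" for i d
    unfolding set_zero_sum by simp
  have "set_zero U (lin_form c A) = (\<Sum>i\<in>A. if i \<in> U then 0 else Poly_Mapping.single (Poly_Mapping.single i 1) (c i))"
    unfolding lin_form_def using assms
    by (induction A rule: finite_induct) (simp_all add: set_zero_0 set_zero_add single del: One_nat_def)
  also have "\<dots> = (\<Sum>i\<in>A - U. Poly_Mapping.single (Poly_Mapping.single i 1) (c i))"
    using assms by (intro sum.mono_neutral_cong_right) auto
  finally show ?thesis unfolding lin_form_def .
qed

lemma mpoly_eval_add: "mpoly_eval (f + g) x = mpoly_eval f x + mpoly_eval g x"
  unfolding mpoly_eval_def by (rule setsum_keys_plus_distrib) (simp_all add: distrib_right)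

lemma mpoly_eval_lin_form:
  assumes "finite A" shows "mpoly_eval (lin_form c A) x = (\<Sum>i\<in>A. c i * x i)"
proof -
  have single: "mpoly_eval (Poly_Mapping.single (Poly_Mapping.single i 1) d) x = d * x i" for i d
    unfolding mpoly_eval_def by simp
  have zero: "mpoly_eval 0 x = 0" unfolding mpoly_eval_def by simp
  show ?thesis
    unfolding lin_form_def using assms
    by (induction A rule: finite_induct) (simp_all add: mpoly_eval_add single zero del: One_nat_def)
qed

context valued_field begin

text \<open>The coefficients have valuation 0, so the weights of the terms are the coordinates of
  \<open>w\<close> themselves.\<close>

lemma trop_lin_form:
  assumes w: "w \<in> trop val ({..n} - U) (stratum_ideal n U (class_ideal n P))"
    and A: "A \<subseteq> {..n}" and c: "\<And>i. c i = 1 \<or> c i = - 1"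
    and vanish: "\<And>z. z 0 + z 1 + z 2 = (0 :: 'k) \<Longrightarrow> (\<Sum>i\<in>A. c i * class_point P z i) = 0"
    and ne: "A - U \<noteq> {}"
  shows "\<exists>i\<in>A - U. \<exists>j\<in>A - U. i \<noteq> j \<and> w i = w j \<and> (\<forall>k\<in>A - U. w i \<le> w k)"
proof -
  have finA: "finite A" using A finite_subset by blast
  have cnz: "c i \<noteq> 0" for i using c[of i] by auto
  have vc: "val (c i) = 0" for i using c[of i] val_1 val_minus_1 by auto
  have "keys (lin_form c A :: 'k mpoly) = (\<lambda>i. Poly_Mapping.single i 1) ` A"
    by (rule keys_lin_form[OF finA cnz])
  then have "lin_form c A \<in> class_ideal n P"
    unfolding class_ideal_iff mpoly_eval_lin_form[OF finA]
    using vanish A by (auto simp: poly_ring_def)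
  then have J: "lin_form c (A - U) \<in> stratum_ideal n U (class_ideal n P)"
    unfolding stratum_ideal_def genideal_def using set_zero_lin_form[OF finA, of U c] by force
  define F where "F = (lin_form c (A - U) :: 'k laurent)"
  have fin: "finite (A - U)" using finA by simp
  have keys: "keys F = (\<lambda>i. Poly_Mapping.single i 1) ` (A - U)"
    unfolding F_def by (rule keys_lin_form[OF fin cnz])
  then have "F \<noteq> 0" using ne by auto
  have weight: "trop_weight val ({..n} - U) w F (Poly_Mapping.single i 1) = ereal (w i)" if "i \<in> A - U" for i
  proof -
    have "(\<Sum>k\<in>{..n} - U. w k * of_int (lookup (Poly_Mapping.single i 1) k)) = (\<Sum>k\<in>{..n} - U. if k = i then w k else 0)"
      by (intro sum.cong refl) (auto simp: lookup_single when_def)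
    also have "\<dots> = w i" using that A by auto
    finally show ?thesis unfolding trop_weight_def F_def using that
      by (simp add: lookup_lin_form[OF fin] vc)
  qed
  have "\<exists>a\<in>keys F. \<exists>b\<in>keys F. a \<noteq> b \<and>
      trop_weight val ({..n} - U) w F a = trop_weight val ({..n} - U) w F b \<and>
      (\<forall>c\<in>keys F. trop_weight val ({..n} - U) w F a \<le> trop_weight val ({..n} - U) w F c)"
    using w J \<open>F \<noteq> 0\<close> unfolding trop_def F_def by blast
  then obtain i j where ij: "i \<in> A - U" "j \<in> A - U" "Poly_Mapping.single i (1::int) \<noteq> Poly_Mapping.single j 1"
      "trop_weight val ({..n} - U) w F (Poly_Mapping.single i 1) = trop_weight val ({..n} - U) w F (Poly_Mapping.single j 1)"
      "\<forall>k\<in>A - U. trop_weight val ({..n} - U) w F (Poly_Mapping.single i 1) \<le> trop_weight val ({..n} - U) w F (Poly_Mapping.single k 1)"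
    unfolding keys by auto
  then have "i \<noteq> j" by blast
  moreover have "w i = w j" using ij(4) weight ij(1,2) by simp
  moreover have "\<forall>k\<in>A - U. w i \<le> w k" using ij(5) weight ij(1) by simp
  ultimately show ?thesis using ij by blast
qed

end

subsection \<open>The tropical line\<close>

text \<open>The centre of the star is at \<open>t = 0\<close>. Later \<open>Q\<close> is
  \<open>S v - T e\<close>, so that \<open>T e\<close> is the set on which the coordinates stay 0
  along the arm.\<close>

definition arm_coords :: "nat \<Rightarrow> nat set \<Rightarrow> nat set \<Rightarrow> ereal \<Rightarrow> nat \<Rightarrow> ereal" where
  "arm_coords n S Q t = (\<lambda>i\<in>{..n}. if i \<notin> S then \<infinity> else if i \<in> Q then t else 0)"

definition arm :: "nat \<Rightarrow> nat set \<Rightarrow> nat set \<Rightarrow> (nat \<Rightarrow> ereal) set set" where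
  "arm n S Q = {TP_rel n `` {arm_coords n S Q t} | t. 0 \<le> t}"

lemma topspace_TP_coords:
  "q \<in> topspace (TP_coords n) \<longleftrightarrow> q \<in> {..n} \<rightarrow>\<^sub>E {-\<infinity><..} \<and> (\<exists>i\<le>n. q i \<noteq> \<infinity>)"
  unfolding TP_coords_def by (auto simp: PiE_def)

lemma TP_class_eqI:
  assumes "p \<in> topspace (TP_coords n)" "q \<in> topspace (TP_coords n)" "\<And>i. i \<le> n \<Longrightarrow> q i = ereal c + p i"
  shows "TP_rel n `` {p} = TP_rel n `` {q}"
  by (rule equiv_class_eq[OF equiv_TP_rel]) (use assms in \<open>auto simp: TP_rel_def\<close>)

lemma arm_coords_topspace:
  assumes "S \<subseteq> {..n}" "S - Q \<noteq> {}" "0 \<le> t"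
  shows "arm_coords n S Q t \<in> topspace (TP_coords n)"
proof -
  obtain i where "i \<in> S" "i \<notin> Q" using assms by auto
  then have "i \<le> n" "arm_coords n S Q t i \<noteq> \<infinity>" using assms unfolding arm_coords_def by auto
  moreover have "- \<infinity> < t" using assms(3) by (metis ereal_infty_less(2) less_le_trans zero_ereal_def less_ereal.simps(5) order_le_less)
  ultimately have "arm_coords n S Q t \<in> {..n} \<rightarrow>\<^sub>E {-\<infinity><..}" unfolding arm_coords_def by auto
  then show ?thesis unfolding topspace_TP_coords
    using \<open>i \<le> n\<close> \<open>arm_coords n S Q t i \<noteq> \<infinity>\<close> by blast
qed




text \<open>Three kinds of linear forms in the ideal suffice: a variable outside \<open>S\<close>,
  the difference of two variables of one class, and the sum of one variable from each class. They
  force infinity outside \<open>S\<close>, equality within classes, and a minimum of the three class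
  values that is attained twice; the remaining class names the arm.\<close>

lemma trop_line_subset:
  fixes val :: "'k::alg_closed_field \<Rightarrow> ereal"
  assumes "valued_field val"
    and P: "P 0 \<union> P 1 \<union> P 2 \<subseteq> {..n}" "P 0 \<inter> P 1 = {}" "P 0 \<inter> P 2 = {}" "P 1 \<inter> P 2 = {}"
    and ne: "P 1 \<union> P 2 \<noteq> {}" "P 0 \<union> P 2 \<noteq> {}" "P 0 \<union> P 1 \<noteq> {}"
    and S: "S = P 0 \<union> P 1 \<union> P 2"
    and U: "U \<subset> {..n}" and w: "w \<in> trop val ({..n} - U) (stratum_ideal n U (class_ideal n P))"
  shows "\<exists>k\<in>{0, 1, 2}. TP_point n U w \<in> arm n S (P k)"
proof -
  interpret valued_field val by fact
  have sub: "P k \<subseteq> {..n}" if "k \<in> {0, 1, 2}" for k using P that by auto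
  \<comment> \<open>The extended coordinates, infinite on \<open>U\<close>, allow all strata to be
    treated alike.\<close>
  define W where "W i = (if i \<in> U then \<infinity> else ereal (w i))" for i
  have off: "i \<in> U" if i: "i \<le> n" "i \<notin> S" for i
  proof (rule ccontr)
    assume "i \<notin> U"
    have "\<exists>a\<in>{i} - U. \<exists>b\<in>{i} - U. a \<noteq> b \<and> w a = w b \<and> (\<forall>k\<in>{i} - U. w a \<le> w k)"
      by (rule trop_lin_form[OF w, where c = "\<lambda>_. 1"]) (use i S \<open>i \<notin> U\<close> in \<open>auto simp: class_point_def\<close>)
    then show False by auto
  qed
  have same: "W i = W j" if k: "k \<in> {0, 1, 2}" and ij: "i \<in> P k" "j \<in> P k" for i j k
  proof (cases "i = j \<or> {i, j} - U = {}")
    case True then show ?thesis unfolding W_def by auto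
  next
    case False
    have cp: "class_point P z i = class_point P z j" for z :: "nat \<Rightarrow> 'k"
      using k ij P unfolding class_point_def by auto
    have "\<exists>a\<in>{i, j} - U. \<exists>b\<in>{i, j} - U. a \<noteq> b \<and> w a = w b \<and> (\<forall>k\<in>{i, j} - U. w a \<le> w k)"
      by (rule trop_lin_form[OF w, where c = "\<lambda>l. if l = i then 1 else - 1"])
        (use sub[OF k] ij False cp in auto)
    then show ?thesis unfolding W_def by auto
  qed
  have three: "(W i = W j \<and> W i \<le> W l) \<or> (W i = W l \<and> W i \<le> W j) \<or> (W j = W l \<and> W j \<le> W i)"
    if ijl: "i \<in> P 0" "j \<in> P 1" "l \<in> P 2" for i j l
  proof (cases "{i, j, l} - U = {}")
    case True then show ?thesis unfolding W_def by auto
  next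
    case False
    have d: "i \<noteq> j" "i \<noteq> l" "j \<noteq> l" using ijl P by auto
    have cp: "class_point P z i = z 0" "class_point P z j = z 1" "class_point P z l = z 2" for z :: "nat \<Rightarrow> 'k"
      using ijl P unfolding class_point_def by auto
    have "\<exists>a\<in>{i, j, l} - U. \<exists>b\<in>{i, j, l} - U. a \<noteq> b \<and> w a = w b \<and> (\<forall>k\<in>{i, j, l} - U. w a \<le> w k)"
      by (rule trop_lin_form[OF w, where c = "\<lambda>_. 1"])
        (use P ijl False d cp in \<open>auto simp: add.assoc\<close>)
    then obtain a b where ab: "a \<in> {i, j, l} - U" "b \<in> {i, j, l} - U" "a \<noteq> b" "w a = w b"
      "\<forall>k\<in>{i, j, l} - U. w a \<le> w k" by blast
    then have "W a = W b" "\<forall>k\<in>{i, j, l}. W a \<le> W k" unfolding W_def by auto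
    then show ?thesis using ab(1-3) by auto
  qed
  have fin: "\<exists>i\<in>S. W i \<noteq> \<infinity>"
  proof -
    obtain i where "i \<le> n" "i \<notin> U" using U by auto
    then show ?thesis using off unfolding W_def by auto
  qed
  have "\<exists>k\<in>{0, 1, 2}. \<exists>m t. (\<forall>i\<in>S - P k. W i = m) \<and> (\<forall>i\<in>P k. W i = t) \<and> m \<le> t"
  proof -
    \<comment> \<open>With an empty class there is no form with three terms, and the values on the
      other two classes are independent; the class with the larger value gives the arm.\<close>
    have two: "\<exists>k\<in>{0, 1, 2}. \<exists>m t. (\<forall>i\<in>S - P k. W i = m) \<and> (\<forall>i\<in>P k. W i = t) \<and> m \<le> t"
      if k: "{k0, k1, k2} = {0, 1, 2}" and k12: "k1 \<noteq> k2" and e: "P k0 = {}" "i1 \<in> P k1" "i2 \<in> P k2" for k0 k1 k2 i1 i2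
    proof -
      have SP: "S = P k1 \<union> P k2" and kk: "k1 \<in> {0, 1, 2}" "k2 \<in> {0, 1, 2}"
        and dis: "P k1 \<inter> P k2 = {}"
      proof -
        show kk: "k1 \<in> {0, 1, 2}" "k2 \<in> {0, 1, 2}" using k by blast+
        have "S = \<Union>(P ` {0, 1, 2})" using S by auto
        then have "S = \<Union>(P ` {k0, k1, k2})" using k by simp
        then show "S = P k1 \<union> P k2" using e by simp
        show "P k1 \<inter> P k2 = {}" using kk P k12 by auto
      qed
      show ?thesis
      proof (cases "W i1 \<le> W i2")
        case True
        have "(\<forall>i\<in>S - P k2. W i = W i1) \<and> (\<forall>i\<in>P k2. W i = W i2) \<and> W i1 \<le> W i2"
          using SP dis same[OF kk(1) _ e(2)] same[OF kk(2) _ e(3)] True by blast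
        then show ?thesis using kk by blast
      next
        case False
        then have le: "W i2 \<le> W i1" by simp
        have "(\<forall>i\<in>S - P k1. W i = W i2) \<and> (\<forall>i\<in>P k1. W i = W i1) \<and> W i2 \<le> W i1"
          using SP dis same[OF kk(1) _ e(2)] same[OF kk(2) _ e(3)] le by blast
        then show ?thesis using kk by blast
      qed
    qed
    consider "P 0 = {}" | "P 1 = {}" | "P 2 = {}" | i0 i1 i2 where "i0 \<in> P 0" "i1 \<in> P 1" "i2 \<in> P 2" by blast
    then show ?thesis
    proof cases
      case 1
      obtain i1 i2 where "i1 \<in> P 1" "i2 \<in> P 2" using ne 1 by auto
      then show ?thesis using two[of 0 1 2 i1 i2] 1 by simp
    next
      case 2
      obtain i1 i2 where "i1 \<in> P 0" "i2 \<in> P 2" using ne 2 by auto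
      then show ?thesis using two[of 1 0 2 i1 i2] 2 by (simp add: insert_commute)
    next
      case 3
      obtain i1 i2 where "i1 \<in> P 0" "i2 \<in> P 1" using ne 3 by auto
      moreover have "{2, 0, 1} = {0, 1, 2 :: nat}" by auto
      ultimately show ?thesis using two[of 2 0 1 i1 i2] 3 by simp
    next
      case 4
      have V: "\<And>i. i \<in> P 0 \<Longrightarrow> W i = W i0" "\<And>i. i \<in> P 1 \<Longrightarrow> W i = W i1" "\<And>i. i \<in> P 2 \<Longrightarrow> W i = W i2"
        by (rule same[of 0], simp, assumption, rule 4, rule same[of 1], simp, assumption, rule 4,
            rule same[of 2], simp, assumption, rule 4)
      from three[OF 4] show ?thesis
      proof (elim disjE conjE)
        assume "W i0 = W i1" "W i0 \<le> W i2"
        then have "(\<forall>i\<in>S - P 2. W i = W i0) \<and> (\<forall>i\<in>P 2. W i = W i2) \<and> W i0 \<le> W i2" using V S by auto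
        then show ?thesis by blast
      next
        assume "W i0 = W i2" "W i0 \<le> W i1"
        then have "(\<forall>i\<in>S - P 1. W i = W i0) \<and> (\<forall>i\<in>P 1. W i = W i1) \<and> W i0 \<le> W i1" using V S by auto
        then show ?thesis by blast
      next
        assume "W i1 = W i2" "W i1 \<le> W i0"
        then have "(\<forall>i\<in>S - P 0. W i = W i1) \<and> (\<forall>i\<in>P 0. W i = W i0) \<and> W i1 \<le> W i0" using V S by auto
        then show ?thesis by blast
      qed
    qed
  qed
  then obtain k m t where k: "k \<in> {0, 1, 2}" and m: "\<And>i. i \<in> S - P k \<Longrightarrow> W i = m"
    and t: "\<And>i. i \<in> P k \<Longrightarrow> W i = t" and mt: "m \<le> t" by metis
  have kS: "P k \<subseteq> S" "S - P k \<noteq> {}" "S \<subseteq> {..n}" using k S P ne by auto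
  have "m \<noteq> \<infinity>"
  proof
    assume "m = \<infinity>"
    then have "W i = \<infinity>" if "i \<in> S" for i using m[of i] t[of i] mt that by (cases "i \<in> P k") auto
    then show False using fin by auto
  qed
  moreover have "m \<noteq> - \<infinity>"
  proof -
    obtain i where "i \<in> S - P k" using kS by blast
    then show ?thesis using m[of i] unfolding W_def by (auto split: if_splits)
  qed
  ultimately obtain r where r: "m = ereal r" by (cases m) auto
  define q where "q = (\<lambda>i\<in>{..n}. if i \<in> U then \<infinity> else ereal (w i))"
  \<comment> \<open>The representative is shifted by \<open>- m\<close>, which brings the minimum to
    0 as in \<open>arm_coords\<close>; \<open>t\<close> may be infinite but \<open>m\<close> is
    not.\<close>
  have nonneg: "0 \<le> t - m" using mt r by (cases t) auto
  have "TP_rel n `` {arm_coords n S (P k) (t - m)} = TP_rel n `` {q}"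
  proof (rule TP_class_eqI)
    show "arm_coords n S (P k) (t - m) \<in> topspace (TP_coords n)"
      by (rule arm_coords_topspace[OF kS(3,2) nonneg])
    obtain i where "i \<le> n" "i \<notin> U" using U by auto
    then have "\<exists>i\<le>n. q i \<noteq> \<infinity>" unfolding q_def by (intro exI[of _ i]) auto
    then show "q \<in> topspace (TP_coords n)" unfolding topspace_TP_coords by (auto simp: q_def)
    show "q i = ereal r + arm_coords n S (P k) (t - m) i" if "i \<le> n" for i
    proof -
      have "q i = W i" using that unfolding q_def W_def by simp
      moreover have "t = ereal r + (t - m)" using r mt by (cases t) auto
      moreover have "W i = \<infinity>" if "i \<notin> S" using off[OF \<open>i \<le> n\<close> that] unfolding W_def by simp
      ultimately show ?thesis using m[of i] t[of i] that r kS(1) unfolding arm_coords_def by auto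
    qed
  qed
  then have "TP_point n U w \<in> arm n S (P k)"
    unfolding TP_point_def arm_def q_def using nonneg by blast
  then show ?thesis using k by blast
qed

lemma class_point_in:
  assumes "P 0 \<inter> P 1 = {}" "P 0 \<inter> P 2 = {}" "P 1 \<inter> P 2 = {}" "k \<in> {0, 1, 2}" "i \<in> P k"
  shows "class_point P z i = z k"
  using assms unfolding class_point_def by auto

lemma class_point_out: "i \<notin> P 0 \<union> P 1 \<union> P 2 \<Longrightarrow> class_point P z i = 0"
  unfolding class_point_def by auto

text \<open>A point with finite \<open>t\<close> comes from the path \<open>(X, 1, -(1 + X))\<close>
  on the classes \<open>k\<close>, \<open>k1\<close>, \<open>k2\<close>, where \<open>X\<close> has
  weight \<open>t\<close>. The end point comes from the constant path \<open>(0, 1, -1)\<close>, in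
  the stratum where the coordinates in \<open>P k\<close> are infinite as well.\<close>

lemma arm_subset_tropproj:
  fixes val :: "'k::alg_closed_field \<Rightarrow> ereal"
  assumes vf: "valued_field val"
    and P: "P 0 \<union> P 1 \<union> P 2 \<subseteq> {..n}" "P 0 \<inter> P 1 = {}" "P 0 \<inter> P 2 = {}" "P 1 \<inter> P 2 = {}"
    and S: "S = P 0 \<union> P 1 \<union> P 2" and k: "k \<in> {0, 1, 2}" and ne: "S - P k \<noteq> {}"
  shows "arm n S (P k) \<subseteq> tropproj val n (class_ideal n P)"
proof
  interpret valued_field val by (rule vf)
  fix C assume "C \<in> arm n S (P k)"
  then obtain t where t: "0 \<le> t" "C = TP_rel n `` {arm_coords n S (P k) t}" unfolding arm_def by auto
  define k1 where "k1 = (if k = 0 then 1 else 0 :: nat)"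
  define k2 where "k2 = (if k = 2 then 1 else 2 :: nat)"
  have kk: "k1 \<in> {0, 1, 2}" "k2 \<in> {0, 1, 2}" "k \<noteq> k1" "k \<noteq> k2" "k1 \<noteq> k2"
    using k unfolding k1_def k2_def by auto
  have SP: "S = P k \<union> P k1 \<union> P k2" using k S unfolding k1_def k2_def by auto
  have sum3: "z 0 + z 1 + z 2 = z k + z k1 + z k2" for z :: "nat \<Rightarrow> 'k poly"
    using k unfolding k1_def k2_def by (auto simp: algebra_simps)
  have one: "z k1 = 1 \<Longrightarrow> z 0 = 1 \<or> z 1 = 1 \<or> z 2 = 1" for z :: "nat \<Rightarrow> 'k poly"
    unfolding k1_def by (cases "k = 0") (simp_all del: One_nat_def)
  note cp = class_point_in[where P = P, OF P(2-4)]
  have disj: "P k \<inter> P k1 = {}" "P k \<inter> P k2 = {}" "P k1 \<inter> P k2 = {}"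
    using k P unfolding k1_def k2_def by auto
  have Sn: "S \<subseteq> {..n}" using S P by simp
  have in_trop: "TP_point n U w \<in> tropproj val n (class_ideal n P)"
    if "U \<subset> {..n}" "w \<in> trop val ({..n} - U) (stratum_ideal n U (class_ideal n P))" for U w
    using that unfolding tropproj_def by blast
  show "C \<in> tropproj val n (class_ideal n P)"
  proof (cases t)
    case (real r)
    define q where "q j = (if j = k then [:0, 1:] else if j = k1 then 1 else - (1 + [:0, 1:]) :: 'k poly)" for j
    define \<epsilon> where "\<epsilon> i = (if i \<in> P k2 then - (1 + fls_X) else 1 :: 'k fls)" for i
    define h where "h i = (if i \<in> P k then 1 else 0 :: int)" for i
    define U where "U = {..n} - S"
    define w where "w = (\<lambda>i\<in>{..n} - U. r * of_int (h i))"
    have US: "{..n} - U = S" using Sn unfolding U_def by auto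
    have qv: "q k = [:0, 1:]" "q k1 = 1" "q k2 = - (1 + [:0, 1:])"
      using kk unfolding q_def by auto
    have "w \<in> trop val ({..n} - U) (stratum_ideal n U (class_ideal n P))"
    proof (rule class_path_in_trop[OF vf, where q = q and \<epsilon> = \<epsilon> and h = h and t = r])
      show "q 0 + q 1 + q 2 = 0" unfolding sum3 qv by simp
      show "q 0 = 1 \<or> q 1 = 1 \<or> q 2 = 1" using one qv by blast
      show "U \<subseteq> {..n}" unfolding U_def by auto
      show "i \<in> U \<longleftrightarrow> class_point P q i = 0" if "i \<le> n" for i
      proof (cases "i \<in> S")
        case True
        then have "class_point P q i \<in> {q k, q k1, q k2}" using cp k kk SP by auto
        moreover have "- (1 + [:0, 1:]) \<noteq> (0 :: 'k poly)" by (simp add: one_pCons)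
        ultimately have "class_point P q i \<noteq> 0" unfolding qv by (elim insertE) simp_all
        then show ?thesis using True unfolding U_def by auto
      next
        case False
        then show ?thesis using class_point_out[of i P q] S that unfolding U_def by auto
      qed
      show "fps_to_fls (fps_of_poly (class_point P q i)) = fls_X powi (h i) * \<epsilon> i" if "i \<in> {..n} - U" for i
      proof -
        have i: "i \<in> P k \<or> i \<in> P k1 \<or> i \<in> P k2" using that US SP by auto
        have X: "fps_of_poly [:0, 1 :: 'k:] = fps_X" by (simp add: fps_of_poly_pCons)
        have "h i = 1 \<and> \<epsilon> i = 1 \<and> class_point P q i = [:0, 1:]" if "i \<in> P k"
          using that disj cp[OF k that, of q] qv unfolding h_def \<epsilon>_def by auto
        moreover have "h i = 0 \<and> \<epsilon> i = 1 \<and> class_point P q i = 1" if "i \<in> P k1"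
          using that disj cp[OF kk(1) that, of q] qv unfolding h_def \<epsilon>_def by auto
        moreover have "h i = 0 \<and> \<epsilon> i = - (1 + fls_X) \<and> class_point P q i = - (1 + [:0, 1:])" if "i \<in> P k2"
          using that disj cp[OF kk(2) that, of q] qv unfolding h_def \<epsilon>_def by auto
        moreover have "fps_to_fls (fps_of_poly (- (1 + [:0, 1 :: 'k:]))) = - (1 + fls_X)"
          unfolding fps_of_poly_uminus fps_of_poly_add X by simp
        moreover have "fps_to_fls (fps_of_poly [:0, 1 :: 'k:]) = fls_X" unfolding X by simp
        moreover have "fps_to_fls (fps_of_poly (1 :: 'k poly)) = 1" by simp
        moreover have "fls_X powi 1 * 1 = (fls_X :: 'k fls)" "fls_X powi 0 * u = (u :: 'k fls)" for u
          by (simp_all del: fls_X_power_int)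
        ultimately show ?thesis using i by (elim disjE) (simp_all only:)
      qed
      show "val_unit (\<epsilon> i) \<and> val_unit (inverse (\<epsilon> i))" for i
        unfolding \<epsilon>_def
        by (simp add: val_unit_1 val_unit_1_X val_unit_inverse_1_X val_unit_uminus del: minus_add_distrib)
      show "w \<in> ({..n} - U) \<rightarrow>\<^sub>E UNIV" "\<And>i. i \<in> {..n} - U \<Longrightarrow> w i = r * of_int (h i)" "0 \<le> r"
        using t real unfolding w_def by auto
    qed
    moreover have "U \<subset> {..n}" using ne Sn unfolding U_def by auto
    moreover have "TP_point n U w = C"
      unfolding TP_point_def t(2)
      by (rule arg_cong[where f = "\<lambda>p. TP_rel n `` {p}"])
        (use real in \<open>auto simp: fun_eq_iff arm_coords_def U_def w_def h_def zero_ereal_def\<close>)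
    ultimately show ?thesis using in_trop by metis
  next
    case PInf
    define q where "q j = (if j = k then 0 else if j = k1 then 1 else - 1 :: 'k poly)" for j
    define \<epsilon> where "\<epsilon> i = (if i \<in> P k2 then - 1 else 1 :: 'k fls)" for i
    define U where "U = ({..n} - S) \<union> P k"
    define w where "w = (\<lambda>i\<in>{..n} - U. 0 :: real)"
    have US: "{..n} - U = S - P k" using Sn unfolding U_def by auto
    have qv: "q k = 0" "q k1 = 1" "q k2 = - 1" using kk unfolding q_def by auto
    have "w \<in> trop val ({..n} - U) (stratum_ideal n U (class_ideal n P))"
    proof (rule class_path_in_trop[OF vf, where q = q and \<epsilon> = \<epsilon> and h = "\<lambda>_. 0" and t = 0])
      show "q 0 + q 1 + q 2 = 0" unfolding sum3 qv by simp
      show "q 0 = 1 \<or> q 1 = 1 \<or> q 2 = 1" using one qv by blast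
      show "U \<subseteq> {..n}" using Sn SP unfolding U_def by auto
      show "i \<in> U \<longleftrightarrow> class_point P q i = 0" if "i \<le> n" for i
      proof (cases "i \<in> S - P k")
        case True
        then have "class_point P q i \<in> {q k1, q k2}" using cp kk SP by auto
        then show ?thesis using True unfolding qv U_def by auto
      next
        case False
        then show ?thesis using class_point_out[of i P q] cp[OF k, of i q] qv S that unfolding U_def by auto
      qed
      show "fps_to_fls (fps_of_poly (class_point P q i)) = fls_X powi 0 * \<epsilon> i" if "i \<in> {..n} - U" for i
      proof -
        have i: "i \<in> P k1 \<or> i \<in> P k2" using that US SP by auto
        have "\<epsilon> i = 1 \<and> class_point P q i = 1" if "i \<in> P k1"
          using that disj cp[OF kk(1) that, of q] qv unfolding \<epsilon>_def by auto
        moreover have "\<epsilon> i = - 1 \<and> class_point P q i = - 1" if "i \<in> P k2"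
          using that cp[OF kk(2) that, of q] qv unfolding \<epsilon>_def by auto
        ultimately show ?thesis using i
          by (elim disjE) (simp_all add: fps_of_poly_uminus)
      qed
      show "val_unit (\<epsilon> i) \<and> val_unit (inverse (\<epsilon> i))" for i
        unfolding \<epsilon>_def by (simp add: val_unit_1 val_unit_uminus)
    qed (auto simp: w_def)
    moreover have "U \<subset> {..n}" using ne Sn SP unfolding U_def by auto
    moreover have "TP_point n U w = C"
      unfolding TP_point_def t(2)
      by (rule arg_cong[where f = "\<lambda>p. TP_rel n `` {p}"])
        (use PInf in \<open>auto simp: fun_eq_iff arm_coords_def U_def w_def zero_ereal_def\<close>)
    ultimately show ?thesis using in_trop by metis
  qed (use t in auto)
qed

lemma tropproj_class_ideal:
  fixes val :: "'k::alg_closed_field \<Rightarrow> ereal"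
  assumes vf: "valued_field val"
    and P: "P 0 \<union> P 1 \<union> P 2 \<subseteq> {..n}" "P 0 \<inter> P 1 = {}" "P 0 \<inter> P 2 = {}" "P 1 \<inter> P 2 = {}"
    and ne: "P 1 \<union> P 2 \<noteq> {}" "P 0 \<union> P 2 \<noteq> {}" "P 0 \<union> P 1 \<noteq> {}"
    and S: "S = P 0 \<union> P 1 \<union> P 2"
  shows "tropproj val n (class_ideal n P) = (\<Union>k\<in>{0, 1, 2}. arm n S (P k))"
proof
  show "tropproj val n (class_ideal n P) \<subseteq> (\<Union>k\<in>{0, 1, 2}. arm n S (P k))"
    unfolding tropproj_def using trop_line_subset[OF vf P ne S] by blast
  have "S - P k \<noteq> {}" if "k \<in> {0, 1, 2}" for k using that S P ne by auto
  then show "(\<Union>k\<in>{0, 1, 2}. arm n S (P k)) \<subseteq> tropproj val n (class_ideal n P)"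
    using arm_subset_tropproj[OF vf P S] by blast
qed

lemma union_of_arms_tropical_line:
  fixes val :: "'k::alg_closed_field \<Rightarrow> ereal" and P :: "nat \<Rightarrow> nat set"
  assumes vf: "valued_field val"
    and P: "P 0 \<union> P 1 \<union> P 2 \<subseteq> {..n}" "P 0 \<inter> P 1 = {}" "P 0 \<inter> P 2 = {}" "P 1 \<inter> P 2 = {}"
    and ne: "P 1 \<union> P 2 \<noteq> {}" "P 0 \<union> P 2 \<noteq> {}" "P 0 \<union> P 1 \<noteq> {}"
    and S: "S = P 0 \<union> P 1 \<union> P 2"
  shows "(\<Union>k\<in>{0, 1, 2}. arm n S (P k)) \<in> tropical_lines val n"
  using class_ideal_tropical_line[OF P ne] tropproj_class_ideal[OF assms] by metis

section \<open>The embedding of the graph\<close>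

subsection \<open>The topology of tropical projective space\<close>

lemma topspace_TP: "topspace (TP n) = topspace (TP_coords n) // TP_rel n"
proof -
  have "openin (TP n) (topspace (TP_coords n) // TP_rel n)"
    unfolding TP_def openin_quotient_topology[OF equiv_TP_rel]
    using Union_quotient[OF equiv_TP_rel] by (metis openin_topspace order_refl)
  moreover have "topspace (TP n) \<subseteq> topspace (TP_coords n) // TP_rel n"
    using openin_topspace[of "TP n"] unfolding TP_def openin_quotient_topology[OF equiv_TP_rel] by blast
  ultimately show ?thesis using openin_subset by blast
qed

lemma TP_class_topspace: "p \<in> topspace (TP_coords n) \<Longrightarrow> TP_rel n `` {p} \<in> topspace (TP n)"
  unfolding topspace_TP by (rule quotientI)

lemma in_TP_class: "p \<in> topspace (TP_coords n) \<Longrightarrow> p \<in> TP_rel n `` {p}"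
  by (rule equiv_class_self[OF equiv_TP_rel])

lemma TP_class_mem:
  assumes "C \<in> topspace (TP n)" "p \<in> C" shows "C = TP_rel n `` {p}" "p \<in> topspace (TP_coords n)"
proof -
  obtain q where q: "q \<in> topspace (TP_coords n)" "C = TP_rel n `` {q}"
    using assms(1) unfolding topspace_TP by (rule quotientE)
  have "(q, p) \<in> TP_rel n" using assms(2) q by simp
  then show "C = TP_rel n `` {p}" "p \<in> topspace (TP_coords n)"
    using equiv_class_eq[OF equiv_TP_rel] q by (auto simp: TP_rel_def)
qed

lemma continuous_map_TP_class: "continuous_map (TP_coords n) (TP n) (\<lambda>p. TP_rel n `` {p})"
  unfolding continuous_map_def
proof (intro conjI allI impI)
  show "(\<lambda>p. TP_rel n `` {p}) \<in> topspace (TP_coords n) \<rightarrow> topspace (TP n)"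
    using TP_class_topspace by auto
  fix U assume U: "openin (TP n) U"
  then have sub: "U \<subseteq> topspace (TP n)" by (rule openin_subset)
  have "{p \<in> topspace (TP_coords n). TP_rel n `` {p} \<in> U} = \<Union>U"
  proof (intro subset_antisym subsetI)
    fix p assume "p \<in> {p \<in> topspace (TP_coords n). TP_rel n `` {p} \<in> U}"
    then show "p \<in> \<Union>U" using in_TP_class by (intro UnionI[of "TP_rel n `` {p}"]) auto
  next
    fix p assume "p \<in> \<Union>U"
    then obtain C where C: "p \<in> C" "C \<in> U" by blast
    note p = TP_class_mem[OF subsetD[OF sub C(2)] C(1)]
    show "p \<in> {p \<in> topspace (TP_coords n). TP_rel n `` {p} \<in> U}" using C(2) p(2) unfolding p(1) by simp
  qed
  then show "openin (TP_coords n) {p \<in> topspace (TP_coords n). TP_rel n `` {p} \<in> U}"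
    using U unfolding TP_def openin_quotient_topology[OF equiv_TP_rel] by simp
qed

lemma continuous_map_from_TP:
  assumes f: "continuous_map (TP_coords n) Y f"
    and inv: "\<And>p. p \<in> topspace (TP_coords n) \<Longrightarrow> f p = h (TP_rel n `` {p})"
  shows "continuous_map (TP n) Y h"
  unfolding continuous_map_def
proof (intro conjI allI impI)
  show "h \<in> topspace (TP n) \<rightarrow> topspace Y"
  proof
    fix C assume "C \<in> topspace (TP n)"
    then obtain p where p: "p \<in> topspace (TP_coords n)" "C = TP_rel n `` {p}"
      unfolding topspace_TP by (rule quotientE)
    have "f p \<in> topspace Y" using continuous_map_funspace[OF f] p(1) by blast
    then show "h C \<in> topspace Y" unfolding p(2) inv[OF p(1)] .
  qed
  fix U assume U: "openin Y U"
  have "\<Union>{C \<in> topspace (TP n). h C \<in> U} = {p \<in> topspace (TP_coords n). f p \<in> U}"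
  proof (intro subset_antisym subsetI)
    fix p assume "p \<in> \<Union>{C \<in> topspace (TP n). h C \<in> U}"
    then obtain C where C: "p \<in> C" "C \<in> topspace (TP n)" "h C \<in> U" by blast
    note p = TP_class_mem[OF C(2,1)]
    show "p \<in> {p \<in> topspace (TP_coords n). f p \<in> U}" using C(3) p(2) inv unfolding p(1) by simp
  next
    fix p assume "p \<in> {p \<in> topspace (TP_coords n). f p \<in> U}"
    then have p: "p \<in> topspace (TP_coords n)" "f p \<in> U" by blast+
    show "p \<in> \<Union>{C \<in> topspace (TP n). h C \<in> U}"
      using in_TP_class[OF p(1)] TP_class_topspace[OF p(1)] inv[OF p(1)] p(2)
      by (intro UnionI[of "TP_rel n `` {p}"]) simp_all
  qed
  moreover have "openin (TP_coords n) {p \<in> topspace (TP_coords n). f p \<in> U}"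
    using f U unfolding continuous_map_def by blast
  ultimately show "openin (TP n) {C \<in> topspace (TP n). h C \<in> U}"
    unfolding TP_def openin_quotient_topology[OF equiv_TP_rel] by (auto simp: topspace_TP[unfolded TP_def])
qed

definition exp_neg :: "ereal \<Rightarrow> real" where
  "exp_neg x = (if x = \<infinity> then 0 else exp (- real_of_ereal x))"

lemma exp_neg_add: "exp_neg (ereal c + x) = exp (- c) * exp_neg x" if "x \<noteq> -\<infinity>"
  using that by (cases x) (auto simp: exp_neg_def exp_add[symmetric])

lemma exp_neg_nonneg: "0 \<le> exp_neg x"
  unfolding exp_neg_def by simp

lemma exp_neg_pos: "x \<noteq> \<infinity> \<Longrightarrow> 0 < exp_neg x"
  unfolding exp_neg_def by simp

lemma continuous_on_exp_neg: "continuous_on {-\<infinity><..} exp_neg"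
proof -
  have "isCont exp_neg x" if x: "-\<infinity> < x" for x
  proof (cases x)
    case (real r)
    have "isCont (\<lambda>y. exp (- real_of_ereal y)) x"
      using real by (intro continuous_intros continuous_at_of_ereal) auto
    moreover have "eventually (\<lambda>y. exp (- real_of_ereal y) = exp_neg y) (nhds x)"
      using eventually_nhds_in_open[of "{..<\<infinity>}" x] real
      by (auto simp: exp_neg_def elim!: eventually_mono)
    ultimately show ?thesis by (simp add: isCont_cong)
  next
    case PInf
    have "(exp_neg \<longlongrightarrow> 0) (at \<infinity>)"
    proof (rule order_tendstoI)
      fix a :: real assume "a < 0"
      then show "\<forall>\<^sub>F y in at \<infinity>. a < exp_neg y"
        using exp_neg_nonneg by (auto intro!: always_eventually elim: less_le_trans)
    next
      fix a :: real assume a: "0 < a"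
      have "eventually (\<lambda>y. y \<in> {ereal (- ln a)<..}) (nhds \<infinity>)"
        by (intro eventually_nhds_in_open) auto
      then have "eventually (\<lambda>y. y \<in> {ereal (- ln a)<..}) (at \<infinity>)"
        unfolding eventually_at_filter by (rule eventually_mono) simp
      then show "\<forall>\<^sub>F y in at \<infinity>. exp_neg y < a"
      proof (rule eventually_mono)
        fix y assume "y \<in> {ereal (- ln a)<..}"
        then show "exp_neg y < a"
        proof (cases y)
          case (real s)
          then have "- s < ln a" using \<open>y \<in> _\<close> by simp
          then have "exp (- s) < exp (ln a)" by simp
          then show ?thesis using a real by (simp add: exp_neg_def)
        qed (use a in \<open>auto simp: exp_neg_def\<close>)
      qed
    qed
    then show ?thesis using PInf by (simp add: isCont_def exp_neg_def)
  qed (use x in auto)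
  then show ?thesis by (intro continuous_at_imp_continuous_on) auto
qed

text \<open>The values \<open>exp (- p i)\<close> scaled to sum 1: an additive constant in
  \<open>p\<close> cancels and infinity becomes 0. This continuous injection into a real product
  space is what makes \<open>TP n\<close> Hausdorff.\<close>

definition simplex_coords :: "nat \<Rightarrow> (nat \<Rightarrow> ereal) \<Rightarrow> nat \<Rightarrow> real" where
  "simplex_coords n p = (\<lambda>i\<in>{..n}. exp_neg (p i) / (\<Sum>j\<le>n. exp_neg (p j)))"

lemma sum_exp_neg_pos:
  assumes "p \<in> topspace (TP_coords n)" shows "0 < (\<Sum>j\<le>n. exp_neg (p j))"
proof -
  obtain i where "i \<le> n" "p i \<noteq> \<infinity>" using assms unfolding topspace_TP_coords by auto
  then show ?thesis
    using exp_neg_pos exp_neg_nonneg by (intro sum_pos2[of _ i]) auto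
qed

lemma TP_coords_not_MInf: "p \<in> topspace (TP_coords n) \<Longrightarrow> i \<le> n \<Longrightarrow> p i \<noteq> - \<infinity>"
  unfolding topspace_TP_coords by (auto simp: PiE_def Pi_def)

lemma simplex_coords_rel:
  assumes "(p, q) \<in> TP_rel n" shows "simplex_coords n p = simplex_coords n q"
proof -
  obtain c where pq: "p \<in> topspace (TP_coords n)" and c: "\<And>i. i \<le> n \<Longrightarrow> q i = ereal c + p i"
    using assms unfolding TP_rel_def by auto
  have "exp_neg (q i) = exp (- c) * exp_neg (p i)" if "i \<le> n" for i
    using c[OF that] exp_neg_add TP_coords_not_MInf[OF pq that] by simp
  moreover from this have "(\<Sum>j\<le>n. exp_neg (q j)) = exp (- c) * (\<Sum>j\<le>n. exp_neg (p j))"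
    by (simp add: sum_distrib_left)
  ultimately show ?thesis unfolding simplex_coords_def by (intro restrict_ext) simp
qed

lemma simplex_coords_inject:
  assumes p: "p \<in> topspace (TP_coords n)" and q: "q \<in> topspace (TP_coords n)"
    and eq: "simplex_coords n p = simplex_coords n q"
  shows "(p, q) \<in> TP_rel n"
proof -
  define a where "a = (\<Sum>j\<le>n. exp_neg (p j))"
  define b where "b = (\<Sum>j\<le>n. exp_neg (q j))"
  have ab: "0 < a" "0 < b" unfolding a_def b_def using sum_exp_neg_pos p q by auto
  have "q i = ereal (ln (a / b)) + p i" if i: "i \<le> n" for i
  proof -
    have e: "exp_neg (p i) / a = exp_neg (q i) / b"
      using fun_cong[OF eq, of i] i unfolding simplex_coords_def a_def b_def by simp
    show ?thesis
    proof (cases "p i = \<infinity> \<or> q i = \<infinity>")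
      case True
      then have "exp_neg (p i) = 0 \<or> exp_neg (q i) = 0" by (auto simp: exp_neg_def)
      then have "exp_neg (p i) = 0 \<and> exp_neg (q i) = 0" using e ab by auto
      then have "p i = \<infinity>" "q i = \<infinity>" using exp_neg_pos[of "p i"] exp_neg_pos[of "q i"] by force+
      then show ?thesis by simp
    next
      case False
      then obtain x y where xy: "p i = ereal x" "q i = ereal y"
        using TP_coords_not_MInf p q i by (metis ereal_cases)
      then have "exp (- x) / a = exp (- y) / b" using e by (simp add: exp_neg_def)
      then have "ln (exp (- x) / a) = ln (exp (- y) / b)" by simp
      then have "- x - ln a = - y - ln b" using ab by (simp add: ln_div)
      then show ?thesis using xy ab by (simp add: ln_div)
    qed
  qed
  then show ?thesis using p q unfolding TP_rel_def by auto
qed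

lemma continuous_map_simplex_coords:
  "continuous_map (TP_coords n) (powertop_real {..n}) (simplex_coords n)"
proof -
  have "continuous_map (TP_coords n) euclideanreal (\<lambda>p. exp_neg (p i))" if "i \<le> n" for i
  proof -
    have 1: "continuous_map (TP_coords n) (top_of_set {-\<infinity><..}) (\<lambda>p. p i)"
      unfolding TP_coords_def using that
      by (intro continuous_map_from_subtopology continuous_map_product_projection) auto
    have 2: "continuous_map (top_of_set {-\<infinity><..}) euclideanreal exp_neg"
      using continuous_on_exp_neg by simp
    show ?thesis using continuous_map_compose[OF 1 2] by (simp add: comp_def)
  qed
  then show ?thesis
    unfolding continuous_map_componentwise simplex_coords_def
    using sum_exp_neg_pos by (auto intro!: continuous_map_real_divide continuous_map_sum simp: less_imp_neq[symmetric])
qed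

lemma Hausdorff_space_TP: "Hausdorff_space (TP n)"
proof (rule Hausdorff_space_injective_preimage)
  \<comment> \<open>The choice of the representative does not matter, by
    \<open>simplex_coords_rel\<close>.\<close>
  let ?h = "\<lambda>C. simplex_coords n (SOME p. p \<in> C)"
  have h: "simplex_coords n p = ?h (TP_rel n `` {p})" if "p \<in> topspace (TP_coords n)" for p
  proof -
    have "(SOME x. x \<in> TP_rel n `` {p}) \<in> TP_rel n `` {p}" using in_TP_class[OF that] by (rule someI[where P = "\<lambda>x. x \<in> TP_rel n `` {p}"])
    then show ?thesis by (intro simplex_coords_rel) simp
  qed
  show "Hausdorff_space (powertop_real {..n})" by (simp add: Hausdorff_space_product_topology)
  show "continuous_map (TP n) (powertop_real {..n}) ?h"
    using continuous_map_simplex_coords h by (rule continuous_map_from_TP)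
  show "inj_on ?h (topspace (TP n))"
  proof (rule inj_onI)
    fix C D assume CD: "C \<in> topspace (TP n)" "D \<in> topspace (TP n)" "?h C = ?h D"
    then obtain p q where pq: "p \<in> topspace (TP_coords n)" "C = TP_rel n `` {p}"
      "q \<in> topspace (TP_coords n)" "D = TP_rel n `` {q}"
      unfolding topspace_TP by (metis quotientE)
    then have "simplex_coords n p = simplex_coords n q" using CD(3) h by simp
    then show "C = D" using simplex_coords_inject pq equiv_class_eq[OF equiv_TP_rel] by metis
  qed
qed

text \<open>A decreasing bijection from the unit interval to the interval from 0 to infinity.
  Infinity as the value at negative arguments makes it continuous on the whole line.\<close>

definition stretch :: "real \<Rightarrow> ereal" where
  "stretch s = (if s \<le> 0 then \<infinity> else ereal (1 / s - 1))"

lemma stretch_0 [simp]: "stretch 0 = \<infinity>" and stretch_1 [simp]: "stretch 1 = 0"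
  by (simp_all add: stretch_def zero_ereal_def)

lemma stretch_nonneg: "s \<le> 1 \<Longrightarrow> 0 \<le> stretch s"
  unfolding stretch_def by (auto simp: field_simps)

lemma stretch_not_MInf: "- \<infinity> < stretch s"
  unfolding stretch_def by simp

lemma stretch_inject: "0 \<le> s \<Longrightarrow> 0 \<le> t \<Longrightarrow> stretch s = stretch t \<longleftrightarrow> s = t"
  unfolding stretch_def by (auto simp: field_simps)

lemma stretch_surj: assumes "0 \<le> t" obtains s where "0 \<le> s" "s \<le> 1" "stretch s = t"
proof (cases t)
  case (real r)
  then have "0 \<le> r" using assms by simp
  then show ?thesis using that[of "1 / (1 + r)"] real by (simp add: stretch_def)
next
  case PInf then show ?thesis using that[of 0] by simp
qed (use assms in auto)

lemma isCont_stretch: "isCont stretch x"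
proof -
  consider "x < 0" | "x = 0" | "x > 0" by linarith
  then show ?thesis
  proof cases
    case 1
    have "eventually (\<lambda>y. \<infinity> = stretch y) (nhds x)"
      using eventually_nhds_in_open[of "{..<0}" x] 1
      by (auto simp: stretch_def elim!: eventually_mono)
    moreover have "isCont (\<lambda>_. \<infinity> :: ereal) x" by simp
    ultimately show ?thesis using isCont_cong by fastforce
  next
    case 3
    have "eventually (\<lambda>y. ereal (1 / y - 1) = stretch y) (nhds x)"
      using eventually_nhds_in_open[of "{0<..}" x] 3
      by (auto simp: stretch_def elim!: eventually_mono)
    moreover have "isCont (\<lambda>y. ereal (1 / y - 1)) x" using 3 by (intro continuous_intros) auto
    ultimately show ?thesis using isCont_cong by fastforce
  next
    case 2
    have "(stretch \<longlongrightarrow> \<infinity>) (at 0)"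
      unfolding tendsto_PInfty
    proof
      fix B :: real
      define \<delta> where "\<delta> = 1 / (\<bar>B\<bar> + 2)"
      have "0 < \<delta>" unfolding \<delta>_def by simp
      then have "eventually (\<lambda>y. y \<in> {..<\<delta>}) (nhds 0)" by (intro eventually_nhds_in_open) auto
      then show "eventually (\<lambda>y. ereal B < stretch y) (at 0)"
        unfolding eventually_at_filter
      proof (rule eventually_mono, intro impI)
        fix y assume y: "y \<in> {..<\<delta>}"
        show "ereal B < stretch y"
        proof (cases "y \<le> 0")
          case False
          then have "1 / \<delta> < 1 / y" using y by (intro divide_strict_left_mono) auto
          then have "B < 1 / y - 1" unfolding \<delta>_def by simp
          then show ?thesis using False by (simp add: stretch_def)
        qed (simp add: stretch_def)
      qed
    qed
    then show ?thesis using 2 by (simp add: isCont_def)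
  qed
qed

lemma continuous_map_Max_insert:
  assumes "finite A" "\<And>a. a \<in> A \<Longrightarrow> continuous_map X euclideanreal (f a)"
  shows "continuous_map X euclideanreal (\<lambda>x. Max (insert 0 ((\<lambda>a. f a x) ` A)))"
  using assms
proof (induction A rule: finite_induct)
  case (insert a A)
  have "Max (insert 0 ((\<lambda>a. f a x) ` insert a A)) = max (f a x) (Max (insert 0 ((\<lambda>a. f a x) ` A)))" for x
    using insert(1) by (simp add: insert_commute[of 0])
  then show ?case using insert by (simp add: continuous_map_real_max)
qed simp

section \<open>The map from the graph onto the union of the lines\<close>

context coded_graph begin

abbreviation "S \<equiv> vertex_code E T"

text \<open>Chosen such that \<open>2 * x v + slope i v w * x w - 1\<close> at
  \<open>arm_param v w s\<close> is \<open>1\<close> for \<open>i\<close> in \<open>T {v, w}\<close>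
  and \<open>s\<close> for the other \<open>i\<close> in \<open>S v\<close>, whether the arm covers
  half of the edge or all of it.\<close>

definition slope :: "nat \<Rightarrow> 'v \<Rightarrow> 'v \<Rightarrow> real" where
  "slope i v w = (if i \<in> T {v, w} then 2 else if S w = T {v, w} then 1 else 0)"

definition darts :: "nat \<Rightarrow> ('v \<times> 'v) set" where
  "darts i = {(v, w). {v, w} \<in> E \<and> i \<in> S v}"

text \<open>One maximum of affine functions for the whole graph instead of a definition edge by
  edge: continuity is immediate and nothing has to be glued at vertices and midpoints. The entry 0
  provides the value at coordinates outside \<open>S v\<close>.\<close>

definition weight :: "('v \<Rightarrow> real) \<Rightarrow> nat \<Rightarrow> real" where
  "weight x i = Max (insert 0 ((\<lambda>(v, w). 2 * x v + slope i v w * x w - 1) ` darts i))"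

definition coords :: "('v \<Rightarrow> real) \<Rightarrow> nat \<Rightarrow> ereal" where
  "coords x = (\<lambda>i\<in>{..n}. stretch (weight x i))"

definition graph_map :: "('v \<Rightarrow> real) \<Rightarrow> (nat \<Rightarrow> ereal) set" where
  "graph_map x = TP_rel n `` {coords x}"

definition segment :: "'v \<Rightarrow> 'v \<Rightarrow> real \<Rightarrow> 'v \<Rightarrow> real" where
  "segment v w s = (\<lambda>u\<in>V. if u = v then s else if u = w then 1 - s else 0)"

text \<open>The vertex \<open>v\<close> is at \<open>s = 1\<close>. The point with \<open>s = 0\<close> is the midpoint of the edge, or \<open>w\<close> if
  the whole edge is mapped to the arm at \<open>v\<close>.\<close>
definition arm_param :: "'v \<Rightarrow> 'v \<Rightarrow> real \<Rightarrow> 'v \<Rightarrow> real" where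
  "arm_param v w s = segment v w (if S w = T {v, w} then s else (1 + s) / 2)"

definition line_of :: "'v \<Rightarrow> (nat \<Rightarrow> ereal) set set" where
  "line_of v = (\<Union>e\<in>{e \<in> E. v \<in> e}. arm n (S v) (S v - T e))"

lemma adj_V: "{v, w} \<in> E \<Longrightarrow> v \<in> V" "{v, w} \<in> E \<Longrightarrow> w \<in> V"
  using edge_subset by blast+

lemma adj_neq: "{v, w} \<in> E \<Longrightarrow> v \<noteq> w"
  using card_edge by fastforce

lemma T_S: "e \<in> E \<Longrightarrow> v \<in> e \<Longrightarrow> T e \<subseteq> S v"
  unfolding vertex_code_def by blast

lemma S_subset: "S v \<subseteq> {..n}"
  unfolding vertex_code_def using T_subset by blast

lemma finite_darts: "finite (darts i)"
  by (rule finite_subset[of _ "V \<times> V"]) (use finite_V adj_V in \<open>auto simp: darts_def\<close>)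

lemma segment_commute: "{v, w} \<in> E \<Longrightarrow> segment v w s = segment w v (1 - s)"
  using adj_neq unfolding segment_def by (intro restrict_ext) auto

lemma edge_two_ends:
  assumes "e \<in> E" obtains v w where "e = {v, w}" "{v, w} \<in> E"
  using card_edge[OF assms] assms by (auto simp: card_2_iff)

lemma ex_neighbour: assumes "v \<in> V" obtains w where "{v, w} \<in> E"
proof -
  have "{e \<in> E. v \<in> e} \<noteq> {}" using degree[OF assms] by force
  then obtain e where e: "e \<in> E" "v \<in> e" by blast
  obtain a b where "e = {a, b}" "{a, b} \<in> E" using e(1) by (rule edge_two_ends)
  then show ?thesis using e that[of a] that[of b] by (auto simp: insert_commute)
qed

lemma topspace_realisation:
  "topspace (graph_realisation V E) = (\<Union>(v, w)\<in>{(v, w). {v, w} \<in> E}. segment v w ` {0..1})" (is "?L = ?R")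
proof -
  have L: "?L = {x \<in> V \<rightarrow>\<^sub>E {0..1}. (\<Sum>v\<in>V. x v) = 1 \<and> {v \<in> V. x v \<noteq> 0} \<in> E \<union> (\<lambda>v. {v}) ` V}"
    unfolding graph_realisation_def by auto
  show ?thesis
  proof (intro subset_antisym subsetI)
    fix x assume "x \<in> ?L"
    then have x: "x \<in> V \<rightarrow>\<^sub>E {0..1}" "(\<Sum>v\<in>V. x v) = 1" "{v \<in> V. x v \<noteq> 0} \<in> E \<union> (\<lambda>v. {v}) ` V"
      unfolding L by auto
    obtain v w where vw: "{v, w} \<in> E" "\<And>u. u \<in> V \<Longrightarrow> u \<noteq> v \<Longrightarrow> u \<noteq> w \<Longrightarrow> x u = 0"
    proof -
      consider "{v \<in> V. x v \<noteq> 0} \<in> E" | v where "v \<in> V" "{v \<in> V. x v \<noteq> 0} = {v}" using x(3) by blast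
      then show ?thesis
      proof cases
        case 1
        then obtain a b where "{v \<in> V. x v \<noteq> 0} = {a, b}" "{a, b} \<in> E" by (rule edge_two_ends)
        then show ?thesis using that[of a b] by blast
      next
        case (2 v)
        obtain w where "{v, w} \<in> E" using 2(1) by (rule ex_neighbour)
        then show ?thesis using that[of v w] 2 by blast
      qed
    qed
    have "(\<Sum>u\<in>V. x u) = (\<Sum>u\<in>{v, w}. x u)"
      using vw adj_V[OF vw(1)] finite_V by (intro sum.mono_neutral_right) auto
    then have sum: "x v + x w = 1" using x(2) adj_neq[OF vw(1)] by simp
    have "x = segment v w (x v)"
    proof
      fix u
      show "x u = segment v w (x v) u"
        using x(1) vw(2)[of u] sum adj_neq[OF vw(1)] unfolding segment_def
        by (cases "u \<in> V") (auto simp: PiE_def extensional_def)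
    qed
    moreover have "x v \<in> {0..1}" using x(1) adj_V[OF vw(1)] by blast
    ultimately show "x \<in> ?R" using vw(1) by blast
  next
    fix x assume "x \<in> ?R"
    then obtain v w s where x: "{v, w} \<in> E" "s \<in> {0..1}" "x = segment v w s" by auto
    have V: "v \<in> V" "w \<in> V" "v \<noteq> w" using adj_V x adj_neq by blast+
    have "(\<Sum>u\<in>V. x u) = (\<Sum>u\<in>{v, w}. x u)"
      using V finite_V by (intro sum.mono_neutral_right) (auto simp: x segment_def)
    then have "(\<Sum>u\<in>V. x u) = 1" using V by (simp add: x segment_def)
    moreover have "x \<in> V \<rightarrow>\<^sub>E {0..1}" using x(2) unfolding x segment_def by auto
    moreover have "{u \<in> V. x u \<noteq> 0} \<in> E \<union> (\<lambda>v. {v}) ` V"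
    proof -
      have "{u \<in> V. x u \<noteq> 0} = (if s = 0 then {w} else if s = 1 then {v} else {v, w})"
        using V x(2) unfolding x segment_def by auto
      then show ?thesis using V x(1) by auto
    qed
    ultimately show "x \<in> ?L" unfolding L by blast
  qed
qed

lemma segment_in_realisation:
  "{v, w} \<in> E \<Longrightarrow> 0 \<le> s \<Longrightarrow> s \<le> 1 \<Longrightarrow> segment v w s \<in> topspace (graph_realisation V E)"
  unfolding topspace_realisation by (intro UN_I[of "(v, w)"]) auto

lemma arm_param_in_realisation:
  "{v, w} \<in> E \<Longrightarrow> 0 \<le> s \<Longrightarrow> s \<le> 1 \<Longrightarrow> arm_param v w s \<in> topspace (graph_realisation V E)"
  unfolding arm_param_def by (intro segment_in_realisation) auto

lemma compact_space_realisation: "compact_space (graph_realisation V E)"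
proof -
  have "compactin (powertop_real V) (topspace (graph_realisation V E))"
    unfolding topspace_realisation
  proof (rule compactin_Union)
    show "finite ((\<lambda>(v, w). segment v w ` {0..1}) ` {(v, w). {v, w} \<in> E})"
      by (rule finite_imageI, rule finite_subset[of _ "V \<times> V"]) (use finite_V adj_V in auto)
    fix K assume "K \<in> (\<lambda>(v, w). segment v w ` {0..1}) ` {(v, w). {v, w} \<in> E}"
    then obtain v w where K: "K = segment v w ` {0..1}" by auto
    have "continuous_map euclideanreal (powertop_real V) (segment v w)"
      unfolding continuous_map_componentwise
    proof (intro conjI ballI)
      fix u assume "u \<in> V"
      then show "continuous_map euclideanreal euclideanreal (\<lambda>s. segment v w s u)"
        unfolding segment_def by (cases "u = v"; cases "u = w") (simp_all add: continuous_on_id continuous_on_diff)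
    qed (auto simp: segment_def)
    then show "compactin (powertop_real V) K"
      unfolding K by (rule image_compactin[rotated]) simp
  qed
  moreover have "graph_realisation V E = subtopology (powertop_real V) (topspace (graph_realisation V E))"
    unfolding graph_realisation_def topspace_subtopology by (rule subtopology_restrict[symmetric])
  ultimately show ?thesis using compact_space_subtopology by metis
qed

text \<open>An end \<open>w\<close> with \<open>S w = T {v, w}\<close> is called saturated: its own
  arm along this edge is a single point.\<close>

lemma not_both_saturated: "{v, w} \<in> E \<Longrightarrow> S v = T {v, w} \<Longrightarrow> S w \<noteq> T {v, w}"
  using inj_S adj_V adj_neq unfolding inj_on_def by metis

text \<open>An edge with a saturated end belongs entirely to the arm from the other end. Any other
  edge is divided at its midpoint between the arms from its two ends.\<close>

lemma realisation_armE:
  assumes "x \<in> topspace (graph_realisation V E)"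
  obtains v w s where "{v, w} \<in> E" "S v \<noteq> T {v, w}" "0 \<le> s" "s \<le> 1" "x = arm_param v w s"
proof -
  obtain v w a where x: "{v, w} \<in> E" "0 \<le> a" "a \<le> 1" "x = segment v w a"
    using assms unfolding topspace_realisation by auto
  have wv: "{w, v} \<in> E" "T {w, v} = T {v, w}" using x by (simp_all add: insert_commute)
  have x': "x = segment w v (1 - a)" using segment_commute x by simp
  consider "S w = T {v, w}" | "S v = T {v, w}" | "S w \<noteq> T {v, w}" "S v \<noteq> T {v, w}" by blast
  then show ?thesis
  proof cases
    case 1
    then show ?thesis using that[of v w a] x not_both_saturated unfolding arm_param_def by metis
  next
    case 2
    then show ?thesis using that[of w v "1 - a"] x x' wv not_both_saturated[OF x(1) 2]
      unfolding arm_param_def by simp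
  next
    case 3
    show ?thesis
    proof (cases "1 / 2 \<le> a")
      case True
      then show ?thesis using that[of v w "2 * a - 1"] x 3 unfolding arm_param_def by simp
    next
      case False
      then show ?thesis using that[of w v "1 - 2 * a"] x x' 3 wv
        unfolding arm_param_def by (simp add: diff_divide_distrib)
    qed
  qed
qed

text \<open>The dart \<open>(v, w)\<close> attains the value if \<open>i\<close> lies in
  \<open>S v\<close>; otherwise the entry 0 does. All other darts stay below.\<close>

lemma weight_arm_param:
  assumes vw: "{v, w} \<in> E" "S v \<noteq> T {v, w}" and s: "0 \<le> s" "s \<le> 1"
  shows "weight (arm_param v w s) i = (if i \<in> T {v, w} then 1 else if i \<in> S v then s else 0)" (is "_ = ?t")
proof -
  define x where "x = arm_param v w s"
  define a where "a = (if S w = T {v, w} then s else (1 + s) / 2)"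
  have V: "v \<in> V" "w \<in> V" "v \<noteq> w" using adj_V vw adj_neq by blast+
  have x: "x v = a" "x w = 1 - a" and x0: "u \<in> V \<Longrightarrow> u \<noteq> v \<Longrightarrow> u \<noteq> w \<Longrightarrow> x u = 0" for u
    unfolding x_def arm_param_def segment_def a_def using V by auto
  have a01: "0 \<le> a" "a \<le> 1" unfolding a_def using s by auto
  have Tv: "T {v, w} \<subseteq> S v" "T {v, w} \<subseteq> S w" using T_S vw by auto
  have t01: "0 \<le> ?t" "?t \<le> 1" using s by auto
  have K1: "2 * a - 1 \<le> ?t" if "i \<in> S v" unfolding a_def using that s by (auto simp: field_simps)
  have K2: "1 - 2 * a \<le> ?t" if "i \<in> S w" unfolding a_def using that s by (auto simp: field_simps)
  have bound: "2 * x p + slope i p q * x q - 1 \<le> ?t" if pq: "{p, q} \<in> E" "i \<in> S p" for p q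
  proof -
    have pqV: "p \<in> V" "q \<in> V" "p \<noteq> q" using adj_V pq adj_neq by blast+
    have iq: "i \<in> S q" if "slope i p q = 2"
      using that T_S[OF pq(1), of q] unfolding slope_def by (auto split: if_splits)
    have sl: "slope i p q = 2 \<or> slope i p q = 1 \<or> slope i p q = 0" unfolding slope_def by auto
    \<comment> \<open>If \<open>p\<close> is neither \<open>v\<close> nor \<open>w\<close>, then
      \<open>x p = 0\<close>: a slope of at most 1 makes the term nonpositive, and slope 2 puts
      \<open>i\<close> into \<open>S q\<close>, so that \<open>K1\<close> or \<open>K2\<close>
      applies with \<open>q\<close> in the place of \<open>p\<close>.\<close>
    consider "p = v" "q = w" | "p = w" "q = v" | "p = v" "q \<noteq> w" | "p = w" "q \<noteq> v"
      | "p \<noteq> v" "p \<noteq> w" "q = v" | "p \<noteq> v" "p \<noteq> w" "q = w" | "p \<noteq> v" "p \<noteq> w" "q \<noteq> v" "q \<noteq> w" by blast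
    then show ?thesis
    proof cases
      case 1
      show ?thesis unfolding 1 x using pq(2) Tv s 1 unfolding slope_def a_def by (auto simp: field_simps)
    next
      case 2
      have "slope i w v = (if i \<in> T {v, w} then 2 else 0)"
        using vw(2) unfolding slope_def by (simp add: insert_commute)
      then show ?thesis using 2 K2 pq(2) x a01 by (auto split: if_splits)
    next
      case 3 then show ?thesis using K1 pq x x0[of q] pqV by auto
    next
      case 4 then show ?thesis using K2 pq x x0[of q] pqV by auto
    next
      case 5 then show ?thesis using sl K1 iq x x0[of p] pqV a01 t01 by auto
    next
      case 6 then show ?thesis using sl K2 iq x x0[of p] pqV a01 t01 by auto
    next
      case 7 then show ?thesis using x0[of p] x0[of q] pqV t01 by auto
    qed
  qed
  have attained: "?t = 0 \<or> (\<exists>(p, q)\<in>darts i. 2 * x p + slope i p q * x q - 1 = ?t)"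
  proof (cases "i \<in> S v")
    case True
    then have "(v, w) \<in> darts i" using vw unfolding darts_def by simp
    moreover have "2 * x v + slope i v w * x w - 1 = ?t"
      using True unfolding slope_def x a_def by (auto simp: field_simps)
    ultimately show ?thesis by blast
  next
    case False then show ?thesis using Tv by auto
  qed
  have "weight x i = ?t"
    unfolding weight_def
  proof (rule Max_eqI)
    show "finite (insert 0 ((\<lambda>(v, w). 2 * x v + slope i v w * x w - 1) ` darts i))"
      using finite_darts by simp
    show "y \<le> ?t" if "y \<in> insert 0 ((\<lambda>(v, w). 2 * x v + slope i v w * x w - 1) ` darts i)" for y
      using that bound t01 unfolding darts_def by auto
    show "?t \<in> insert 0 ((\<lambda>(v, w). 2 * x v + slope i v w * x w - 1) ` darts i)"
      using attained by (force simp del: if_split)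
  qed
  then show ?thesis unfolding x_def .
qed

lemma coords_arm_param:
  assumes "{v, w} \<in> E" "S v \<noteq> T {v, w}" "0 \<le> s" "s \<le> 1"
  shows "coords (arm_param v w s) = arm_coords n (S v) (S v - T {v, w}) (stretch s)"
  unfolding coords_def arm_coords_def weight_arm_param[OF assms]
  using T_S[OF assms(1), of v] by (intro restrict_ext) auto


lemma graph_map_arm_param:
  assumes "{v, w} \<in> E" "S v \<noteq> T {v, w}" "0 \<le> s" "s \<le> 1"
  shows "graph_map (arm_param v w s) = TP_rel n `` {arm_coords n (S v) (S v - T {v, w}) (stretch s)}"
  unfolding graph_map_def coords_arm_param[OF assms] ..

lemma arm_coords_in:
  assumes "e \<in> E" "v \<in> e" "0 \<le> t"
  shows "arm_coords n (S v) (S v - T e) t \<in> topspace (TP_coords n)"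
  using T_S[OF assms(1,2)] T_nonempty[OF assms(1)] assms(3) S_subset by (intro arm_coords_topspace) auto

lemma coords_topspace:
  assumes "x \<in> topspace (graph_realisation V E)" shows "coords x \<in> topspace (TP_coords n)"
proof -
  obtain v w s where "{v, w} \<in> E" "S v \<noteq> T {v, w}" "0 \<le> s" "s \<le> 1" "x = arm_param v w s"
    using assms by (rule realisation_armE)
  then show ?thesis using coords_arm_param arm_coords_in[of "{v, w}" v] stretch_nonneg by simp
qed

lemma continuous_map_weight: "continuous_map (graph_realisation V E) euclideanreal (\<lambda>x. weight x i)"
  unfolding weight_def
proof (rule continuous_map_Max_insert[OF finite_darts])
  fix p assume p: "p \<in> darts i"
  obtain v w where vw: "p = (v, w)" "v \<in> V" "w \<in> V"
    using p adj_V unfolding darts_def by blast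
  have proj: "continuous_map (graph_realisation V E) euclideanreal (\<lambda>x. x u)" if "u \<in> V" for u
    unfolding graph_realisation_def
    using that by (intro continuous_map_from_subtopology continuous_map_product_projection)
  show "continuous_map (graph_realisation V E) euclideanreal (\<lambda>x. case p of (v, w) \<Rightarrow> 2 * x v + slope i v w * x w - 1)"
    unfolding vw(1) prod.case using proj[OF vw(2)] proj[OF vw(3)]
    by (intro continuous_map_diff continuous_map_add continuous_map_real_mult continuous_map_const[THEN iffD2]) auto
qed

lemma continuous_map_coords: "continuous_map (graph_realisation V E) (TP_coords n) coords"
proof -
  have "continuous_map (graph_realisation V E) (product_topology (\<lambda>_. top_of_set {-\<infinity><..}) {..n}) coords"
    unfolding continuous_map_componentwise
  proof (intro conjI ballI)
    show "coords ` topspace (graph_realisation V E) \<subseteq> extensional {..n}" unfolding coords_def by auto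
    fix i assume i: "i \<in> {..n}"
    have "continuous_map euclideanreal (top_of_set {-\<infinity><..}) stretch"
      using isCont_stretch stretch_not_MInf
      by (auto simp: continuous_map_in_subtopology intro: continuous_at_imp_continuous_on)
    from continuous_map_compose[OF continuous_map_weight this, of i]
    show "continuous_map (graph_realisation V E) (top_of_set {-\<infinity><..}) (\<lambda>x. coords x i)"
      using i by (simp add: coords_def comp_def)
  qed
  then show ?thesis
    using coords_topspace unfolding TP_coords_def
    by (auto simp: continuous_map_in_subtopology)
qed

lemma continuous_map_graph_map: "continuous_map (graph_realisation V E) (TP n) graph_map"
  using continuous_map_compose[OF continuous_map_coords continuous_map_TP_class]
  by (simp add: comp_def graph_map_def[abs_def])

text \<open>By the injectivity of \<open>T\<close>, at most one edge at \<open>v\<close> has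
  \<open>S v\<close> as its set. Another edge is used to reach the centre of the star when an arm at
  \<open>v\<close> is degenerate.\<close>

lemma ex_unsaturated:
  assumes "e \<in> E" "v \<in> e" "S v = T e"
  obtains w where "{v, w} \<in> E" "S v \<noteq> T {v, w}"
proof -
  have v: "v \<in> V" using edge_subset assms by blast
  have "{e \<in> E. v \<in> e} \<noteq> {e}" using degree[OF v] by force
  then obtain f where f: "f \<in> E" "v \<in> f" "f \<noteq> e" using assms by blast
  obtain a b where ab: "f = {a, b}" "{a, b} \<in> E" using f(1) by (rule edge_two_ends)
  have "T f \<noteq> T e" using inj_T f assms unfolding inj_on_def by metis
  then have ne: "S v \<noteq> T f" using assms(3) by simp
  have "v = a \<or> v = b" using f(2) ab(1) by blast
  then obtain w where "f = {v, w}" using ab(1) by (elim disjE) (auto simp: insert_commute)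
  then show ?thesis using that[of w] f(1) ne by simp
qed

lemma graph_map_image: "graph_map ` topspace (graph_realisation V E) = (\<Union>v\<in>V. line_of v)"
proof (intro subset_antisym subsetI)
  fix C assume "C \<in> graph_map ` topspace (graph_realisation V E)"
  then obtain x where x: "x \<in> topspace (graph_realisation V E)" "C = graph_map x" by blast
  obtain v w s where vw: "{v, w} \<in> E" "S v \<noteq> T {v, w}" "0 \<le> s" "s \<le> 1" "x = arm_param v w s"
    using x(1) by (rule realisation_armE)
  have "C \<in> arm n (S v) (S v - T {v, w})"
    unfolding arm_def x(2) vw(5) graph_map_arm_param[OF vw(1-4)] using stretch_nonneg[OF vw(4)] by blast
  then show "C \<in> (\<Union>v\<in>V. line_of v)" unfolding line_of_def using vw(1) adj_V by blast
next
  fix C assume "C \<in> (\<Union>v\<in>V. line_of v)"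
  then obtain v e t where ve: "v \<in> V" "e \<in> E" "v \<in> e" and t: "0 \<le> t"
    and C: "C = TP_rel n `` {arm_coords n (S v) (S v - T e) t}"
    unfolding line_of_def arm_def by blast
  have "\<exists>v w s. {v, w} \<in> E \<and> S v \<noteq> T {v, w} \<and> 0 \<le> s \<and> s \<le> 1 \<and>
      C = TP_rel n `` {arm_coords n (S v) (S v - T {v, w}) (stretch s)}"
  proof (cases "S v = T e")
    \<comment> \<open>The arm consists of the centre only, which is also the point
      \<open>s = 1\<close> of another arm at \<open>v\<close>.\<close>
    case True
    obtain w where w: "{v, w} \<in> E" "S v \<noteq> T {v, w}" using ve(2,3) True by (rule ex_unsaturated)
    have "arm_coords n (S v) (S v - T e) t = arm_coords n (S v) (S v - T {v, w}) (stretch 1)"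
      unfolding arm_coords_def True by auto
    then show ?thesis using w C by (intro exI[of _ v] exI[of _ w] exI[of _ 1]) simp
  next
    case False
    obtain a b where ab: "e = {a, b}" "{a, b} \<in> E" using ve(2) by (rule edge_two_ends)
    then obtain w where w: "e = {v, w}" using ve(3) by (metis insertE insert_commute singletonD)
    obtain s where "0 \<le> s" "s \<le> 1" "stretch s = t" using t by (rule stretch_surj)
    then show ?thesis using w ve False C by (intro exI[of _ v] exI[of _ w] exI[of _ s]) simp
  qed
  then obtain v w s where vw: "{v, w} \<in> E" "S v \<noteq> T {v, w}" "0 \<le> s" "s \<le> 1"
    "C = TP_rel n `` {arm_coords n (S v) (S v - T {v, w}) (stretch s)}" by blast
  then have "C = graph_map (arm_param v w s)" using graph_map_arm_param by simp
  then show "C \<in> graph_map ` topspace (graph_realisation V E)"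
    using arm_param_in_realisation[OF vw(1,3,4)] by blast
qed

lemma arm_param_1: "{v, w} \<in> E \<Longrightarrow> arm_param v w 1 = (\<lambda>u\<in>V. if u = v then 1 else 0)"
  unfolding arm_param_def segment_def by (intro restrict_ext) simp

text \<open>The set where the weight is 1 and the set where it is nonzero are
  \<open>T {v, w}\<close> and \<open>S v\<close> for \<open>0 < s < 1\<close>, both
  \<open>S v\<close> for \<open>s = 1\<close>, and both \<open>T {v, w}\<close> for
  \<open>s = 0\<close>. The injectivity of \<open>S\<close> and \<open>T\<close> and the condition
  \<open>S_eq_T\<close> recover the point from them.\<close>

lemma arm_param_inject:
  assumes vw: "{v, w} \<in> E" "S v \<noteq> T {v, w}" "0 \<le> s" "s \<le> 1"
    and vw': "{v', w'} \<in> E" "S v' \<noteq> T {v', w'}" "0 \<le> s'" "s' \<le> 1"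
    and eq: "\<And>i. i \<le> n \<Longrightarrow> (if i \<in> T {v, w} then 1 else if i \<in> S v then s else 0)
               = (if i \<in> T {v', w'} then 1 else if i \<in> S v' then s' else 0)"
  shows "arm_param v w s = arm_param v' w' s'"
proof -
  have V: "v \<in> V" "w \<in> V" "v' \<in> V" "w' \<in> V" "v \<noteq> w" "v' \<noteq> w'" using adj_V adj_neq vw vw' by blast+
  have T: "T {v, w} \<subset> S v" "T {v', w'} \<subset> S v'" using T_S[of _ v] T_S[of _ v'] vw vw' by blast+
  define f where "f i = (if i \<in> T {v, w} then 1 else if i \<in> S v then s else 0 :: real)" for i
  have f': "f i = (if i \<in> T {v', w'} then 1 else if i \<in> S v' then s' else 0)" if "i \<le> n" for i
    using eq[OF that] unfolding f_def .
  have levels: "{i. i \<le> n \<and> f i = 1} = (if t = 1 then B else A)" "{i. i \<le> n \<and> f i \<noteq> 0} = (if t = 0 then A else B)"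
    if f: "\<And>i. i \<le> n \<Longrightarrow> f i = (if i \<in> A then 1 else if i \<in> B then t else 0)" and AB: "A \<subset> B" "B \<subseteq> {..n}" for A B t
  proof -
    have "i \<le> n \<and> f i = 1 \<longleftrightarrow> i \<in> (if t = 1 then B else A)" "i \<le> n \<and> f i \<noteq> 0 \<longleftrightarrow> i \<in> (if t = 0 then A else B)" for i
      using f[of i] AB by (auto split: if_splits)
    then show "{i. i \<le> n \<and> f i = 1} = (if t = 1 then B else A)" "{i. i \<le> n \<and> f i \<noteq> 0} = (if t = 0 then A else B)"
      by blast+
  qed
  note top = levels(1)[OF f_def T(1) S_subset] and supp = levels(2)[OF f_def T(1) S_subset]
  note top' = levels(1)[OF f' T(2) S_subset] and supp' = levels(2)[OF f' T(2) S_subset]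
  have vinj: "v = v'" if "S v = S v'" using that inj_S V unfolding inj_on_def by blast
  have einj: "{v, w} = {v', w'}" if "T {v, w} = T {v', w'}" using that inj_T vw vw' unfolding inj_on_def by blast
  \<comment> \<open>A centre coincides with the end of an arm: \<open>S_eq_T\<close> makes
    \<open>a\<close> an end of the edge, necessarily its saturated end \<open>d\<close>, and the arm
    from \<open>c\<close> runs all the way to \<open>d\<close>.\<close>
  have mixed: "arm_param a b 1 = arm_param c d 0"
    if ab: "{a, b} \<in> E" and cd: "{c, d} \<in> E" "S c \<noteq> T {c, d}" and st: "S a = T {c, d}" for a b c d
  proof -
    have "a \<in> {c, d}" using S_eq_T[OF adj_V(1)[OF ab] cd(1) st] .
    then have "a = d" using cd(2) st by auto
    then show ?thesis
      using st adj_neq[OF cd(1)] unfolding arm_param_1[OF ab] arm_param_def segment_def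
      by (intro restrict_ext) auto
  qed
  consider "s = 1" "s' = 1" | "s = 1" "s' = 0" | "s = 0" "s' = 1" | "s = 0" "s' = 0"
    | "s \<noteq> 0" "s \<noteq> 1" | "s' \<noteq> 0" "s' \<noteq> 1" by blast
  then show ?thesis
  proof cases
    case 1
    then have "v = v'" using top top' vinj by simp
    then show ?thesis using 1 arm_param_1 vw(1) vw'(1) by simp
  next
    case 2
    then show ?thesis using mixed[OF vw(1) vw'(1,2)] top top' by simp
  next
    case 3
    then show ?thesis using mixed[OF vw'(1) vw(1,2)] top top' by simp
  next
    case 4
    then have e: "{v, w} = {v', w'}" using top top' einj by simp
    show ?thesis
    proof (cases "v = v'")
      case True then show ?thesis using e 4 V by (auto simp: doubleton_eq_iff)
    next
      \<comment> \<open>The two arms come from opposite ends of one edge. Neither end is saturated,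
        so both parameters 0 denote the midpoint.\<close>
      case False
      then have "v' = w" "w' = v" using e by (auto simp: doubleton_eq_iff)
      moreover have "{w, v} = {v, w}" by (rule insert_commute)
      ultimately show ?thesis
        using 4 vw(2) vw'(2) V unfolding arm_param_def segment_def by (intro restrict_ext) auto
    qed
  next
    case 5
    then have s: "T {v, w} = (if s' = 1 then S v' else T {v', w'})" "S v = (if s' = 0 then T {v', w'} else S v')"
      using top top' supp supp' by simp_all
    have s': "s' \<noteq> 0" "s' \<noteq> 1" using s T by auto
    then have "T {v, w} = T {v', w'}" "v = v'" using s vinj by auto
    then have "w = w'" using einj V by (auto simp: doubleton_eq_iff)
    obtain i where i: "i \<in> S v" "i \<notin> T {v, w}" using T by blast
    then have "s = s'" using f'[of i] s s' S_subset[of v] unfolding f_def by auto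
    then show ?thesis using \<open>v = v'\<close> \<open>w = w'\<close> by simp
  next
    case 6
    then have s: "T {v', w'} = (if s = 1 then S v else T {v, w})" "S v' = (if s = 0 then T {v, w} else S v)"
      using top top' supp supp' by simp_all
    have s': "s \<noteq> 0" "s \<noteq> 1" using s T by auto
    then have "T {v, w} = T {v', w'}" "v = v'" using s vinj by auto
    then have "w = w'" using einj V by (auto simp: doubleton_eq_iff)
    obtain i where i: "i \<in> S v'" "i \<notin> T {v', w'}" using T by blast
    then have "s = s'" using f'[of i] s s' S_subset[of v'] unfolding f_def by auto
    then show ?thesis using \<open>v = v'\<close> \<open>w = w'\<close> by simp
  qed
qed


text \<open>The representative \<open>coords x\<close> has minimum 0, attained on
  \<open>T {v, w}\<close>, so two representatives of one class cannot differ by a nonzero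
  constant.\<close>

lemma inj_on_graph_map: "inj_on graph_map (topspace (graph_realisation V E))"
proof (rule inj_onI)
  fix x y assume x: "x \<in> topspace (graph_realisation V E)" and y: "y \<in> topspace (graph_realisation V E)"
    and eq: "graph_map x = graph_map y"
  obtain v w s where vw: "{v, w} \<in> E" "S v \<noteq> T {v, w}" "0 \<le> s" "s \<le> 1" "x = arm_param v w s"
    using x by (rule realisation_armE)
  obtain v' w' s' where vw': "{v', w'} \<in> E" "S v' \<noteq> T {v', w'}" "0 \<le> s'" "s' \<le> 1" "y = arm_param v' w' s'"
    using y by (rule realisation_armE)
  define f where "f i = (if i \<in> T {v, w} then 1 else if i \<in> S v then s else 0)" for i
  define f' where "f' i = (if i \<in> T {v', w'} then 1 else if i \<in> S v' then s' else 0)" for i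
  have f01: "0 \<le> f i" "f i \<le> 1" "0 \<le> f' i" "f' i \<le> 1" for i
    using vw(3,4) vw'(3,4) unfolding f_def f'_def by auto
  have cx: "coords x i = stretch (f i)" and cy: "coords y i = stretch (f' i)" if "i \<le> n" for i
    using that unfolding coords_def vw(5) vw'(5) weight_arm_param[OF vw(1-4)] weight_arm_param[OF vw'(1-4)]
      f_def f'_def by auto
  have "(coords x, coords y) \<in> TP_rel n"
    using eq eq_equiv_class[OF _ equiv_TP_rel] coords_topspace[OF y] unfolding graph_map_def by blast
  then obtain c where c: "\<And>i. i \<le> n \<Longrightarrow> stretch (f' i) = ereal c + stretch (f i)"
    unfolding TP_rel_def using cx cy by auto
  have "c = 0"
  proof (rule antisym)
    obtain i where i: "i \<in> T {v', w'}" using T_nonempty[OF vw'(1)] by blast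
    then have "i \<le> n" using T_subset[OF vw'(1)] by auto
    then have "ereal c + stretch (f i) = 0" using c[of i] i unfolding f'_def by simp
    then show "c \<le> 0" using stretch_nonneg[OF f01(2)[of i]] by (cases "stretch (f i)") auto
  next
    obtain i where i: "i \<in> T {v, w}" using T_nonempty[OF vw(1)] by blast
    then have "i \<le> n" using T_subset[OF vw(1)] by auto
    then have "stretch (f' i) = ereal c" using c[of i] i unfolding f_def by simp
    then show "0 \<le> c" using stretch_nonneg[OF f01(4)[of i]] by simp
  qed
  then have "f i = f' i" if "i \<le> n" for i
    using c[OF that] stretch_inject[OF f01(3,1), of i i] by (simp add: zero_ereal_def[symmetric])
  then show "x = y"
    unfolding vw(5) vw'(5) by (intro arm_param_inject[OF vw(1-4) vw'(1-4)]) (simp add: f_def f'_def)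
qed

section \<open>The union as a topological space, and the individual lines\<close>

lemma lines_subset: "(\<Union>v\<in>V. line_of v) \<subseteq> topspace (TP n)"
  unfolding graph_map_image[symmetric] using continuous_map_graph_map
  by (rule continuous_map_image_subset_topspace)

lemma lines_homeomorphic:
  "subtopology (TP n) (\<Union>v\<in>V. line_of v) homeomorphic_space graph_realisation V E"
proof -
  have "homeomorphic_map (graph_realisation V E) (subtopology (TP n) (\<Union>v\<in>V. line_of v)) graph_map"
  proof (rule continuous_imp_homeomorphic_map)
    show "compact_space (graph_realisation V E)" by (rule compact_space_realisation)
    show "Hausdorff_space (subtopology (TP n) (\<Union>v\<in>V. line_of v))"
      by (rule Hausdorff_space_subtopology[OF Hausdorff_space_TP])
    show "continuous_map (graph_realisation V E) (subtopology (TP n) (\<Union>v\<in>V. line_of v)) graph_map"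
      using continuous_map_graph_map graph_map_image by (auto simp: continuous_map_in_subtopology)
    show "graph_map ` topspace (graph_realisation V E) = topspace (subtopology (TP n) (\<Union>v\<in>V. line_of v))"
      using graph_map_image lines_subset by auto
  qed (rule inj_on_graph_map)
  then show ?thesis by (metis homeomorphic_map_imp_homeomorphic_space homeomorphic_space_sym)
qed

text \<open>The classes are \<open>S v - T e\<close> for the three edges at \<open>v\<close>:
  disjoint and covering by \<open>missing_once\<close>, with at most one of them empty because the
  sets \<open>T e\<close> are nonempty.\<close>

lemma line_of_tropical_line:
  fixes val :: "'k::alg_closed_field \<Rightarrow> ereal"
  assumes val: "real_valuation val" and v: "v \<in> V"
  shows "line_of v \<in> tropical_lines val n"
proof -
  obtain e0 e1 e2 where e: "{e \<in> E. v \<in> e} = {e0, e1, e2}" "e0 \<noteq> e1" "e1 \<noteq> e2" "e0 \<noteq> e2"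
    using degree[OF v] by (auto simp: card_3_iff)
  have eE: "e \<in> E \<and> v \<in> e \<longleftrightarrow> e = e0 \<or> e = e1 \<or> e = e2" for e using e(1) by auto
  define P where "P k = S v - T (if k = 0 then e0 else if k = 1 then e1 else e2)" for k :: nat
  have P: "P 0 = S v - T e0" "P 1 = S v - T e1" "P 2 = S v - T e2" unfolding P_def by simp_all
  have disj: "(S v - T e) \<inter> (S v - T f) = {}" if ef: "e \<in> E \<and> v \<in> e" "f \<in> E \<and> v \<in> f" "e \<noteq> f" for e f
  proof (rule ccontr)
    assume "\<not> ?thesis"
    then obtain i where i: "i \<in> S v" "i \<notin> T e" "i \<notin> T f" by blast
    have "(THE h. h \<in> E \<and> v \<in> h \<and> i \<notin> T h) = e" "(THE h. h \<in> E \<and> v \<in> h \<and> i \<notin> T h) = f"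
      by (rule the1_equality[OF missing_once[OF v i(1)] conjI[OF conjunct1[OF ef(1)] conjI[OF conjunct2[OF ef(1)] i(2)]]],
          rule the1_equality[OF missing_once[OF v i(1)] conjI[OF conjunct1[OF ef(2)] conjI[OF conjunct2[OF ef(2)] i(3)]]])
    then show False using ef(3) by simp
  qed
  have cover: "S v = P 0 \<union> P 1 \<union> P 2"
  proof
    show "S v \<subseteq> P 0 \<union> P 1 \<union> P 2"
    proof
      fix i assume i: "i \<in> S v"
      obtain e where e: "e \<in> E \<and> v \<in> e" "i \<notin> T e" by (rule ex1E[OF missing_once[OF v i]]) blast
      then have "e = e0 \<or> e = e1 \<or> e = e2" using eE by simp
      then show "i \<in> P 0 \<union> P 1 \<union> P 2" using i e(2) unfolding P by (elim disjE) simp_all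
    qed
    show "P 0 \<union> P 1 \<union> P 2 \<subseteq> S v" unfolding P_def by blast
  qed
  have ne: "S v - (S v - T e) \<noteq> {}" if "e \<in> E \<and> v \<in> e" for e
    using T_S[of e v] T_nonempty[of e] that by blast
  have d: "P 0 \<inter> P 1 = {}" "P 0 \<inter> P 2 = {}" "P 1 \<inter> P 2 = {}"
    unfolding P using disj eE e by metis+
  have "(\<Union>k\<in>{0, 1, 2}. arm n (S v) (P k)) \<in> tropical_lines val n"
  proof (rule union_of_arms_tropical_line[OF _ _ d])
    show "valued_field val" using val by (rule valued_field.intro)
    show "P 0 \<union> P 1 \<union> P 2 \<subseteq> {..n}" using cover S_subset by blast
    have "S v - P 0 \<noteq> {}" "S v - P 1 \<noteq> {}" "S v - P 2 \<noteq> {}" unfolding P using ne eE by blast+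
    then show "P 1 \<union> P 2 \<noteq> {}" "P 0 \<union> P 2 \<noteq> {}" "P 0 \<union> P 1 \<noteq> {}" using cover by blast+
  qed (rule cover)
  also have "(\<Union>k\<in>{0, 1, 2}. arm n (S v) (P k)) = line_of v"
    unfolding line_of_def e(1) by (simp add: P del: One_nat_def)
  finally show ?thesis .
qed

text \<open>With \<open>ex_line_of_support\<close> this recovers \<open>S v\<close> as the set of
  coordinates that are finite somewhere on the line. Distinct vertices thus give distinct lines, as
  the count of lines requires.\<close>

lemma line_of_support:
  assumes C: "C \<in> line_of v" and q: "q \<in> C" and i: "i \<le> n" "q i \<noteq> \<infinity>"
  shows "i \<in> S v"
proof -
  obtain e t where "C = TP_rel n `` {arm_coords n (S v) (S v - T e) t}"
    using C unfolding line_of_def arm_def by blast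
  then have "(arm_coords n (S v) (S v - T e) t, q) \<in> TP_rel n" using q by simp
  then have "arm_coords n (S v) (S v - T e) t i \<noteq> \<infinity>" using i unfolding TP_rel_def by auto
  then show ?thesis using i(1) unfolding arm_coords_def by (simp split: if_splits)
qed

lemma ex_line_of_support:
  assumes i: "i \<in> S v" obtains C q where "C \<in> line_of v" "q \<in> C" "i \<le> n" "q i \<noteq> \<infinity>"
proof -
  obtain e where e: "e \<in> E" "v \<in> e" using i unfolding vertex_code_def by blast
  let ?q = "arm_coords n (S v) (S v - T e) 0"
  have le: "i \<le> n" using i S_subset[of v] by auto
  have "TP_rel n `` {?q} \<in> line_of v"
    unfolding line_of_def arm_def using e by (intro UN_I[of e]) auto
  moreover have "?q \<in> TP_rel n `` {?q}" by (rule in_TP_class[OF arm_coords_in[OF e order_refl]])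
  moreover have "?q i \<noteq> \<infinity>" using i le unfolding arm_coords_def by simp
  ultimately show ?thesis using that le by blast
qed

lemma line_of_mono: assumes "line_of v \<subseteq> line_of w" shows "S v \<subseteq> S w"
proof
  fix i assume "i \<in> S v"
  then obtain C q where "C \<in> line_of v" "q \<in> C" "i \<le> n" "q i \<noteq> \<infinity>" by (rule ex_line_of_support)
  then show "i \<in> S w" using line_of_support assms by blast
qed

lemma inj_line_of: "inj_on line_of V"
proof (rule inj_onI)
  fix v w assume vw: "v \<in> V" "w \<in> V" "line_of v = line_of w"
  then have "S v = S w" using line_of_mono[of v w] line_of_mono[of w v] by simp
  then show "v = w" using inj_S vw unfolding inj_on_def by blast
qed

end

text \<open>The union of the lines is already a copy of the graph, so a constant homotopy is
  enough.\<close>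

lemma deformation_retract_of_space_topspace: "deformation_retract_of_space (topspace X) X"
  unfolding deformation_retract_of_space_def
  by (intro conjI exI[of _ id]) (simp_all add: retraction_maps_def)


theorem corollary1p4:
  fixes val :: "'k::alg_closed_field \<Rightarrow> ereal"
    and V :: "'v set" and E :: "'v set set"
  assumes "real_valuation val"
    and "finite_simple_graph V E"
    and "regular_graph 3 V E"
    and "edge_connected 3 V E"
    and "planar_graph V E"
  shows "\<exists>\<A>. tropical_graph_curve val V E \<A>"
proof -
  note V = coded_graph_exists(2)[OF assms(2-4)]
  obtain T where "coded_graph V E (genus V E - 1) T" using coded_graph_exists(1)[OF assms(2-4)] by blast
  then interpret coded_graph V E "genus V E - 1" T .
  let ?X = "subtopology (TP (genus V E - 1)) (\<Union>v\<in>V. line_of v)"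
  have "subtopology ?X (topspace ?X) homeomorphic_space graph_realisation V E"
    unfolding subtopology_topspace by (rule lines_homeomorphic)
  then have "tropical_graph_curve val V E (line_of ` V)"
    unfolding tropical_graph_curve_def Let_def
    using finite_V card_image[OF inj_line_of] V line_of_tropical_line[OF assms(1)]
      deformation_retract_of_space_topspace[of ?X]
    by (intro conjI exI[of _ "topspace ?X"]) auto
  then show ?thesis by blast
qed

end
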